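(* Let $\eta\in(0,1)$, $N_B\ge0$, $N_T=(1-\eta)N_B$, $N_S>0$, and let the bipartite resource $\rho_{SI}$ be the two-mode squeezed vacuum (TMSV) state with mean photon number $N_S$. If $N_T>\max\{\eta,\ \eta N_S-1\}$, then \begin{align*} \chi_{\mathrm{ring}}^{\mathrm{TMSV}}\ \ge\ {}&C_{\mathrm{EA}}(\eta,N_S,N_T)+g(N_T)-g(\eta N_S+N_T)\\ &+(2\eta N_S+N_T)N_S\log\left(\frac{(N_T+1)(N_T-\eta)}{N_T(N_T-\eta+1)}\right)+N_S\log\left(\frac{N_T+1}{N_T-\eta+1}\right)\\ &+\eta N_S\log\left(\frac{(N_T+1)^2(N_T-\eta)}{N_T^2(N_T-\eta+1)}\right). \end{align*}
   Context: All logarithms are natural. $g(x)=(x+1)\log(x+1)-x\log x$ (with $g(0)=0$). The entanglement-assisted capacity is $$C_{\mathrm{EA}}(\eta,N_S,N_T)=g(N_S)+g(\eta N_S+N_T)-g\Big(\frac{\mu_+-1}2\Big)-g\Big(\frac{\mu_--1}2\Big),$$ $$\mu_\pm=\sqrt{(N_S+\eta N_S+N_T+1)^2-4\eta N_S(N_S+1)}\ \pm\ \big(N_T-(1-\eta)N_S\big).$$ Lossy thermal bosonic channel: with transmissivity $\eta\in(0,1)$ and noise mean photon number $N_B$, the channel mixes the input mode $\hat a$ with an environment mode $\hat c$ in the thermal state $\rho_{N_B}=\sum_{n\ge0}\frac{N_B^n}{(N_B+1)^{n+1}}|n\rangle\langle n|$ on a beamsplitter; the accessible output mode is $\hat b=\sqrt\eta\,\hat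 a+\sqrt{1-\eta}\,\hat c$ and the mode $\hat e=-\sqrt{1-\eta}\,\hat a+\sqrt\eta\,\hat c$ is lost (traced out). With $N_T=(1-\eta)N_B$ this is called the $(\eta,N_T)$-bosonic channel. TMSV state: $\rho_{SI}=|\psi\rangle\langle\psi|_{SI}$ with $|\psi\rangle_{SI}=\sum_{k\ge0}\sqrt{\frac{N_S^k}{(N_S+1)^{k+1}}}\,|k\rangle_S|k\rangle_I$ (signal mode $S$, idler mode $I$). $\rho_{BI}^{\theta}$ is the state obtained from $\rho_{SI}$ by applying the phase shift $\theta$ (unitary $e^{i\theta\hat a^\dagger\hat a}$) to the signal mode $S$ and then sending it through the $(\eta,N_T)$-bosonic channel (output mode $B$), the idler $I$ being left unchanged. With $\mathbb H(\rho)=-\mathrm{tr}(\rho\log\rho)$ the von Neumann entropy, the Holevo information of the ring state is $$\chi_{\mathrm{ring}}^{\mathrm{TMSV}}=\mathbb H\Big(\frac1{2\pi}\int_0^{2\pi}\rho_{BI}^\theta\,d\theta\Big)-\frac1{2\pi}\int_0^{2\pi}\mathbb H(\rho_{BI}^\theta)\,d\theta .$$ *)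

theory Defs
  imports "HOL-Analysis.Analysis"
begin

text \<open>
  An operator on the Hilbert space \<open>\<ell>\<^sup>2('a)\<close> is represented by its matrix
  \<open>A i j = \<langle>i|A|j\<rangle>\<close> in the canonical orthonormal basis.  For one bosonic mode the basis is
  the Fock (photon number) basis, indexed by \<^typ>\<open>nat\<close>; for several modes it is the
  product basis, indexed by tuples.
\<close>

type_synonym 'a ket = "'a \<Rightarrow> complex"
type_synonym 'a operator = "'a \<Rightarrow> 'a \<Rightarrow> complex"

definition op_id :: "'a operator" where
  "op_id i j = (if i = j then 1 else 0)"

definition op_diag :: "('a \<Rightarrow> complex) \<Rightarrow> 'a operator" where
  "op_diag d i j = (if i = j then d i else 0)"

definition op_mult :: "'a operator \<Rightarrow> 'a operator \<Rightarrow> 'a operator" where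
  "op_mult A B i j = (\<Sum>\<^sub>\<infinity>k. A i k * B k j)"

definition op_adj :: "'a operator \<Rightarrow> 'a operator" where
  "op_adj A i j = cnj (A j i)"

definition op_conjugate :: "'a operator \<Rightarrow> 'a operator \<Rightarrow> 'a operator" where
  "op_conjugate U A = op_mult (op_mult U A) (op_adj U)"

definition op_tensor :: "'a operator \<Rightarrow> 'b operator \<Rightarrow> ('a \<times> 'b) operator" where
  "op_tensor A B x y = A (fst x) (fst y) * B (snd x) (snd y)"

definition op_trace :: "'a operator \<Rightarrow> complex" where
  "op_trace A = (\<Sum>\<^sub>\<infinity>i. A i i)"

definition partial_trace_snd :: "('a \<times> 'b) operator \<Rightarrow> 'a operator" where
  "partial_trace_snd A i j = (\<Sum>\<^sub>\<infinity>e. A (i, e) (j, e))"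

definition projector :: "'a ket \<Rightarrow> 'a operator" where
  "projector \<psi> i j = \<psi> i * cnj (\<psi> j)"

definition op_unitary :: "'a operator \<Rightarrow> bool" where
  "op_unitary U \<longleftrightarrow> op_mult (op_adj U) U = op_id \<and> op_mult U (op_adj U) = op_id"

text \<open>
  \<open>A = \<Sum>\<^sub>k l\<^sub>k |v\<^sub>k\<rangle>\<langle>v\<^sub>k|\<close> with the columns \<open>v\<^sub>k\<close> of \<open>v\<close> forming an orthonormal basis.
  The boundedness condition makes all the sums involved absolutely convergent, which excludes
  decompositions in which \<^const>\<open>infsum\<close> would return its default value.
\<close>

definition diagonalizes :: "'a operator \<Rightarrow> ('a \<Rightarrow> real) \<Rightarrow> 'a operator \<Rightarrow> bool" where
  "diagonalizes v l A \<longleftrightarrow>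
     op_unitary v \<and> bounded (range l) \<and> A = op_conjugate v (op_diag (\<lambda>k. complex_of_real (l k)))"

text \<open>
  Functional calculus for self-adjoint operators with an orthonormal eigenbasis (in particular
  for density operators); the result does not depend on the chosen eigenbasis.
\<close>

definition op_fun :: "(real \<Rightarrow> real) \<Rightarrow> 'a operator \<Rightarrow> 'a operator" where
  "op_fun f A =
     (let (v, l) = (SOME p. diagonalizes (fst p) (snd p) A)
      in op_conjugate v (op_diag (\<lambda>k. complex_of_real (f (l k)))))"

text \<open>
  Since \<^term>\<open>0 * ln 0 = (0::real)\<close>, the convention \<open>0 log 0 = 0\<close> is built in.
  For a state of infinite entropy the sum in the trace diverges and the value is 0 by
  convention; the states below have finite mean photon number, hence finite entropy.
\<close>

definition vN_entropy :: "'a operator \<Rightarrow> real" where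
  "vN_entropy \<rho> = - Re (op_trace (op_fun (\<lambda>x. x * ln x) \<rho>))"

definition raise_fst :: "(nat \<times> nat) ket \<Rightarrow> (nat \<times> nat) ket" where
  "raise_fst \<psi> x = complex_of_real (sqrt (real (fst x))) * \<psi> (fst x - 1, snd x)"

definition raise_snd :: "(nat \<times> nat) ket \<Rightarrow> (nat \<times> nat) ket" where
  "raise_snd \<psi> x = complex_of_real (sqrt (real (snd x))) * \<psi> (fst x, snd x - 1)"

definition lower_fst :: "(nat \<times> nat) ket \<Rightarrow> (nat \<times> nat) ket" where
  "lower_fst \<psi> x = complex_of_real (sqrt (real (fst x + 1))) * \<psi> (fst x + 1, snd x)"

definition lower_snd :: "(nat \<times> nat) ket \<Rightarrow> (nat \<times> nat) ket" where
  "lower_snd \<psi> x = complex_of_real (sqrt (real (snd x + 1))) * \<psi> (fst x, snd x + 1)"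

definition raise_comb :: "real \<Rightarrow> real \<Rightarrow> (nat \<times> nat) ket \<Rightarrow> (nat \<times> nat) ket" where
  "raise_comb p q \<psi> x = complex_of_real p * raise_fst \<psi> x + complex_of_real q * raise_snd \<psi> x"

definition vacuum :: "(nat \<times> nat) ket" where
  "vacuum x = (if x = (0, 0) then 1 else 0)"

text \<open>
  Inverting \<open>b = \<surd>\<eta> a + \<surd>(1-\<eta>) c\<close>, \<open>e = -\<surd>(1-\<eta>) a + \<surd>\<eta> c\<close> gives
  \<open>a\<^sup>\<dagger> = \<surd>\<eta> b\<^sup>\<dagger> - \<surd>(1-\<eta>) e\<^sup>\<dagger>\<close> and \<open>c\<^sup>\<dagger> = \<surd>(1-\<eta>) b\<^sup>\<dagger> + \<surd>\<eta> e\<^sup>\<dagger>\<close>; substituting these into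
  \<open>|n\<rangle>\<^sub>a|m\<rangle>\<^sub>c = (a\<^sup>\<dagger>)\<^sup>n (c\<^sup>\<dagger>)\<^sup>m |0,0\<rangle> / \<surd>(n! m!)\<close> yields the image of \<open>|n\<rangle>\<^sub>a|m\<rangle>\<^sub>c\<close> as a
  state of the output modes \<open>(b, e)\<close>.
\<close>

definition beamsplitter_ket :: "real \<Rightarrow> nat \<Rightarrow> nat \<Rightarrow> (nat \<times> nat) ket" where
  "beamsplitter_ket \<eta> n m x =
     ((raise_comb (sqrt \<eta>) (- sqrt (1 - \<eta>)) ^^ n)
       ((raise_comb (sqrt (1 - \<eta>)) (sqrt \<eta>) ^^ m) vacuum)) x
     / complex_of_real (sqrt (fact n * fact m))"

definition beamsplitter :: "real \<Rightarrow> (nat \<times> nat) operator" where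
  "beamsplitter \<eta> x y = beamsplitter_ket \<eta> (fst y) (snd y) x"

text \<open>
  The beamsplitter acting on signal and environment and trivially on an idler; rows are indexed
  by \<open>((b, i), e)\<close>, columns by \<open>((s, i), c)\<close>.
\<close>

definition beamsplitter_ext :: "real \<Rightarrow> ((nat \<times> 'i) \<times> nat) operator" where
  "beamsplitter_ext \<eta> x y =
     beamsplitter \<eta> (fst (fst x), snd x) (fst (fst y), snd y) * op_id (snd (fst x)) (snd (fst y))"

definition thermal_state :: "real \<Rightarrow> nat operator" where
  "thermal_state N = op_diag (\<lambda>n. complex_of_real (N ^ n / (N + 1) ^ (n + 1)))"

text \<open>
  The channel on the first factor of a bipartite state, parametrized by the transmissivity and
  the mean photon number \<open>N\<^sub>B\<close> of the environment; in terms of \<open>N\<^sub>T = (1 - \<eta>) N\<^sub>B\<close> it is the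
  \<open>(\<eta>, N\<^sub>T)\<close>-bosonic channel.
\<close>

definition lossy_thermal_channel :: "real \<Rightarrow> real \<Rightarrow> (nat \<times> 'i) operator \<Rightarrow> (nat \<times> 'i) operator" where
  "lossy_thermal_channel \<eta> N\<^sub>B \<rho> =
     partial_trace_snd (op_conjugate (beamsplitter_ext \<eta>) (op_tensor \<rho> (thermal_state N\<^sub>B)))"

definition phase_shift :: "real \<Rightarrow> nat operator" where
  "phase_shift \<theta> = op_diag (\<lambda>n. exp (\<i> * complex_of_real \<theta> * of_nat n))"

definition tmsv_ket :: "real \<Rightarrow> (nat \<times> nat) ket" where
  "tmsv_ket N x =
     (if fst x = snd x then complex_of_real (sqrt (N ^ fst x / (N + 1) ^ (fst x + 1))) else 0)"

definition tmsv_state :: "real \<Rightarrow> (nat \<times> nat) operator" where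
  "tmsv_state N = projector (tmsv_ket N)"

definition output_state ::
  "real \<Rightarrow> real \<Rightarrow> (nat \<times> 'i) operator \<Rightarrow> real \<Rightarrow> (nat \<times> 'i) operator" where
  "output_state \<eta> N\<^sub>B \<rho> \<theta> =
     lossy_thermal_channel \<eta> N\<^sub>B (op_conjugate (op_tensor (phase_shift \<theta>) op_id) \<rho>)"

text \<open>
  The phase average is taken entrywise; the family \<open>\<theta> \<mapsto> \<rho> \<theta>\<close> it is applied to is continuous
  in trace norm, so these are the matrix entries of the operator-valued integral.
\<close>

definition phase_average :: "(real \<Rightarrow> 'a operator) \<Rightarrow> 'a operator" where
  "phase_average \<rho> i j = integral {0..2 * pi} (\<lambda>\<theta>. \<rho> \<theta> i j) / complex_of_real (2 * pi)"

definition holevo_ring :: "real \<Rightarrow> real \<Rightarrow> (nat \<times> 'i) operator \<Rightarrow> real" where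
  "holevo_ring \<eta> N\<^sub>B \<rho> =
     vN_entropy (phase_average (output_state \<eta> N\<^sub>B \<rho>))
     - 1 / (2 * pi) * integral {0..2 * pi} (\<lambda>\<theta>. vN_entropy (output_state \<eta> N\<^sub>B \<rho> \<theta>))"

definition g :: "real \<Rightarrow> real" where
  "g x = (x + 1) * ln (x + 1) - x * ln x"

definition mu_plus :: "real \<Rightarrow> real \<Rightarrow> real \<Rightarrow> real" where
  "mu_plus \<eta> N\<^sub>S N\<^sub>T =
     sqrt ((N\<^sub>S + \<eta> * N\<^sub>S + N\<^sub>T + 1)\<^sup>2 - 4 * \<eta> * N\<^sub>S * (N\<^sub>S + 1)) + (N\<^sub>T - (1 - \<eta>) * N\<^sub>S)"

definition mu_minus :: "real \<Rightarrow> real \<Rightarrow> real \<Rightarrow> real" where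
  "mu_minus \<eta> N\<^sub>S N\<^sub>T =
     sqrt ((N\<^sub>S + \<eta> * N\<^sub>S + N\<^sub>T + 1)\<^sup>2 - 4 * \<eta> * N\<^sub>S * (N\<^sub>S + 1)) - (N\<^sub>T - (1 - \<eta>) * N\<^sub>S)"

definition C_EA :: "real \<Rightarrow> real \<Rightarrow> real \<Rightarrow> real" where
  "C_EA \<eta> N\<^sub>S N\<^sub>T =
     g N\<^sub>S + g (\<eta> * N\<^sub>S + N\<^sub>T) - g ((mu_plus \<eta> N\<^sub>S N\<^sub>T - 1) / 2) - g ((mu_minus \<eta> N\<^sub>S N\<^sub>T - 1) / 2)"

text \<open>
  The defining mode relations hold for \<^const>\<open>beamsplitter_ket\<close>: with \<open>U\<close> the beamsplitter,
  \<open>b U = U (\<surd>\<eta> a + \<surd>(1-\<eta>) c)\<close> and \<open>e U = U (-\<surd>(1-\<eta>) a + \<surd>\<eta> c)\<close> on number states.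
\<close>

lemma lower_fst_raise_comb:
  "lower_fst (raise_comb p q \<psi>) =
     (\<lambda>x. raise_comb p q (lower_fst \<psi>) x + complex_of_real p * \<psi> x)"
proof
  fix x :: "nat \<times> nat"
  define r where "r n = complex_of_real (sqrt (real n))" for n
  have r_sq: "r n * r n = of_nat n" for n
    by (simp add: r_def flip: of_real_mult)
  have r_sq': "r n * (r n * z) = of_nat n * z" for n z
    by (simp add: r_sq flip: mult.assoc)
  have r0: "r 0 = 0" by (simp add: r_def)
  obtain b e where x: "x = (b, e)" by fastforce
  show "lower_fst (raise_comb p q \<psi>) x = raise_comb p q (lower_fst \<psi>) x + complex_of_real p * \<psi> x"
    unfolding x lower_fst_def raise_comb_def raise_fst_def raise_snd_def r_def[symmetric]
    by (cases b) (simp_all add: r0 r_sq r_sq' algebra_simps)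
qed

lemma lower_snd_raise_comb:
  "lower_snd (raise_comb p q \<psi>) =
     (\<lambda>x. raise_comb p q (lower_snd \<psi>) x + complex_of_real q * \<psi> x)"
proof
  fix x :: "nat \<times> nat"
  define r where "r n = complex_of_real (sqrt (real n))" for n
  have r_sq: "r n * r n = of_nat n" for n
    by (simp add: r_def flip: of_real_mult)
  have r_sq': "r n * (r n * z) = of_nat n * z" for n z
    by (simp add: r_sq flip: mult.assoc)
  have r0: "r 0 = 0" by (simp add: r_def)
  obtain b e where x: "x = (b, e)" by fastforce
  show "lower_snd (raise_comb p q \<psi>) x = raise_comb p q (lower_snd \<psi>) x + complex_of_real q * \<psi> x"
    unfolding x lower_snd_def raise_comb_def raise_fst_def raise_snd_def r_def[symmetric]
    by (cases e) (simp_all add: r0 r_sq r_sq' algebra_simps)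
qed

lemma raise_comb_linear:
  "raise_comb p q (\<lambda>x. \<psi> x + c * \<phi> x) = (\<lambda>x. raise_comb p q \<psi> x + c * raise_comb p q \<phi> x)"
  by (rule ext) (simp add: raise_comb_def raise_fst_def raise_snd_def algebra_simps)

lemma raise_comb_funpow_linear:
  "(raise_comb p q ^^ n) (\<lambda>x. \<psi> x + c * \<phi> x)
     = (\<lambda>x. (raise_comb p q ^^ n) \<psi> x + c * (raise_comb p q ^^ n) \<phi> x)"
  by (induction n) (simp_all add: raise_comb_linear)

lemma raise_comb_funpow_zero: "(raise_comb p q ^^ n) (\<lambda>x. 0) = (\<lambda>x. 0)"
proof (induction n)
  case (Suc n)
  then show ?case
    by (auto simp: raise_comb_def raise_fst_def raise_snd_def)
qed simp

lemma lower_raise_comb_funpow: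
  assumes L: "\<And>\<psi>. L (raise_comb p q \<psi>) = (\<lambda>x. raise_comb p q (L \<psi>) x + c * \<psi> x)"
  shows "L ((raise_comb p q ^^ n) \<psi>) =
    (\<lambda>x. (raise_comb p q ^^ n) (L \<psi>) x + (of_nat n * c) * (raise_comb p q ^^ (n - 1)) \<psi> x)"
proof (induction n)
  case (Suc n)
  have "L ((raise_comb p q ^^ Suc n) \<psi>) =
    (\<lambda>x. raise_comb p q (L ((raise_comb p q ^^ n) \<psi>)) x + c * (raise_comb p q ^^ n) \<psi> x)"
    by (simp add: L)
  also have "\<dots> = (\<lambda>x. (raise_comb p q ^^ Suc n) (L \<psi>) x
    + (of_nat n * c) * raise_comb p q ((raise_comb p q ^^ (n - 1)) \<psi>) x
    + c * (raise_comb p q ^^ n) \<psi> x)"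
    unfolding Suc.IH raise_comb_linear by simp
  finally show ?case
    by (cases n) (simp_all add: algebra_simps)
qed simp

lemma lower_beamsplitter_unnormalized:
  assumes "\<And>\<psi>. L (raise_comb p q \<psi>) = (\<lambda>x. raise_comb p q (L \<psi>) x + c * \<psi> x)"
    and "\<And>\<psi>. L (raise_comb p' q' \<psi>) = (\<lambda>x. raise_comb p' q' (L \<psi>) x + c' * \<psi> x)"
    and "L vacuum = (\<lambda>x. 0)"
  shows "L ((raise_comb p q ^^ n) ((raise_comb p' q' ^^ m) vacuum)) =
    (\<lambda>x. of_nat n * c * (raise_comb p q ^^ (n - 1)) ((raise_comb p' q' ^^ m) vacuum) x
       + of_nat m * c' * (raise_comb p q ^^ n) ((raise_comb p' q' ^^ (m - 1)) vacuum) x)"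
  using raise_comb_funpow_linear[of n p q "\<lambda>x. 0"]
  by (simp add: lower_raise_comb_funpow[of L, OF assms(1)] lower_raise_comb_funpow[of L, OF assms(2)]
      assms(3) raise_comb_funpow_zero algebra_simps)

lemma of_nat_div_sqrt_fact:
  "of_nat n / complex_of_real (sqrt (fact n * y))
     = complex_of_real (sqrt (real n)) / complex_of_real (sqrt (fact (n - 1) * y))"
proof (cases n)
  case (Suc k)
  have "real (Suc k) = sqrt (real (Suc k)) * sqrt (real (Suc k))"
    by simp
  then have "real (Suc k) / sqrt (fact (Suc k) * y) = sqrt (real (Suc k)) / sqrt (fact k * y)"
    unfolding fact_Suc real_sqrt_mult of_nat_mult of_nat_fact
    by (metis mult.assoc mult_divide_mult_cancel_left_if of_nat_0_less_iff real_sqrt_gt_0_iff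
        less_irrefl zero_less_Suc)
  then show ?thesis
    unfolding Suc by (metis diff_Suc_1 of_real_divide of_real_of_nat_eq)
qed simp

lemma beamsplitter_normalization:
  fixes X Y c c' :: complex
  shows "(of_nat n * c * X + of_nat m * c' * Y) / complex_of_real (sqrt (fact n * fact m)) =
    c * complex_of_real (sqrt (real n)) * (X / complex_of_real (sqrt (fact (n - 1) * fact m))) +
    c' * complex_of_real (sqrt (real m)) * (Y / complex_of_real (sqrt (fact n * fact (m - 1))))"
proof -
  have "(of_nat n * c * X + of_nat m * c' * Y) / complex_of_real (sqrt (fact n * fact m)) =
    c * X * (of_nat n / complex_of_real (sqrt (fact n * fact m))) +
    c' * Y * (of_nat m / complex_of_real (sqrt (fact m * fact n)))"
    by (simp add: add_divide_distrib mult_ac)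
  then show ?thesis
    unfolding of_nat_div_sqrt_fact by (simp add: mult_ac)
qed

lemma beamsplitter_mode_b:
  "lower_fst (beamsplitter_ket \<eta> n m) = (\<lambda>x.
     complex_of_real (sqrt \<eta>) * complex_of_real (sqrt (real n)) * beamsplitter_ket \<eta> (n - 1) m x +
     complex_of_real (sqrt (1 - \<eta>)) * complex_of_real (sqrt (real m)) * beamsplitter_ket \<eta> n (m - 1) x)"
proof -
  have vac: "lower_fst vacuum = (\<lambda>x. 0)"
    by (auto simp: lower_fst_def vacuum_def)
  have "lower_fst (beamsplitter_ket \<eta> n m) = (\<lambda>x. lower_fst
     ((raise_comb (sqrt \<eta>) (- sqrt (1 - \<eta>)) ^^ n) ((raise_comb (sqrt (1 - \<eta>)) (sqrt \<eta>) ^^ m) vacuum)) x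
       / complex_of_real (sqrt (fact n * fact m)))"
    unfolding lower_fst_def beamsplitter_ket_def by simp
  then show ?thesis
    unfolding lower_beamsplitter_unnormalized[of lower_fst, OF lower_fst_raise_comb lower_fst_raise_comb vac]
      beamsplitter_normalization beamsplitter_ket_def .
qed

lemma beamsplitter_mode_e:
  "lower_snd (beamsplitter_ket \<eta> n m) = (\<lambda>x.
     complex_of_real (- sqrt (1 - \<eta>)) * complex_of_real (sqrt (real n)) * beamsplitter_ket \<eta> (n - 1) m x +
     complex_of_real (sqrt \<eta>) * complex_of_real (sqrt (real m)) * beamsplitter_ket \<eta> n (m - 1) x)"
proof -
  have vac: "lower_snd vacuum = (\<lambda>x. 0)"
    by (auto simp: lower_snd_def vacuum_def)
  have "lower_snd (beamsplitter_ket \<eta> n m) = (\<lambda>x. lower_snd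
     ((raise_comb (sqrt \<eta>) (- sqrt (1 - \<eta>)) ^^ n) ((raise_comb (sqrt (1 - \<eta>)) (sqrt \<eta>) ^^ m) vacuum)) x
       / complex_of_real (sqrt (fact n * fact m)))"
    unfolding lower_snd_def beamsplitter_ket_def by simp
  then show ?thesis
    unfolding lower_beamsplitter_unnormalized[of lower_snd, OF lower_snd_raise_comb lower_snd_raise_comb vac]
      beamsplitter_normalization beamsplitter_ket_def .
qed

end

(*
  In the Fock basis the phase average destroys all coherences between different idler photon
  numbers, and the channel preserves the difference of output and idler photon numbers along the
  TMSV state, so the averaged state is diagonal with explicit entries
    P(b,k) = C q1^b q2^k Q(b,k),   Q(b,k) = sum_m (b choose m) (k choose m) w^m,
  where 1 - w = (N_T + 1)(N_T - eta) / (N_T (N_T + 1 - eta)).  Bernoulli's inequality gives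
  Q(b,k) <= (1 + w)^(bk) <= (1 - w)^(-bk); inserting this in the Shannon entropy of P and evaluating
  the moments E[b], E[k], E[bk] yields exactly the claimed bound, up to the entropy of a single
  output state.

  That entropy is found by diagonalizing the output state with a two-mode squeezing operator.  All
  operators involved are Gaussian: their entries are the Taylor coefficients of
  exp (p z1 z2 + p' w1 w2 + q1 z1 w1 + q2 z2 w2), normalized by square roots of factorials.  Such
  operators compose by a simple rule on (p, p', q1, q2), which is proved without Gaussian integrals
  by showing that both sides satisfy the same first-order (ladder) recursions.
*)
theory Submission
  imports Defs
begin

subsection \<open>Square-summable families and the functional calculus\<close>

text \<open>\<open>op_fun\<close> picks an eigenbasis by a choice operator, so no entropy can be
  computed before any two diagonalizations of an operator are shown to give the same result. The
  double sums in that argument need not converge absolutely; estimates in the style of Bessel's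
  inequality replace Fubini's theorem there.

  A single kernel format serves the whole proof because of how the indices are grouped. The TMSV
  state ties the signal number to the idler number, so the signal input of the beamsplitter can be
  read as a row index beside the output mode, with environment and lost mode as column indices. In
  this grouping the beamsplitter amplitudes have the same form as a two-mode squeezing operator, and
  tracing out the lost mode together with summing over the environment is one composition of
  kernels.

  The last weakening, from 1 + w to 1 / (1 - w), produces exactly the logarithm in the claim; w < 1
  holds because \<open>N\<^sub>T > \<eta>\<close>.\<close>

definition l2 :: "('a \<Rightarrow> complex) \<Rightarrow> bool" where
  "l2 x \<longleftrightarrow> (\<lambda>i. (cmod (x i))\<^sup>2) summable_on UNIV"

definition l2_sq :: "('a \<Rightarrow> complex) \<Rightarrow> real" where
  "l2_sq x = (\<Sum>\<^sub>\<infinity>i. (cmod (x i))\<^sup>2)"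

lemma l2_sq_nonneg: "l2_sq x \<ge> 0"
  unfolding l2_sq_def by (rule infsum_nonneg) auto

lemma l2_cnj [simp]: "l2 (\<lambda>i. cnj (x i)) \<longleftrightarrow> l2 x"
  by (simp add: l2_def)

lemma l2_mult_bounded:
  assumes "l2 x" "\<And>i. cmod (c i) \<le> B"
  shows "l2 (\<lambda>i. c i * x i)"
  unfolding l2_def
proof (rule summable_on_comparison_test)
  show "(\<lambda>i. B\<^sup>2 * (cmod (x i))\<^sup>2) summable_on UNIV"
    using assms(1) by (auto simp: l2_def intro: summable_on_cmult_right)
  fix i
  show "(cmod (c i * x i))\<^sup>2 \<le> B\<^sup>2 * (cmod (x i))\<^sup>2"
    using assms(2)[of i] by (auto simp: norm_mult power_mult_distrib intro!: mult_right_mono power_mono)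
qed auto

lemma l2_diff:
  assumes "l2 x" "l2 y"
  shows "l2 (\<lambda>i. x i - y i)"
  unfolding l2_def
proof (rule summable_on_comparison_test)
  show "(\<lambda>i. 2 * (cmod (x i))\<^sup>2 + 2 * (cmod (y i))\<^sup>2) summable_on UNIV"
    using assms by (auto simp: l2_def intro!: summable_on_cmult_right summable_on_add)
  fix i
  have "(cmod (x i - y i))\<^sup>2 \<le> (cmod (x i) + cmod (y i))\<^sup>2"
    by (intro power_mono norm_triangle_ineq4) auto
  also have "\<dots> \<le> 2 * (cmod (x i))\<^sup>2 + 2 * (cmod (y i))\<^sup>2"
    using sum_squares_bound[of "cmod (x i)" "cmod (y i)"] by (simp add: power2_sum)
  finally show "(cmod (x i - y i))\<^sup>2 \<le> 2 * (cmod (x i))\<^sup>2 + 2 * (cmod (y i))\<^sup>2" .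
qed auto

lemma l2_mult_abs_summable:
  assumes "l2 x" "l2 y"
  shows "(\<lambda>i. norm (x i * y i)) summable_on UNIV"
proof (rule summable_on_comparison_test)
  show "(\<lambda>i. (cmod (x i))\<^sup>2 + (cmod (y i))\<^sup>2) summable_on UNIV"
    using assms by (auto simp: l2_def intro!: summable_on_add)
  fix i
  show "norm (x i * y i) \<le> (cmod (x i))\<^sup>2 + (cmod (y i))\<^sup>2"
    using sum_squares_bound[of "cmod (x i)" "cmod (y i)"]
      mult_nonneg_nonneg[OF norm_ge_zero[of "x i"] norm_ge_zero[of "y i"]]
    unfolding real_norm_def abs_of_nonneg[OF norm_ge_zero] norm_mult by linarith
qed auto

lemma l2_mult_summable:
  assumes "l2 x" "l2 y"
  shows "(\<lambda>i. x i * y i) summable_on UNIV"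
  using l2_mult_abs_summable[OF assms] by (rule Infinite_Sum.abs_summable_summable)

lemma l2_Cauchy_Schwarz:
  assumes "l2 x" "l2 y"
  shows "cmod (\<Sum>\<^sub>\<infinity>i. x i * y i) \<le> sqrt (l2_sq x) * sqrt (l2_sq y)"
proof -
  have "cmod (\<Sum>\<^sub>\<infinity>i. x i * y i) \<le> (\<Sum>\<^sub>\<infinity>i. norm (x i * y i))"
    by (rule norm_infsum_bound) (rule l2_mult_abs_summable[OF assms])
  also have "\<dots> \<le> sqrt (l2_sq x) * sqrt (l2_sq y)"
  proof (rule infsum_le_finite_sums)
    show "(\<lambda>i. norm (x i * y i)) summable_on UNIV"
      by (rule l2_mult_abs_summable[OF assms])
    fix F :: "'a set" assume F: "finite F"
    have "(\<Sum>i\<in>F. norm (x i * y i)) \<le> L2_set (\<lambda>i. cmod (x i)) F * L2_set (\<lambda>i. cmod (y i)) F"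
      using L2_set_mult_ineq[of "\<lambda>i. cmod (x i)" "\<lambda>i. cmod (y i)" F] by (simp add: norm_mult)
    also have "\<dots> \<le> sqrt (l2_sq x) * sqrt (l2_sq y)"
      using assms F unfolding L2_set_def l2_def l2_sq_def
      by (intro mult_mono real_sqrt_le_mono finite_sum_le_infsum) (auto intro: sum_nonneg infsum_nonneg)
    finally show "(\<Sum>i\<in>F. norm (x i * y i)) \<le> sqrt (l2_sq x) * sqrt (l2_sq y)" .
  qed
  finally show ?thesis .
qed

section \<open>Unitary matrices and square-summable families\<close>

lemma unitary_rows:
  assumes "op_unitary U"
  shows "l2 (U j)" "((\<lambda>k. U j k * cnj (U j' k)) has_sum (if j = j' then 1 else 0)) UNIV"
proof -
  have row: "(\<Sum>\<^sub>\<infinity>k. U j k * cnj (U j' k)) = (if j = j' then 1 else 0)" for j j'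
    using assms unfolding op_unitary_def op_mult_def op_adj_def op_id_def by metis
  have l2: "l2 (U j)" for j
  proof -
    \<comment> \<open>A divergent \<open>infsum\<close> would have the default value 0, whereas the
      diagonal entry is 1; hence the sum converges.\<close>
    have "(\<lambda>k. U j k * cnj (U j k)) summable_on UNIV"
      using row[of j j] infsum_not_exists by fastforce
    then have "(\<lambda>k. Re (U j k * cnj (U j k))) summable_on UNIV"
      by (rule summable_on_Re)
    then show ?thesis
      by (simp add: l2_def cmod_power2) (simp add: power2_eq_square)
  qed
  show "l2 (U j)" by (rule l2)
  have "(\<lambda>k. U j k * cnj (U j' k)) summable_on UNIV"
    by (rule l2_mult_summable) (simp_all add: l2)
  then show "((\<lambda>k. U j k * cnj (U j' k)) has_sum (if j = j' then 1 else 0)) UNIV"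
    unfolding row[symmetric] by (rule has_sum_infsum)
qed

lemma unitary_adj: "op_unitary U \<Longrightarrow> op_unitary (op_adj U)"
  by (simp add: op_unitary_def op_adj_def[abs_def])

lemma unitary_cols:
  assumes "op_unitary U"
  shows "l2 (\<lambda>i. U i k)" "((\<lambda>i. cnj (U i k) * U i k') has_sum (if k = k' then 1 else 0)) UNIV"
  using unitary_rows[OF unitary_adj[OF assms], of k] unitary_rows(2)[OF unitary_adj[OF assms], of k k']
  by (simp_all add: op_adj_def[abs_def])

lemma has_sum_finite_sum:
  fixes f :: "'i \<Rightarrow> 'a \<Rightarrow> 'b::topological_comm_monoid_add"
  assumes "\<And>j. j \<in> F \<Longrightarrow> (f j has_sum S j) A"
  shows "((\<lambda>k. \<Sum>j\<in>F. f j k) has_sum (\<Sum>j\<in>F. S j)) A"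
  using assms by (induction F rule: infinite_finite_induct) (auto intro: has_sum_add)

lemma has_sum_difference:
  fixes f h :: "'a \<Rightarrow> 'b::real_normed_algebra_1"
  assumes "(f has_sum a) A" "(h has_sum b) A"
  shows "((\<lambda>x. f x - h x) has_sum (a - b)) A"
  using has_sum_add[OF assms(1) has_sum_uminusI[OF assms(2)]] by simp

lemma isometry_finite:
  assumes "op_unitary U" "finite F"
  shows "((\<lambda>k. (cmod (\<Sum>j\<in>F. x j * U j k))\<^sup>2) has_sum (\<Sum>j\<in>F. (cmod (x j))\<^sup>2)) UNIV"
proof -
  have sq: "complex_of_real ((cmod z)\<^sup>2) = z * cnj z" for z
    by (rule complex_norm_square)
  have "((\<lambda>k. \<Sum>j\<in>F. \<Sum>j'\<in>F. (x j * cnj (x j')) * (U j k * cnj (U j' k)))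
      has_sum (\<Sum>j\<in>F. \<Sum>j'\<in>F. (x j * cnj (x j')) * (if j = j' then 1 else 0))) UNIV"
    by (intro has_sum_finite_sum has_sum_cmult_right unitary_rows assms)
  also have "(\<lambda>k. \<Sum>j\<in>F. \<Sum>j'\<in>F. (x j * cnj (x j')) * (U j k * cnj (U j' k)))
      = (\<lambda>k. complex_of_real ((cmod (\<Sum>j\<in>F. x j * U j k))\<^sup>2))"
    by (rule ext) (simp only: sq, simp add: sum_product mult_ac)
  also have "(\<Sum>j\<in>F. \<Sum>j'\<in>F. (x j * cnj (x j')) * (if j = j' then 1 else 0))
      = complex_of_real (\<Sum>j\<in>F. (cmod (x j))\<^sup>2)"
    using assms(2) by (simp only: of_real_sum sq) (simp add: if_distrib cong: if_cong)
  finally show ?thesis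
    by (simp only: has_sum_of_real_iff)
qed

text \<open>Finite truncations of x satisfy the norm identity \<open>isometry_finite\<close>. For a
  fixed finite set of coordinates the resulting bound survives the limit, and bounded finite partial
  sums give both summability and the estimate.\<close>

lemma bessel:
  assumes "op_unitary U" "l2 x"
  shows "l2 (\<lambda>k. \<Sum>\<^sub>\<infinity>j. x j * U j k)" "l2_sq (\<lambda>k. \<Sum>\<^sub>\<infinity>j. x j * U j k) \<le> l2_sq x"
proof -
  let ?X = "\<lambda>k. \<Sum>\<^sub>\<infinity>j. x j * U j k"
  have lim: "((\<lambda>F. \<Sum>j\<in>F. x j * U j k) \<longlongrightarrow> ?X k) (finite_subsets_at_top UNIV)" for k
    by (rule infsum_tendsto) (intro l2_mult_summable assms(2) unitary_cols(1)[OF assms(1)])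
  have bound: "(\<Sum>k\<in>K. (cmod (?X k))\<^sup>2) \<le> l2_sq x" if "finite K" for K
  proof (rule tendsto_upperbound)
    show "((\<lambda>F. \<Sum>k\<in>K. (cmod (\<Sum>j\<in>F. x j * U j k))\<^sup>2) \<longlongrightarrow> (\<Sum>k\<in>K. (cmod (?X k))\<^sup>2))
      (finite_subsets_at_top UNIV)"
      by (intro tendsto_intros lim)
    show "\<forall>\<^sub>F F in finite_subsets_at_top UNIV. (\<Sum>k\<in>K. (cmod (\<Sum>j\<in>F. x j * U j k))\<^sup>2) \<le> l2_sq x"
    proof (rule eventually_finite_subsets_at_top_weakI)
      fix F :: "'a set" assume F: "finite F"
      have "(\<Sum>k\<in>K. (cmod (\<Sum>j\<in>F. x j * U j k))\<^sup>2) \<le> (\<Sum>j\<in>F. (cmod (x j))\<^sup>2)"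
        using isometry_finite[OF assms(1) F] that by (rule finite_sum_le_has_sum) auto
      also have "\<dots> \<le> l2_sq x"
        unfolding l2_sq_def by (rule finite_sum_le_infsum) (use assms(2) F in \<open>auto simp: l2_def\<close>)
      finally show "(\<Sum>k\<in>K. (cmod (\<Sum>j\<in>F. x j * U j k))\<^sup>2) \<le> l2_sq x" .
    qed
  qed auto
  show l2X: "l2 ?X"
    unfolding l2_def
    by (rule nonneg_bdd_above_summable_on) (auto intro!: bdd_aboveI bound)
  show "l2_sq ?X \<le> l2_sq x"
    unfolding l2_sq_def[of ?X]
    by (rule infsum_le_finite_sums) (use l2X bound in \<open>auto simp: l2_def\<close>)
qed

text \<open>The family x j * U j k * y k is in general not absolutely summable, so the order of
  summation cannot be exchanged by Fubini. Instead the error of a finite partial sum over j is the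
  tail of x sent through U and paired with y, which Bessel and Cauchy-Schwarz bound by the norm of
  that tail.\<close>

lemma unitary_swap:
  assumes U: "op_unitary U" and x: "l2 x" and y: "l2 y"
  shows "((\<lambda>j. x j * (\<Sum>\<^sub>\<infinity>k. U j k * y k)) has_sum (\<Sum>\<^sub>\<infinity>k. (\<Sum>\<^sub>\<infinity>j. x j * U j k) * y k)) UNIV"
proof -
  let ?X = "\<lambda>k. \<Sum>\<^sub>\<infinity>j. x j * U j k"
  have sx: "((\<lambda>j. (cmod (x j))\<^sup>2) has_sum l2_sq x) UNIV"
    using x unfolding l2_def l2_sq_def by simp
  have est: "cmod ((\<Sum>j\<in>F. x j * (\<Sum>\<^sub>\<infinity>k. U j k * y k)) - (\<Sum>\<^sub>\<infinity>k. ?X k * y k))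
      \<le> sqrt (l2_sq x - (\<Sum>j\<in>F. (cmod (x j))\<^sup>2)) * sqrt (l2_sq y)" if F: "finite F" for F
  proof -
    \<comment> \<open>The tail of x outside F: its image under U is exactly the error of the partial
      sum over F.\<close>
    define z where "z j = (if j \<in> F then 0 else x j)" for j
    let ?Z = "\<lambda>k. \<Sum>\<^sub>\<infinity>j. z j * U j k"
    have fin: "((\<lambda>j. if j \<in> F then f j else 0) has_sum sum f F) UNIV" for f :: "_ \<Rightarrow> 'b::{comm_monoid_add,topological_space}"
      by (rule has_sum_finite_neutralI[OF F]) auto
    have "((\<lambda>j. (cmod (x j))\<^sup>2 - (if j \<in> F then (cmod (x j))\<^sup>2 else 0)) has_sum
        (l2_sq x - (\<Sum>j\<in>F. (cmod (x j))\<^sup>2))) UNIV"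
      using has_sum_add[OF sx has_sum_uminusI[OF fin[of "\<lambda>j. (cmod (x j))\<^sup>2"]]] by simp
    also have "(\<lambda>j. (cmod (x j))\<^sup>2 - (if j \<in> F then (cmod (x j))\<^sup>2 else 0)) = (\<lambda>j. (cmod (z j))\<^sup>2)"
      by (auto simp: z_def)
    finally have z: "l2 z" "l2_sq z = l2_sq x - (\<Sum>j\<in>F. (cmod (x j))\<^sup>2)"
      unfolding l2_def l2_sq_def by (auto simp: has_sum_iff)
    have X: "?X k = ?Z k + (\<Sum>j\<in>F. x j * U j k)" for k
    proof -
      have "((\<lambda>j. z j * U j k + (if j \<in> F then x j * U j k else 0)) has_sum
          ?Z k + (\<Sum>j\<in>F. x j * U j k)) UNIV"
        by (intro has_sum_add fin has_sum_infsum l2_mult_summable z unitary_cols(1)[OF U])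
      also have "(\<lambda>j. z j * U j k + (if j \<in> F then x j * U j k else 0)) = (\<lambda>j. x j * U j k)"
        by (auto simp: z_def)
      finally show ?thesis by (rule infsumI)
    qed
    have "((\<lambda>k. (\<Sum>j\<in>F. x j * (U j k * y k)) + ?Z k * y k) has_sum
        (\<Sum>j\<in>F. x j * (\<Sum>\<^sub>\<infinity>k. U j k * y k)) + (\<Sum>\<^sub>\<infinity>k. ?Z k * y k)) UNIV"
      by (intro has_sum_add has_sum_finite_sum has_sum_cmult_right has_sum_infsum l2_mult_summable y
          unitary_rows(1)[OF U] bessel(1)[OF U z(1)])
    also have "(\<lambda>k. (\<Sum>j\<in>F. x j * (U j k * y k)) + ?Z k * y k) = (\<lambda>k. ?X k * y k)"
      unfolding X by (simp add: algebra_simps sum_distrib_left)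
    finally have "(\<Sum>\<^sub>\<infinity>k. ?X k * y k) = (\<Sum>j\<in>F. x j * (\<Sum>\<^sub>\<infinity>k. U j k * y k)) + (\<Sum>\<^sub>\<infinity>k. ?Z k * y k)"
      by (rule infsumI)
    then have "cmod ((\<Sum>j\<in>F. x j * (\<Sum>\<^sub>\<infinity>k. U j k * y k)) - (\<Sum>\<^sub>\<infinity>k. ?X k * y k)) = cmod (\<Sum>\<^sub>\<infinity>k. ?Z k * y k)"
      by simp
    also have "\<dots> \<le> sqrt (l2_sq ?Z) * sqrt (l2_sq y)"
      by (rule l2_Cauchy_Schwarz[OF bessel(1)[OF U z(1)] y])
    also have "\<dots> \<le> sqrt (l2_sq z) * sqrt (l2_sq y)"
      by (intro mult_right_mono real_sqrt_le_mono bessel(2)[OF U z(1)]) (simp add: l2_sq_nonneg)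
    finally show ?thesis by (simp add: z(2))
  qed
  have "((\<lambda>F. sqrt (l2_sq x - (\<Sum>j\<in>F. (cmod (x j))\<^sup>2)) * sqrt (l2_sq y)) \<longlongrightarrow>
      sqrt (l2_sq x - l2_sq x) * sqrt (l2_sq y)) (finite_subsets_at_top UNIV)"
    using sx unfolding has_sum_def by (intro tendsto_intros)
  then have lim0: "((\<lambda>F. sqrt (l2_sq x - (\<Sum>j\<in>F. (cmod (x j))\<^sup>2)) * sqrt (l2_sq y)) \<longlongrightarrow> 0)
      (finite_subsets_at_top UNIV)"
    by simp
  show ?thesis
    unfolding has_sum_def
  proof (rule LIM_zero_cancel, rule Lim_null_comparison[OF _ lim0])
    show "\<forall>\<^sub>F F in finite_subsets_at_top UNIV.
        cmod ((\<Sum>j\<in>F. x j * (\<Sum>\<^sub>\<infinity>k. U j k * y k)) - (\<Sum>\<^sub>\<infinity>k. ?X k * y k))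
        \<le> sqrt (l2_sq x - (\<Sum>j\<in>F. (cmod (x j))\<^sup>2)) * sqrt (l2_sq y)"
      by (rule eventually_finite_subsets_at_top_weakI) (rule est)
  qed
qed

section \<open>Matrices acting on square-summable vectors\<close>

definition op_app :: "'a operator \<Rightarrow> 'a ket \<Rightarrow> 'a ket" where
  "op_app A x i = (\<Sum>\<^sub>\<infinity>j. A i j * x j)"

lemma op_app_scale: "op_app A (\<lambda>i. c * x i) = (\<lambda>i. c * op_app A x i)"
  by (rule ext) (simp add: op_app_def mult.left_commute infsum_cmult_right')

text \<open>\<open>bessel\<close> multiplies a row vector into the matrix; complex conjugation turns
  the action on column vectors into that form for the adjoint.\<close>

lemma op_app_l2:
  assumes "op_unitary U" "l2 x"
  shows "l2 (op_app U x)"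
proof -
  have "l2 (\<lambda>k. \<Sum>\<^sub>\<infinity>j. cnj (x j) * op_adj U j k)"
    by (rule bessel(1)[OF unitary_adj[OF assms(1)]]) (simp add: assms(2))
  also have "(\<lambda>k. \<Sum>\<^sub>\<infinity>j. cnj (x j) * op_adj U j k) = (\<lambda>k. cnj (op_app U x k))"
    by (rule ext) (simp add: op_app_def op_adj_def mult.commute flip: infsum_cnj)
  finally show ?thesis by simp
qed

lemma op_adj_adj [simp]: "op_adj (op_adj U) = U"
  by (simp add: op_adj_def[abs_def])

lemma op_app_adj_app:
  assumes U: "op_unitary U" and x: "l2 x"
  shows "op_app (op_adj U) (op_app U x) = x"
proof
  fix k
  have "((\<lambda>i. op_adj U k i * (\<Sum>\<^sub>\<infinity>j. U i j * x j)) has_sum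
      (\<Sum>\<^sub>\<infinity>j. (\<Sum>\<^sub>\<infinity>i. op_adj U k i * U i j) * x j)) UNIV"
    by (rule unitary_swap[OF U unitary_rows(1)[OF unitary_adj[OF U]] x])
  then have "op_app (op_adj U) (op_app U x) k = (\<Sum>\<^sub>\<infinity>j. (\<Sum>\<^sub>\<infinity>i. op_adj U k i * U i j) * x j)"
    unfolding op_app_def by (rule infsumI)
  also have "\<dots> = (\<Sum>\<^sub>\<infinity>j. (if k = j then 1 else 0) * x j)"
    using infsumI[OF unitary_cols(2)[OF U, of k]] by (simp add: op_adj_def)
  also have "\<dots> = x k"
    by (rule infsumI, rule has_sum_finite_neutralI[of "{k}"]) auto
  finally show "op_app (op_adj U) (op_app U x) k = x k" .
qed

lemma op_mult_diag_right: "op_mult A (op_diag d) = (\<lambda>i j. A i j * d j)"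
proof (intro ext)
  fix i j
  show "op_mult A (op_diag d) i j = A i j * d j"
    unfolding op_mult_def op_diag_def
    by (rule infsumI, rule has_sum_finite_neutralI[of "{j}"]) auto
qed

lemma op_conjugate_diag: "op_conjugate v (op_diag d) i j = (\<Sum>\<^sub>\<infinity>k. v i k * d k * cnj (v j k))"
  unfolding op_conjugate_def op_mult_diag_right by (simp add: op_mult_def op_adj_def)

lemma op_app_conjugate_diag:
  assumes v: "op_unitary v" and d: "\<And>k. cmod (d k) \<le> B" and x: "l2 x"
  shows "op_app (op_conjugate v (op_diag d)) x = op_app v (\<lambda>k. d k * op_app (op_adj v) x k)"
proof
  fix i
  have l: "l2 (\<lambda>k. v i k * d k)"
    unfolding mult.commute[of "v i _"] by (rule l2_mult_bounded[OF unitary_rows(1)[OF v] d])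
  have "((\<lambda>k. (v i k * d k) * (\<Sum>\<^sub>\<infinity>j. op_adj v k j * x j)) has_sum
      (\<Sum>\<^sub>\<infinity>j. (\<Sum>\<^sub>\<infinity>k. (v i k * d k) * op_adj v k j) * x j)) UNIV"
    by (rule unitary_swap[OF unitary_adj[OF v] l x])
  from infsumI[OF this]
  show "op_app (op_conjugate v (op_diag d)) x i = op_app v (\<lambda>k. d k * op_app (op_adj v) x k) i"
    by (simp add: op_app_def op_conjugate_diag op_adj_def mult.assoc)
qed

lemma op_app_adj_col:
  assumes "op_unitary w"
  shows "op_app (op_adj w) (\<lambda>i. w i j) = (\<lambda>k. if k = j then 1 else 0)"
  using infsumI[OF unitary_cols(2)[OF assms]] by (auto simp: op_app_def op_adj_def)

lemma op_app_unit: "op_app w (\<lambda>k. c k * (if k = j then 1 else 0)) = (\<lambda>i. c j * w i j)"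
proof
  fix i
  show "op_app w (\<lambda>k. c k * (if k = j then 1 else 0)) i = c j * w i j"
    unfolding op_app_def by (rule infsumI, rule has_sum_finite_neutralI[of "{j}"]) auto
qed

lemma conjugate_diag_row_l2:
  assumes v: "op_unitary v" and d: "\<And>k. cmod (d k) \<le> B"
  shows "l2 (op_conjugate v (op_diag d) i)"
proof -
  have "l2 (\<lambda>k. d k * v i k)"
    by (rule l2_mult_bounded[where B = B, OF unitary_rows(1)[OF v]]) (rule d)
  then have "l2 (\<lambda>k. cnj (d k * v i k))"
    by (subst l2_cnj)
  then have "l2 (op_app v (\<lambda>k. cnj (d k * v i k)))"
    by (rule op_app_l2[OF v])
  then have "l2 (\<lambda>j. cnj (op_app v (\<lambda>k. cnj (d k * v i k)) j))"
    by (subst l2_cnj)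
  also have "(\<lambda>j. cnj (op_app v (\<lambda>k. cnj (d k * v i k)) j)) = op_conjugate v (op_diag d) i"
    by (rule ext) (simp only: op_app_def op_conjugate_diag infsum_cnj[symmetric], simp add: mult_ac)
  finally show ?thesis .
qed

text \<open>A row of the difference is square-summable and orthogonal to the orthonormal basis
  formed by the columns of w. As \<open>op_app (op_adj w)\<close> is inverted by w on such vectors,
  the row vanishes.\<close>

lemma op_eq_if_app_cols_eq:
  assumes w: "op_unitary w" and A: "\<And>i. l2 (A i)" and B: "\<And>i. l2 (B i)"
    and eq: "\<And>j. op_app A (\<lambda>i. w i j) = op_app B (\<lambda>i. w i j)"
  shows "A = B"
proof -
  have "A i = B i" for i
  proof -
    let ?d = "\<lambda>k. cnj (A i k - B i k)"
    have d: "l2 ?d" unfolding l2_cnj by (rule l2_diff[OF A B])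
    have "op_app (op_adj w) ?d = (\<lambda>j. 0)"
    proof
      fix j
      have "(\<Sum>\<^sub>\<infinity>k. A i k * w k j - B i k * w k j) = op_app A (\<lambda>i. w i j) i - op_app B (\<lambda>i. w i j) i"
        unfolding op_app_def
        by (intro infsumI has_sum_difference has_sum_infsum l2_mult_summable A B unitary_cols(1)[OF w])
      then have "cnj (\<Sum>\<^sub>\<infinity>k. A i k * w k j - B i k * w k j) = 0"
        by (simp add: eq)
      then show "op_app (op_adj w) ?d j = 0"
        by (simp add: op_app_def op_adj_def algebra_simps flip: infsum_cnj)
    qed
    then have "op_app (op_adj (op_adj w)) (op_app (op_adj w) ?d) = (\<lambda>j. 0)"
      by (simp only:) (simp add: op_app_def fun_eq_iff)
    then have "?d = (\<lambda>j. 0)"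
      by (simp only: op_app_adj_app[OF unitary_adj[OF w] d])
    then show ?thesis by (auto simp: fun_eq_iff)
  qed
  then show ?thesis by blast
qed

section \<open>Independence of the chosen eigenbasis\<close>

lemma bounded_range_cmod:
  assumes "bounded (range l)"
  obtains B where "\<And>k. cmod (complex_of_real (l k)) \<le> B"
  using assms unfolding bounded_iff by auto

text \<open>The column j of w is an eigenvector for the eigenvalue m j. Its coefficients in the
  basis v therefore vanish wherever l k differs from m j, so multiplying them by f (l k) is the same
  as multiplying by f (m j): both functional calculi agree on every column of w. Boundedness makes
  the sums exchangeable.\<close>

lemma diagonalizes_unique:
  assumes v: "diagonalizes v l A" and w: "diagonalizes w m A"
    and fl: "bounded (range (\<lambda>k. f (l k)))" and fm: "bounded (range (\<lambda>k. f (m k)))"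
  shows "op_conjugate v (op_diag (\<lambda>k. complex_of_real (f (l k))))
       = op_conjugate w (op_diag (\<lambda>k. complex_of_real (f (m k))))"
proof -
  from v have uv: "op_unitary v" and l: "bounded (range l)"
    and A1: "A = op_conjugate v (op_diag (\<lambda>k. complex_of_real (l k)))"
    by (auto simp: diagonalizes_def)
  from w have uw: "op_unitary w" and m: "bounded (range m)"
    and A2: "A = op_conjugate w (op_diag (\<lambda>k. complex_of_real (m k)))"
    by (auto simp: diagonalizes_def)
  obtain Bl where Bl: "\<And>k. cmod (complex_of_real (l k)) \<le> Bl" using l by (rule bounded_range_cmod) blast
  obtain Bm where Bm: "\<And>k. cmod (complex_of_real (m k)) \<le> Bm" using m by (rule bounded_range_cmod) blast
  obtain Cl where Cl: "\<And>k. cmod (complex_of_real (f (l k))) \<le> Cl" using fl by (rule bounded_range_cmod) blast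
  obtain Cm where Cm: "\<And>k. cmod (complex_of_real (f (m k))) \<le> Cm" using fm by (rule bounded_range_cmod) blast
  show ?thesis
  proof (rule op_eq_if_app_cols_eq[OF uw conjugate_diag_row_l2[OF uv Cl] conjugate_diag_row_l2[OF uw Cm]])
    fix j
    let ?w = "\<lambda>i. w i j" and ?c = "op_app (op_adj v) (\<lambda>i. w i j)"
    have l2w: "l2 ?w" by (rule unitary_cols(1)[OF uw])
    have l2c: "l2 ?c" by (rule op_app_l2[OF unitary_adj[OF uv] l2w])
    have vc: "op_app v ?c = ?w"
      using op_app_adj_app[OF unitary_adj[OF uv] l2w] by simp
    have "op_app v (\<lambda>k. complex_of_real (l k) * ?c k) = op_app A ?w"
      unfolding A1 by (rule op_app_conjugate_diag[OF uv Bl l2w, symmetric])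
    also have "\<dots> = (\<lambda>i. complex_of_real (m j) * w i j)"
      unfolding A2 by (simp only: op_app_conjugate_diag[OF uw Bm l2w] op_app_adj_col[OF uw] op_app_unit)
    finally have "op_app (op_adj v) (op_app v (\<lambda>k. complex_of_real (l k) * ?c k))
        = (\<lambda>k. complex_of_real (m j) * ?c k)"
      by (simp add: op_app_scale)
    then have "(\<lambda>k. complex_of_real (l k) * ?c k) = (\<lambda>k. complex_of_real (m j) * ?c k)"
      by (simp only: op_app_adj_app[OF uv l2_mult_bounded[OF l2c Bl]])
    then have "?c k = 0 \<or> l k = m j" for k
      by (auto simp: fun_eq_iff)
    then have f: "complex_of_real (f (l k)) * ?c k = complex_of_real (f (m j)) * ?c k" for k
      by (metis mult_zero_right)
    have "op_app (op_conjugate v (op_diag (\<lambda>k. complex_of_real (f (l k))))) ?w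
        = op_app v (\<lambda>k. complex_of_real (f (m j)) * ?c k)"
      by (simp only: op_app_conjugate_diag[OF uv Cl l2w] f)
    also have "\<dots> = (\<lambda>i. complex_of_real (f (m j)) * w i j)"
      by (simp only: op_app_scale vc)
    also have "\<dots> = op_app (op_conjugate w (op_diag (\<lambda>k. complex_of_real (f (m k))))) ?w"
      by (simp only: op_app_conjugate_diag[OF uw Cm l2w] op_app_adj_col[OF uw] op_app_unit)
    finally show "op_app (op_conjugate v (op_diag (\<lambda>k. complex_of_real (f (l k))))) ?w
        = op_app (op_conjugate w (op_diag (\<lambda>k. complex_of_real (f (m k))))) ?w" .
  qed
qed

text \<open>The eigenvalues selected inside \<open>op_fun\<close> are only known to be bounded, so
  their sign is open and negative arguments must be covered; there \<open>ln\<close> takes the value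
  at the absolute value.\<close>

lemma bounded_xlnx:
  assumes "bounded (range l)"
  shows "bounded (range (\<lambda>k. l k * ln (l k :: real)))"
proof -
  obtain B where B: "\<And>k. \<bar>l k\<bar> \<le> B" using assms by (auto simp: bounded_iff)
  have "\<bar>x * ln x\<bar> \<le> 1 + B * B" if "\<bar>x\<bar> \<le> B" for x :: real
  proof -
    have *: "\<bar>y * ln y\<bar> \<le> 1 + B * B" if y: "0 < y" "y \<le> B" for y :: real
    proof (cases "y \<le> 1")
      case True
      have "ln (1 / y) \<le> 1 / y - 1" using y by (intro ln_le_minus_one) auto
      then have "- ln y \<le> 1 / y - 1" using y by (simp add: ln_div)
      then have "y * (- ln y) \<le> y * (1 / y - 1)" using y by (intro mult_left_mono) auto
      also have "\<dots> \<le> 1" using y by (simp add: algebra_simps)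
      finally have "- (y * ln y) \<le> 1" by simp
      moreover have "y * ln y \<le> 0" using y True by (intro mult_nonneg_nonpos) auto
      ultimately have "\<bar>y * ln y\<bar> \<le> 1" by linarith
      then show ?thesis using zero_le_square[of B] by linarith
    next
      case False
      then have "ln y \<le> y - 1" "0 \<le> ln y" by (auto intro: ln_le_minus_one)
      then have "y * ln y \<le> B * B" using y False by (intro mult_mono) auto
      moreover have "0 \<le> y * ln y" using \<open>0 \<le> ln y\<close> y by simp
      ultimately show ?thesis by linarith
    qed
    consider "x > 0" | "x = 0" | "x < 0" by linarith
    then show ?thesis
    proof cases
      case 1 then show ?thesis using * that by simp
    next
      case 2 then show ?thesis using zero_le_square[of B] by simp
    next
      case 3
      have "ln x = ln (- x)" using ln_minus[of x] by simp
      then show ?thesis using *[of "- x"] that 3 by (simp add: abs_mult)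
    qed
  qed
  then have "\<And>k. \<bar>l k * ln (l k)\<bar> \<le> 1 + B * B" using B by blast
  then show ?thesis by (auto simp: bounded_iff)
qed

text \<open>No summability hypothesis is imposed: if f is not summable, both sides take the default
  value 0.\<close>

lemma infsum_complex_of_real: "(\<Sum>\<^sub>\<infinity>k\<in>A. complex_of_real (f k)) = complex_of_real (infsum f A)"
proof (cases "f summable_on A")
  case True
  then show ?thesis by (intro infsumI has_sum_of_real has_sum_infsum)
next
  case False
  then have "\<not> (\<lambda>k. complex_of_real (f k)) summable_on A"
    using summable_on_Re by fastforce
  then show ?thesis using False by (simp add: infsum_not_exists)
qed

text \<open>Lets any convenient diagonalization replace the chosen one. The trace then sums the
  weights (cmod (w i k))^2 * h k over k and afterwards over i; as all eigenvalues lie in [0,1] these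
  terms are nonnegative, so the order may be reversed, and the columns of w have norm 1.\<close>

lemma vN_entropy_diagonalizes:
  assumes w: "diagonalizes w m A" and m: "\<And>k. 0 \<le> m k" "\<And>k. m k \<le> 1"
    and H: "((\<lambda>k. - (m k * ln (m k))) has_sum H) UNIV"
  shows "vN_entropy A = H"
proof -
  define h where "h k = - (m k * ln (m k))" for k
  have uw: "op_unitary w" using w by (simp add: diagonalizes_def)
  have h0: "h k \<ge> 0" for k
    using m[of k] by (cases "m k = 0") (auto simp: h_def mult_nonneg_nonpos)
  define p where "p = (SOME p. diagonalizes (fst p) (snd p) A)"
  have p: "diagonalizes (fst p) (snd p) A"
    unfolding p_def by (rule someI[of _ "(w, m)"]) (simp add: w)
  have "op_fun (\<lambda>x. x * ln x) A
      = op_conjugate (fst p) (op_diag (\<lambda>k. complex_of_real (snd p k * ln (snd p k))))"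
    unfolding op_fun_def p_def[symmetric] by (simp add: case_prod_beta)
  also have "\<dots> = op_conjugate w (op_diag (\<lambda>k. complex_of_real (m k * ln (m k))))"
    by (rule diagonalizes_unique[OF p w, of "\<lambda>x. x * ln x"])
       (use p w in \<open>auto simp: diagonalizes_def intro!: bounded_xlnx\<close>)
  finally have eq: "op_fun (\<lambda>x. x * ln x) A = op_conjugate w (op_diag (\<lambda>k. complex_of_real (m k * ln (m k))))" .
  have F: "op_fun (\<lambda>x. x * ln x) A i i = - complex_of_real (\<Sum>\<^sub>\<infinity>k. (cmod (w i k))\<^sup>2 * h k)" for i
  proof -
    have "op_fun (\<lambda>x. x * ln x) A i i = (\<Sum>\<^sub>\<infinity>k. complex_of_real (- ((cmod (w i k))\<^sup>2 * h k)))"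
      unfolding eq op_conjugate_diag
      by (rule infsum_cong) (simp only: of_real_mult of_real_minus complex_norm_square h_def, simp)
    also have "\<dots> = complex_of_real (\<Sum>\<^sub>\<infinity>k. - ((cmod (w i k))\<^sup>2 * h k))"
      by (rule infsum_complex_of_real)
    finally show ?thesis by (simp add: infsum_uminus)
  qed
  have inner: "((\<lambda>i. (cmod (w i k))\<^sup>2 * h k) has_sum h k) UNIV" for k
  proof -
    have "((\<lambda>i. complex_of_real ((cmod (w i k))\<^sup>2)) has_sum complex_of_real 1) UNIV"
      using unitary_cols(2)[OF uw, of k k] by (simp only: complex_norm_square) (simp add: mult.commute)
    then have "((\<lambda>i. (cmod (w i k))\<^sup>2) has_sum 1) UNIV" by (simp only: has_sum_of_real_iff)
    from has_sum_cmult_left[OF this, of "h k"] show ?thesis by simp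
  qed
  have h: "(h has_sum H) UNIV" using H by (simp add: h_def[abs_def])
  have "(\<lambda>(k, i). (cmod (w i k))\<^sup>2 * h k) summable_on UNIV \<times> UNIV"
    by (rule summable_on_SigmaI[where g = h])
       (use inner has_sum_imp_summable[OF h] h0 in auto)
  then have "((\<lambda>(k, i). (cmod (w i k))\<^sup>2 * h k) has_sum H) (UNIV \<times> UNIV)"
    by (intro has_sum_SigmaI[where g = h]) (use inner h in auto)
  then have swapped: "((\<lambda>(i, k). (cmod (w i k))\<^sup>2 * h k) has_sum H) (UNIV \<times> UNIV)"
    using has_sum_swap[where f = "\<lambda>(k, i). (cmod (w i k))\<^sup>2 * h k" and S = H and A = UNIV and B = UNIV] by (simp add: case_prod_beta)
  have "((\<lambda>i. \<Sum>\<^sub>\<infinity>k. (cmod (w i k))\<^sup>2 * h k) has_sum H) UNIV"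
  proof (rule has_sum_SigmaD[OF swapped])
    fix i
    have "(\<lambda>k. (cmod (w i k))\<^sup>2 * h k) summable_on UNIV"
      by (rule summable_on_SigmaD1[OF has_sum_imp_summable[OF swapped]]) simp
    then show "((\<lambda>k. case (i, k) of (i, k) \<Rightarrow> (cmod (w i k))\<^sup>2 * h k) has_sum
        (\<Sum>\<^sub>\<infinity>k. (cmod (w i k))\<^sup>2 * h k)) UNIV"
      by simp
  qed
  then have "((\<lambda>i. - complex_of_real (\<Sum>\<^sub>\<infinity>k. (cmod (w i k))\<^sup>2 * h k)) has_sum - complex_of_real H) UNIV"
    by (intro has_sum_uminusI has_sum_of_real)
  then have "op_trace (op_fun (\<lambda>x. x * ln x) A) = - complex_of_real H"
    unfolding op_trace_def F by (rule infsumI)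
  then show ?thesis by (simp add: vN_entropy_def)
qed

subsection \<open>Gaussian operators in the Fock basis\<close>

text \<open>The indices count how often the monomials z1 z2, w1 w2, z1 w1 and z2 w2 are used; x
  holds the exponents of z1, z2 and y those of w1, w2.\<close>

definition gauss_indices :: "nat \<times> nat \<Rightarrow> nat \<times> nat \<Rightarrow> (nat \<times> nat \<times> nat \<times> nat) set" where
  "gauss_indices x y = {(\<alpha>, \<beta>, \<gamma>, \<delta>).
     \<alpha> + \<gamma> = fst x \<and> \<alpha> + \<delta> = snd x \<and> \<beta> + \<gamma> = fst y \<and> \<beta> + \<delta> = snd y}"

definition gauss_coeff :: "real \<Rightarrow> real \<Rightarrow> real \<Rightarrow> real \<Rightarrow> nat \<times> nat \<Rightarrow> nat \<times> nat \<Rightarrow> real" where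
  "gauss_coeff p p' q\<^sub>1 q\<^sub>2 x y = (\<Sum>(\<alpha>, \<beta>, \<gamma>, \<delta>)\<in>gauss_indices x y.
     (p ^ \<alpha> / fact \<alpha>) * (p' ^ \<beta> / fact \<beta>) * (q\<^sub>1 ^ \<gamma> / fact \<gamma>) * (q\<^sub>2 ^ \<delta> / fact \<delta>))"

definition gauss_op :: "real \<Rightarrow> real \<Rightarrow> real \<Rightarrow> real \<Rightarrow> nat \<times> nat \<Rightarrow> nat \<times> nat \<Rightarrow> real" where
  "gauss_op p p' q\<^sub>1 q\<^sub>2 x y =
     sqrt (fact (fst x) * fact (snd x) * fact (fst y) * fact (snd y)) * gauss_coeff p p' q\<^sub>1 q\<^sub>2 x y"

lemma finite_gauss_indices: "finite (gauss_indices x y)"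
  by (rule finite_subset[of _ "{..fst x} \<times> {..fst y} \<times> {..fst x} \<times> {..snd x}"])
     (auto simp: gauss_indices_def)

lemma gauss_op_transpose: "gauss_op p p' q\<^sub>1 q\<^sub>2 x y = gauss_op p' p q\<^sub>1 q\<^sub>2 y x"
proof -
  have "gauss_coeff p p' q\<^sub>1 q\<^sub>2 x y = gauss_coeff p' p q\<^sub>1 q\<^sub>2 y x"
    unfolding gauss_coeff_def
    by (rule sum.reindex_bij_witness[where i = "\<lambda>(\<alpha>, \<beta>, \<gamma>, \<delta>). (\<beta>, \<alpha>, \<gamma>, \<delta>)"
          and j = "\<lambda>(\<alpha>, \<beta>, \<gamma>, \<delta>). (\<beta>, \<alpha>, \<gamma>, \<delta>)"])
       (auto simp: gauss_indices_def mult_ac)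
  then show ?thesis by (simp add: gauss_op_def mult_ac)
qed

lemma gauss_op_swap: "gauss_op p p' q\<^sub>1 q\<^sub>2 x y = gauss_op p p' q\<^sub>2 q\<^sub>1 (prod.swap x) (prod.swap y)"
proof -
  have "gauss_coeff p p' q\<^sub>1 q\<^sub>2 x y = gauss_coeff p p' q\<^sub>2 q\<^sub>1 (prod.swap x) (prod.swap y)"
    unfolding gauss_coeff_def
    by (rule sum.reindex_bij_witness[where i = "\<lambda>(\<alpha>, \<beta>, \<gamma>, \<delta>). (\<alpha>, \<beta>, \<delta>, \<gamma>)"
          and j = "\<lambda>(\<alpha>, \<beta>, \<gamma>, \<delta>). (\<alpha>, \<beta>, \<delta>, \<gamma>)"])
       (auto simp: gauss_indices_def mult_ac)
  then show ?thesis by (simp add: gauss_op_def mult_ac)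
qed

text \<open>This is the substitution of u w1 for w1 and v w2 for w2 in the kernel.\<close>

lemma gauss_op_scale:
  "gauss_op p p' q\<^sub>1 q\<^sub>2 x (n, m) * (u ^ n * v ^ m) = gauss_op p (p' * (u * v)) (q\<^sub>1 * u) (q\<^sub>2 * v) x (n, m)"
proof -
  have "gauss_coeff p p' q\<^sub>1 q\<^sub>2 x (n, m) * (u ^ n * v ^ m)
      = gauss_coeff p (p' * (u * v)) (q\<^sub>1 * u) (q\<^sub>2 * v) x (n, m)"
    unfolding gauss_coeff_def sum_distrib_right
    by (rule sum.cong) (auto simp: gauss_indices_def power_mult_distrib power_add)
  then show ?thesis by (simp add: gauss_op_def)
qed

text \<open>The difference of the two components is \<gamma> - \<delta> in both x and y: such
  operators conserve the photon number difference of the two modes.\<close>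

lemma gauss_op_support:
  assumes "fst x + snd y \<noteq> fst y + snd x"
  shows "gauss_op p p' q\<^sub>1 q\<^sub>2 x y = 0"
proof -
  have "gauss_indices x y = {}" using assms by (auto simp: gauss_indices_def)
  then show ?thesis by (simp add: gauss_op_def gauss_coeff_def)
qed

section \<open>Ladder recursions and uniqueness\<close>

text \<open>Coefficient comparison in the equation that the z1-derivative of the kernel equals (p z2
  + q1 w1) times the kernel. Combinatorially, Suc b is split as \<alpha> + \<gamma>, and each
  summand lowers its own exponent.\<close>

lemma gauss_coeff_lower:
  "real (Suc b) * gauss_coeff p p' q\<^sub>1 q\<^sub>2 (Suc b, i) (n, m) =
     p * (if i = 0 then 0 else gauss_coeff p p' q\<^sub>1 q\<^sub>2 (b, i - 1) (n, m)) +
     q\<^sub>1 * (if n = 0 then 0 else gauss_coeff p p' q\<^sub>1 q\<^sub>2 (b, i) (n - 1, m))"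
proof -
  define t where "t = (\<lambda>(\<alpha>, \<beta>, \<gamma>, \<delta>).
     (p ^ \<alpha> / fact \<alpha>) * (p' ^ \<beta> / fact \<beta>) * (q\<^sub>1 ^ \<gamma> / fact \<gamma>) * (q\<^sub>2 ^ \<delta> / fact \<delta>))"
  have step: "real (Suc k) * (c ^ Suc k / fact (Suc k)) = c * (c ^ k / fact k)" for c :: real and k
    by (simp add: fact_Suc del: of_nat_Suc)
  have t1: "real (Suc \<alpha>) * t (Suc \<alpha>, \<beta>, \<gamma>, \<delta>) = p * t (\<alpha>, \<beta>, \<gamma>, \<delta>)" for \<alpha> \<beta> \<gamma> \<delta>
    unfolding t_def prod.case mult.assoc[symmetric] step by (simp add: mult_ac)
  have t2: "real (Suc \<gamma>) * t (\<alpha>, \<beta>, Suc \<gamma>, \<delta>) = q\<^sub>1 * t (\<alpha>, \<beta>, \<gamma>, \<delta>)" for \<alpha> \<beta> \<gamma> \<delta>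
    using step[of \<gamma> q\<^sub>1] unfolding t_def prod.case by (simp add: mult_ac)
  let ?S = "gauss_indices (Suc b, i) (n, m)"
  have "real (Suc b) * gauss_coeff p p' q\<^sub>1 q\<^sub>2 (Suc b, i) (n, m) =
      (\<Sum>(\<alpha>, \<beta>, \<gamma>, \<delta>)\<in>?S. real \<alpha> * t (\<alpha>, \<beta>, \<gamma>, \<delta>) + real \<gamma> * t (\<alpha>, \<beta>, \<gamma>, \<delta>))"
    unfolding gauss_coeff_def t_def[symmetric] sum_distrib_left
    by (rule sum.cong) (auto simp: gauss_indices_def simp flip: distrib_right of_nat_add)
  also have "\<dots> = (\<Sum>(\<alpha>, \<beta>, \<gamma>, \<delta>)\<in>?S. real \<alpha> * t (\<alpha>, \<beta>, \<gamma>, \<delta>)) + (\<Sum>(\<alpha>, \<beta>, \<gamma>, \<delta>)\<in>?S. real \<gamma> * t (\<alpha>, \<beta>, \<gamma>, \<delta>))"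
    by (simp add: case_prod_beta sum.distrib)
  also have "(\<Sum>(\<alpha>, \<beta>, \<gamma>, \<delta>)\<in>?S. real \<alpha> * t (\<alpha>, \<beta>, \<gamma>, \<delta>)) =
      p * (if i = 0 then 0 else gauss_coeff p p' q\<^sub>1 q\<^sub>2 (b, i - 1) (n, m))"
  proof (cases i)
    case 0
    then show ?thesis by (auto simp: gauss_indices_def intro!: sum.neutral)
  next
    case (Suc i')
    have "(\<Sum>(\<alpha>, \<beta>, \<gamma>, \<delta>)\<in>?S. real \<alpha> * t (\<alpha>, \<beta>, \<gamma>, \<delta>))
        = (\<Sum>(\<alpha>, \<beta>, \<gamma>, \<delta>)\<in>{q \<in> ?S. fst q \<noteq> 0}. real \<alpha> * t (\<alpha>, \<beta>, \<gamma>, \<delta>))"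
      by (rule sum.mono_neutral_right) (auto simp: finite_gauss_indices)
    also have "\<dots> = (\<Sum>q\<in>gauss_indices (b, i') (n, m). p * t q)"
      by (rule sum.reindex_bij_witness[where
          i = "\<lambda>(\<alpha>, \<beta>, \<gamma>, \<delta>). (Suc \<alpha>, \<beta>, \<gamma>, \<delta>)" and j = "\<lambda>(\<alpha>, \<beta>, \<gamma>, \<delta>). (\<alpha> - 1, \<beta>, \<gamma>, \<delta>)"])
         (auto simp: gauss_indices_def Suc gr0_conv_Suc t1 simp del: of_nat_Suc)
    finally show ?thesis
      by (simp add: Suc gauss_coeff_def t_def sum_distrib_left)
  qed
  also have "(\<Sum>(\<alpha>, \<beta>, \<gamma>, \<delta>)\<in>?S. real \<gamma> * t (\<alpha>, \<beta>, \<gamma>, \<delta>)) =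
      q\<^sub>1 * (if n = 0 then 0 else gauss_coeff p p' q\<^sub>1 q\<^sub>2 (b, i) (n - 1, m))"
  proof (cases n)
    case 0
    then show ?thesis by (auto simp: gauss_indices_def intro!: sum.neutral)
  next
    case (Suc n')
    have "(\<Sum>(\<alpha>, \<beta>, \<gamma>, \<delta>)\<in>?S. real \<gamma> * t (\<alpha>, \<beta>, \<gamma>, \<delta>))
        = (\<Sum>(\<alpha>, \<beta>, \<gamma>, \<delta>)\<in>{q \<in> ?S. fst (snd (snd q)) \<noteq> 0}. real \<gamma> * t (\<alpha>, \<beta>, \<gamma>, \<delta>))"
      by (rule sum.mono_neutral_right) (auto simp: finite_gauss_indices)
    also have "\<dots> = (\<Sum>q\<in>gauss_indices (b, i) (n', m). q\<^sub>1 * t q)"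
      by (rule sum.reindex_bij_witness[where
          i = "\<lambda>(\<alpha>, \<beta>, \<gamma>, \<delta>). (\<alpha>, \<beta>, Suc \<gamma>, \<delta>)" and j = "\<lambda>(\<alpha>, \<beta>, \<gamma>, \<delta>). (\<alpha>, \<beta>, \<gamma> - 1, \<delta>)"])
         (auto simp: gauss_indices_def Suc gr0_conv_Suc t2 simp del: of_nat_Suc)
    finally show ?thesis
      by (simp add: Suc gauss_coeff_def t_def sum_distrib_left)
  qed
  finally show ?thesis .
qed

text \<open>The square roots of factorials turn the coefficient recursion into one with ladder
  factors. The case distinctions disappear, since the factor \<open>sqrt 0\<close> removes the terms
  in which \<open>i - 1\<close> or \<open>n - 1\<close> is truncated.\<close>

lemma gauss_op_lower_fst:
  "sqrt (real (Suc b)) * gauss_op p p' q\<^sub>1 q\<^sub>2 (Suc b, i) (n, m) =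
     p * sqrt (real i) * gauss_op p p' q\<^sub>1 q\<^sub>2 (b, i - 1) (n, m) +
     q\<^sub>1 * sqrt (real n) * gauss_op p p' q\<^sub>1 q\<^sub>2 (b, i) (n - 1, m)"
proof -
  have "sqrt (real (Suc b)) * gauss_op p p' q\<^sub>1 q\<^sub>2 (Suc b, i) (n, m) =
      sqrt (fact b * fact i * fact n * fact m) * (real (Suc b) * gauss_coeff p p' q\<^sub>1 q\<^sub>2 (Suc b, i) (n, m))"
  proof -
    have "sqrt (real (Suc b)) * sqrt (fact (Suc b) * fact i * fact n * fact m)
        = sqrt (real (Suc b)) * sqrt (real (Suc b)) * sqrt (fact b * fact i * fact n * fact m)"
      by (simp only: fact_Suc of_nat_mult of_nat_fact real_sqrt_mult mult_ac)
    then show ?thesis by (simp add: gauss_op_def del: of_nat_Suc fact_Suc)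
  qed
  also have "\<dots> = p * (sqrt (fact b * fact i * fact n * fact m)
          * (if i = 0 then 0 else gauss_coeff p p' q\<^sub>1 q\<^sub>2 (b, i - 1) (n, m)))
      + q\<^sub>1 * (sqrt (fact b * fact i * fact n * fact m)
          * (if n = 0 then 0 else gauss_coeff p p' q\<^sub>1 q\<^sub>2 (b, i) (n - 1, m)))"
    unfolding gauss_coeff_lower by (simp add: algebra_simps)
  also have "sqrt (fact b * fact i * fact n * fact m)
        * (if i = 0 then 0 else gauss_coeff p p' q\<^sub>1 q\<^sub>2 (b, i - 1) (n, m))
      = sqrt (real i) * gauss_op p p' q\<^sub>1 q\<^sub>2 (b, i - 1) (n, m)"
    by (cases i) (simp_all add: gauss_op_def real_sqrt_mult mult_ac del: of_nat_Suc)
  also have "sqrt (fact b * fact i * fact n * fact m)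
        * (if n = 0 then 0 else gauss_coeff p p' q\<^sub>1 q\<^sub>2 (b, i) (n - 1, m))
      = sqrt (real n) * gauss_op p p' q\<^sub>1 q\<^sub>2 (b, i) (n - 1, m)"
    by (cases n) (simp_all add: gauss_op_def real_sqrt_mult mult_ac del: of_nat_Suc)
  finally show ?thesis by (simp add: mult_ac)
qed

lemma gauss_op_lower_snd:
  "sqrt (real (Suc i)) * gauss_op p p' q\<^sub>1 q\<^sub>2 (b, Suc i) (n, m) =
     p * sqrt (real b) * gauss_op p p' q\<^sub>1 q\<^sub>2 (b - 1, i) (n, m) +
     q\<^sub>2 * sqrt (real m) * gauss_op p p' q\<^sub>1 q\<^sub>2 (b, i) (n, m - 1)"
  using gauss_op_lower_fst[of i p p' q\<^sub>2 q\<^sub>1 b m n]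
  by (simp add: gauss_op_swap[of p p' q\<^sub>1 q\<^sub>2])

lemma gauss_op_row_0: "gauss_op p p' q\<^sub>1 q\<^sub>2 (0, 0) (n, m) = (if n = m then p' ^ n else 0)"
proof (cases "n = m")
  case True
  have "gauss_indices (0, 0) (n, n) = {(0, n, 0, 0)}"
    by (auto simp: gauss_indices_def)
  then show ?thesis using True by (simp add: gauss_op_def gauss_coeff_def)
next
  case False
  then show ?thesis using gauss_op_support[of "(0,0)" "(n,m)"] by simp
qed

text \<open>
  The relations satisfied by the matrix of an operator whose Bargmann kernel is the exponential of
  \<open>p z\<^sub>1 z\<^sub>2 + p' w\<^sub>1 w\<^sub>2 + q\<^sub>1 z\<^sub>1 w\<^sub>1 + q\<^sub>2 z\<^sub>2 w\<^sub>2\<close>: they express the derivatives in \<open>z\<^sub>1\<close> and \<open>z\<^sub>2\<close>.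
\<close>

definition gauss_rows ::
  "real \<Rightarrow> real \<Rightarrow> real \<Rightarrow> (nat \<times> nat \<Rightarrow> nat \<times> nat \<Rightarrow> 'a::real_normed_field) \<Rightarrow> bool" where
  "gauss_rows p q\<^sub>1 q\<^sub>2 X \<longleftrightarrow> (\<forall>b i n m.
     of_real (sqrt (real (Suc b))) * X (Suc b, i) (n, m) =
       of_real (p * sqrt (real i)) * X (b, i - 1) (n, m) +
       of_real (q\<^sub>1 * sqrt (real n)) * X (b, i) (n - 1, m) \<and>
     of_real (sqrt (real (Suc i))) * X (b, Suc i) (n, m) =
       of_real (p * sqrt (real b)) * X (b - 1, i) (n, m) +
       of_real (q\<^sub>2 * sqrt (real m)) * X (b, i) (n, m - 1))"

lemma gauss_rows_gauss_op:
  "gauss_rows p q\<^sub>1 q\<^sub>2 (\<lambda>x y. of_real (c * gauss_op p p' q\<^sub>1 q\<^sub>2 x y) :: 'a::real_normed_field)"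
  unfolding gauss_rows_def of_real_mult[symmetric] of_real_add[symmetric] of_real_eq_iff
proof (intro allI conjI)
  fix b i n m
  show "sqrt (real (Suc b)) * (c * gauss_op p p' q\<^sub>1 q\<^sub>2 (Suc b, i) (n, m)) =
       p * sqrt (real i) * (c * gauss_op p p' q\<^sub>1 q\<^sub>2 (b, i - 1) (n, m)) +
       q\<^sub>1 * sqrt (real n) * (c * gauss_op p p' q\<^sub>1 q\<^sub>2 (b, i) (n - 1, m))"
    using arg_cong[OF gauss_op_lower_fst[of b p p' q\<^sub>1 q\<^sub>2 i n m], of "\<lambda>z. c * z"]
    by (simp add: algebra_simps del: of_nat_Suc)
  show "sqrt (real (Suc i)) * (c * gauss_op p p' q\<^sub>1 q\<^sub>2 (b, Suc i) (n, m)) =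
       p * sqrt (real b) * (c * gauss_op p p' q\<^sub>1 q\<^sub>2 (b - 1, i) (n, m)) +
       q\<^sub>2 * sqrt (real m) * (c * gauss_op p p' q\<^sub>1 q\<^sub>2 (b, i) (n, m - 1))"
    using arg_cong[OF gauss_op_lower_snd[of i p p' q\<^sub>1 q\<^sub>2 b n m], of "\<lambda>z. c * z"]
    by (simp add: algebra_simps del: of_nat_Suc)
qed

text \<open>The relations express each row through rows of smaller total number, at columns that
  stay in V. Besides V = \<open>UNIV\<close>, the choice V = \<open>{(0, 0)}\<close> matters:
  applied to the transpose, it fixes the whole row (0, 0) from a single entry.\<close>

lemma gauss_rows_unique:
  fixes X Y :: "nat \<times> nat \<Rightarrow> nat \<times> nat \<Rightarrow> 'a::real_normed_field"
  assumes X: "gauss_rows p q\<^sub>1 q\<^sub>2 X" and Y: "gauss_rows p q\<^sub>1 q\<^sub>2 Y"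
    and V: "\<And>n m. (n, m) \<in> V \<Longrightarrow> (n - 1, m) \<in> V \<and> (n, m - 1) \<in> V"
    and 0: "\<And>y. y \<in> V \<Longrightarrow> X (0, 0) y = Y (0, 0) y"
    and y: "y \<in> V"
  shows "X x y = Y x y"
proof -
  have "X (b, i) (n, m) = Y (b, i) (n, m)" if "(n, m) \<in> V" for b i n m
    using that
  proof (induction "b + i" arbitrary: b i n m rule: less_induct)
    case less
    show ?case
    proof (cases b)
      case (Suc b')
      have "of_real (sqrt (real (Suc b'))) * X (Suc b', i) (n, m)
          = of_real (sqrt (real (Suc b'))) * Y (Suc b', i) (n, m)"
        using X Y less Suc V[OF less.prems] unfolding gauss_rows_def by (cases i) auto
      moreover have "sqrt (real (Suc b')) \<noteq> 0" by simp
      ultimately show ?thesis using Suc by (metis mult_left_cancel of_real_eq_0_iff)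
    next
      case b: 0
      show ?thesis
      proof (cases i)
        case 0
        then show ?thesis using b assms(4) less.prems by simp
      next
        case (Suc i')
        have "of_real (sqrt (real (Suc i'))) * X (0, Suc i') (n, m)
            = of_real (sqrt (real (Suc i'))) * Y (0, Suc i') (n, m)"
          using X Y less Suc b V[OF less.prems] unfolding gauss_rows_def by auto
        moreover have "sqrt (real (Suc i')) \<noteq> 0" by simp
        ultimately show ?thesis using Suc b by (metis mult_left_cancel of_real_eq_0_iff)
      qed
    qed
  qed
  then show ?thesis using y by (cases x; cases y) auto
qed

lemma gauss_rows_cols_unique:
  fixes X Y :: "nat \<times> nat \<Rightarrow> nat \<times> nat \<Rightarrow> 'a::real_normed_field"
  assumes X: "gauss_rows p q\<^sub>1 q\<^sub>2 X" "gauss_rows p' q\<^sub>1' q\<^sub>2' (\<lambda>y x. X x y)"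
    and Y: "gauss_rows p q\<^sub>1 q\<^sub>2 Y" "gauss_rows p' q\<^sub>1' q\<^sub>2' (\<lambda>y x. Y x y)"
    and 0: "X (0, 0) (0, 0) = Y (0, 0) (0, 0)"
  shows "X x y = Y x y"
proof (rule gauss_rows_unique[OF X(1) Y(1), of UNIV])
  show "X (0, 0) y = Y (0, 0) y" for y
    by (rule gauss_rows_unique[OF X(2) Y(2), of "{(0, 0)}"]) (auto simp: 0)
qed auto

section \<open>Geometric decay of rows and columns\<close>

text \<open>Used in place of mere summability because it is stable under products and under the
  unbounded factors sqrt n that ladder operators introduce.\<close>

definition geom_decay :: "(nat \<times> nat \<Rightarrow> real) \<Rightarrow> bool" where
  "geom_decay f \<longleftrightarrow> (\<exists>C \<sigma>. 0 < \<sigma> \<and> \<sigma> < 1 \<and> (\<forall>n m. \<bar>f (n, m)\<bar> \<le> C * \<sigma> ^ (n + m)))"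

lemma geom_decayI:
  assumes "0 < \<sigma>" "\<sigma> < 1" "\<And>n m. \<bar>f (n, m)\<bar> \<le> C * \<sigma> ^ (n + m)"
  shows "geom_decay f"
  using assms unfolding geom_decay_def by blast

lemma geom_decayE:
  assumes "geom_decay f"
  obtains C \<sigma> where "0 < \<sigma>" "\<sigma> < 1" "0 \<le> C" "\<And>n m. \<bar>f (n, m)\<bar> \<le> C * \<sigma> ^ (n + m)"
proof -
  obtain C \<sigma> where *: "0 < \<sigma>" "\<sigma> < 1" "\<And>n m. \<bar>f (n, m)\<bar> \<le> C * \<sigma> ^ (n + m)"
    using assms unfolding geom_decay_def by blast
  have "0 \<le> \<bar>f (0, 0)\<bar>" by simp
  also have "\<dots> \<le> C" using *(3)[of 0 0] by simp
  finally show thesis using * that by blast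
qed

lemma geom_decay_scale: "geom_decay f \<Longrightarrow> geom_decay (\<lambda>y. c * f y)"
proof (erule geom_decayE)
  fix C \<sigma> :: real assume *: "0 < \<sigma>" "\<sigma> < 1" "0 \<le> C" "\<And>n m. \<bar>f (n, m)\<bar> \<le> C * \<sigma> ^ (n + m)"
  show ?thesis
  proof (rule geom_decayI[OF *(1,2)])
    show "\<bar>c * f (n, m)\<bar> \<le> (\<bar>c\<bar> * C) * \<sigma> ^ (n + m)" for n m
      using mult_left_mono[OF *(4)[of n m], of "\<bar>c\<bar>"] by (simp add: abs_mult mult.assoc)
  qed
qed

lemma geom_decay_add:
  assumes "geom_decay f" "geom_decay h"
  shows "geom_decay (\<lambda>y. f y + h y)"
proof -
  obtain C \<sigma> where f: "0 < \<sigma>" "\<sigma> < 1" "0 \<le> C" "\<And>n m. \<bar>f (n, m)\<bar> \<le> C * \<sigma> ^ (n + m)"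
    using assms(1) by (rule geom_decayE) blast
  obtain D \<tau> where h: "0 < \<tau>" "\<tau> < 1" "0 \<le> D" "\<And>n m. \<bar>h (n, m)\<bar> \<le> D * \<tau> ^ (n + m)"
    using assms(2) by (rule geom_decayE) blast
  show ?thesis
  proof (rule geom_decayI[of "max \<sigma> \<tau>"])
    fix n m
    have "\<bar>f (n, m) + h (n, m)\<bar> \<le> C * \<sigma> ^ (n + m) + D * \<tau> ^ (n + m)"
      using f(4)[of n m] h(4)[of n m] by linarith
    also have "\<dots> \<le> C * max \<sigma> \<tau> ^ (n + m) + D * max \<sigma> \<tau> ^ (n + m)"
      using f h by (intro add_mono mult_left_mono power_mono) auto
    finally show "\<bar>f (n, m) + h (n, m)\<bar> \<le> (C + D) * max \<sigma> \<tau> ^ (n + m)"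
      by (simp add: distrib_right)
  qed (use f h in auto)
qed

lemma geom_decay_mult:
  assumes "geom_decay f" "geom_decay h"
  shows "geom_decay (\<lambda>y. f y * h y)"
proof -
  obtain C \<sigma> where f: "0 < \<sigma>" "\<sigma> < 1" "0 \<le> C" "\<And>n m. \<bar>f (n, m)\<bar> \<le> C * \<sigma> ^ (n + m)"
    using assms(1) by (rule geom_decayE) blast
  obtain D \<tau> where h: "0 < \<tau>" "\<tau> < 1" "0 \<le> D" "\<And>n m. \<bar>h (n, m)\<bar> \<le> D * \<tau> ^ (n + m)"
    using assms(2) by (rule geom_decayE) blast
  show ?thesis
  proof (rule geom_decayI[OF f(1,2)])
    fix n m
    have "\<tau> ^ (n + m) \<le> 1" using h by (intro power_le_one) auto
    then have "D * \<tau> ^ (n + m) \<le> D" using h by (simp add: mult_left_le)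
    then have "\<bar>h (n, m)\<bar> \<le> D" using h(4)[of n m] by linarith
    then have "\<bar>f (n, m)\<bar> * \<bar>h (n, m)\<bar> \<le> (C * \<sigma> ^ (n + m)) * D"
      using f by (intro mult_mono) auto
    then show "\<bar>f (n, m) * h (n, m)\<bar> \<le> (C * D) * \<sigma> ^ (n + m)"
      by (simp add: abs_mult mult_ac)
  qed
qed

text \<open>Splitting \<sigma> into \<tau> * \<tau>, one power of \<tau> keeps the decay while the
  other absorbs the linear factor, because k * \<tau> ^ k tends to 0 and so is bounded.\<close>

lemma geom_decay_linear_factor:
  assumes "geom_decay f" and c: "\<And>n m :: nat. \<bar>c (n, m)\<bar> \<le> real (n + m)"
  shows "geom_decay (\<lambda>y. c y * f y)"
proof -
  obtain C \<sigma> where f: "0 < \<sigma>" "\<sigma> < 1" "0 \<le> C" "\<And>n m. \<bar>f (n, m)\<bar> \<le> C * \<sigma> ^ (n + m)"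
    using assms(1) by (rule geom_decayE) blast
  define \<tau> where "\<tau> = sqrt \<sigma>"
  have \<tau>: "0 < \<tau>" "\<tau> < 1" "\<sigma> = \<tau> * \<tau>" using f by (auto simp: \<tau>_def)
  have "(\<lambda>k. real k * \<tau> ^ k) \<longlonglongrightarrow> 0"
    using powser_times_n_limit_0[of \<tau>] \<tau> by simp
  then obtain B where B: "\<And>k. \<bar>real k * \<tau> ^ k\<bar> \<le> B"
    using Bseq_def convergentI convergent_imp_Bseq real_norm_def by metis
  show ?thesis
  proof (rule geom_decayI[OF \<tau>(1,2)])
    fix n m :: nat
    let ?k = "n + m"
    have "\<bar>c (n, m)\<bar> * \<bar>f (n, m)\<bar> \<le> real ?k * (C * \<sigma> ^ ?k)"
      using c[of n m] f(4)[of n m] by (intro mult_mono) auto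
    also have "\<dots> = C * \<tau> ^ ?k * (real ?k * \<tau> ^ ?k)"
      by (simp add: \<tau>(3) power_mult_distrib mult_ac)
    also have "\<dots> \<le> C * \<tau> ^ ?k * B"
      using B[of ?k] f \<tau> by (intro mult_left_mono) auto
    finally show "\<bar>c (n, m) * f (n, m)\<bar> \<le> (C * B) * \<tau> ^ ?k"
      by (simp add: abs_mult mult_ac)
  qed
qed

lemma sqrt_nat_le: "sqrt (real n) \<le> real n"
  by (cases n) (auto intro!: real_le_lsqrt simp: power2_eq_square)

lemma geom_decay_shift:
  assumes "geom_decay f"
  shows "geom_decay (\<lambda>(n, m). f (n - 1, m))" "geom_decay (\<lambda>(n, m). f (n, m - 1))"
proof -
  obtain C \<sigma> where f: "0 < \<sigma>" "\<sigma> < 1" "0 \<le> C" "\<And>n m. \<bar>f (n, m)\<bar> \<le> C * \<sigma> ^ (n + m)"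
    using assms(1) by (rule geom_decayE) blast
  \<comment> \<open>The inequality in k covers a genuine shift by one as well as the truncated
    subtraction at 0; the constant grows by 1 / \<sigma>.\<close>
  have "\<bar>f (n, m)\<bar> \<le> C / \<sigma> * \<sigma> ^ k" if "k \<le> Suc (n + m)" for n m k
  proof -
    have "\<sigma> ^ Suc (n + m) \<le> \<sigma> ^ k" using f that by (intro power_decreasing) auto
    then have "C / \<sigma> * \<sigma> ^ Suc (n + m) \<le> C / \<sigma> * \<sigma> ^ k" using f by (intro mult_left_mono) auto
    then show ?thesis using f(4)[of n m] f(1) by simp
  qed
  then show "geom_decay (\<lambda>(n, m). f (n - 1, m))" "geom_decay (\<lambda>(n, m). f (n, m - 1))"
    using f(1,2) by (auto simp del: times_divide_eq_left intro!: geom_decayI[of \<sigma> _ "C / \<sigma>"])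
qed

lemma geom_decay_raise:
  assumes "geom_decay f"
  shows "geom_decay (\<lambda>(n, m). sqrt (real n) * f (n - 1, m))"
    "geom_decay (\<lambda>(n, m). sqrt (real m) * f (n, m - 1))"
proof -
  have "geom_decay (\<lambda>y. sqrt (real (fst y)) * (case y of (n, m) \<Rightarrow> f (n - 1, m)))"
    by (rule geom_decay_linear_factor[OF geom_decay_shift(1)[OF assms]])
       (simp add: sqrt_nat_le add_increasing add_increasing2)
  then show "geom_decay (\<lambda>(n, m). sqrt (real n) * f (n - 1, m))"
    by (simp add: case_prod_beta')
  have "geom_decay (\<lambda>y. sqrt (real (snd y)) * (case y of (n, m) \<Rightarrow> f (n, m - 1)))"
    by (rule geom_decay_linear_factor[OF geom_decay_shift(2)[OF assms]])
       (simp add: sqrt_nat_le add_increasing add_increasing2)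
  then show "geom_decay (\<lambda>(n, m). sqrt (real m) * f (n, m - 1))"
    by (simp add: case_prod_beta')
qed

lemma geom_decay_summable:
  assumes "geom_decay f"
  shows "f summable_on UNIV"
proof -
  obtain C \<sigma> where f: "0 < \<sigma>" "\<sigma> < 1" "0 \<le> C" "\<And>n m. \<bar>f (n, m)\<bar> \<le> C * \<sigma> ^ (n + m)"
    using assms(1) by (rule geom_decayE) blast
  have geo: "(\<lambda>n. \<sigma> ^ n) summable_on UNIV"
    using f by (intro summable_nonneg_imp_summable_on) auto
  have "(\<lambda>y. C * \<sigma> ^ (fst y + snd y)) summable_on UNIV \<times> UNIV"
  proof (rule summable_on_SigmaI)
    fix n
    show "((\<lambda>m. C * \<sigma> ^ (fst (n, m) + snd (n, m))) has_sum C * \<sigma> ^ n * (\<Sum>\<^sub>\<infinity>m. \<sigma> ^ m)) UNIV"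
      using has_sum_cmult_right[OF has_sum_infsum[OF geo], of "C * \<sigma> ^ n"]
      by (simp add: power_add mult_ac)
    show "(\<lambda>n. C * \<sigma> ^ n * (\<Sum>\<^sub>\<infinity>m. \<sigma> ^ m)) summable_on UNIV"
      by (intro summable_on_cmult_left summable_on_cmult_right geo)
  qed (use f in auto)
  then have s: "(\<lambda>y. C * \<sigma> ^ (fst y + snd y)) summable_on UNIV" by simp
  have "(\<lambda>y. norm (f y)) summable_on UNIV"
    by (rule summable_on_comparison_test[OF s]) (use f(4) in auto)
  then show ?thesis by (rule Infinite_Sum.abs_summable_summable)
qed

lemma gauss_op_row_decay:
  assumes "\<bar>p'\<bar> < 1"
  shows "geom_decay (gauss_op p p' q\<^sub>1 q\<^sub>2 x)"
proof -
  \<comment> \<open>This row lives on the diagonal n = m, where the total number is 2 n, so the rate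
    needed is the square root of \<bar>p'\<bar>. Averaging \<bar>p'\<bar> with 1 keeps the rate
    strictly positive when p' = 0.\<close>
  have row_0: "geom_decay (gauss_op p p' q\<^sub>1 q\<^sub>2 (0, 0))"
  proof (rule geom_decayI[of "sqrt ((\<bar>p'\<bar> + 1) / 2)" _ 1])
    fix n m
    let ?s = "sqrt ((\<bar>p'\<bar> + 1) / 2)"
    have sq: "?s * ?s = (\<bar>p'\<bar> + 1) / 2" by simp
    have "\<bar>p'\<bar> \<le> ?s * ?s" unfolding sq using assms by simp
    then have "\<bar>p'\<bar> ^ n \<le> (?s * ?s) ^ n" by (intro power_mono) auto
    then show "\<bar>gauss_op p p' q\<^sub>1 q\<^sub>2 (0, 0) (n, m)\<bar> \<le> 1 * ?s ^ (n + m)"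
      by (auto simp del: real_sqrt_mult_self simp: gauss_op_row_0 power_abs power_add power_mult_distrib)
  qed (use assms in \<open>auto simp: real_sqrt_lt_1_iff\<close>)
  have "geom_decay (gauss_op p p' q\<^sub>1 q\<^sub>2 (b, i))" for b i
  proof (induction "b + i" arbitrary: b i rule: less_induct)
    case less
    show ?case
    proof (cases b)
      case (Suc b')
      have "gauss_op p p' q\<^sub>1 q\<^sub>2 (Suc b', i) y =
          p * sqrt (real i) / sqrt (real (Suc b')) * gauss_op p p' q\<^sub>1 q\<^sub>2 (b', i - 1) y +
          q\<^sub>1 / sqrt (real (Suc b')) * (case y of (n, m) \<Rightarrow> sqrt (real n) * gauss_op p p' q\<^sub>1 q\<^sub>2 (b', i) (n - 1, m))" for y
        using gauss_op_lower_fst[of b' p p' q\<^sub>1 q\<^sub>2 i "fst y" "snd y"]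
        by (cases y) (simp add: field_simps del: of_nat_Suc)
      then have "gauss_op p p' q\<^sub>1 q\<^sub>2 (b, i) = (\<lambda>y.
          p * sqrt (real i) / sqrt (real (Suc b')) * gauss_op p p' q\<^sub>1 q\<^sub>2 (b', i - 1) y +
          q\<^sub>1 / sqrt (real (Suc b')) * (case y of (n, m) \<Rightarrow> sqrt (real n) * gauss_op p p' q\<^sub>1 q\<^sub>2 (b', i) (n - 1, m)))"
        by (simp add: Suc fun_eq_iff del: of_nat_Suc)
      moreover have "geom_decay \<dots>"
        by (intro geom_decay_add geom_decay_scale geom_decay_raise less) (auto simp: Suc)
      ultimately show ?thesis by simp
    next
      case b: 0
      show ?thesis
      proof (cases i)
        case 0
        then show ?thesis using row_0 b by simp
      next
        case (Suc i')
        have "gauss_op p p' q\<^sub>1 q\<^sub>2 (0, Suc i') y =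
            q\<^sub>2 / sqrt (real (Suc i')) * (case y of (n, m) \<Rightarrow> sqrt (real m) * gauss_op p p' q\<^sub>1 q\<^sub>2 (0, i') (n, m - 1))" for y
          using gauss_op_lower_snd[of i' p p' q\<^sub>1 q\<^sub>2 0 "fst y" "snd y"]
          by (cases y) (simp add: field_simps del: of_nat_Suc)
        then have "gauss_op p p' q\<^sub>1 q\<^sub>2 (b, i) = (\<lambda>y.
            q\<^sub>2 / sqrt (real (Suc i')) * (case y of (n, m) \<Rightarrow> sqrt (real m) * gauss_op p p' q\<^sub>1 q\<^sub>2 (0, i') (n, m - 1)))"
          by (simp add: Suc b fun_eq_iff del: of_nat_Suc)
        moreover have "geom_decay \<dots>"
          by (intro geom_decay_scale geom_decay_raise less) (auto simp: Suc b)
        ultimately show ?thesis by simp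
      qed
    qed
  qed
  then show ?thesis by (cases x) auto
qed

lemma gauss_op_col_decay:
  assumes "\<bar>p\<bar> < 1"
  shows "geom_decay (\<lambda>x. gauss_op p p' q\<^sub>1 q\<^sub>2 x y)"
  unfolding gauss_op_transpose[of p p' q\<^sub>1 q\<^sub>2] using gauss_op_row_decay[OF assms] .

text \<open>Raising and lowering operators are adjoint. The term with index 0 vanishes, and the rest
  is reindexed by \<open>Suc\<close>; both steps are valid for arbitrary families.\<close>

lemma infsum_raise_lower:
  fixes f h :: "nat \<times> nat \<Rightarrow> real"
  shows "(\<Sum>\<^sub>\<infinity>(n, m). (sqrt (real n) * f (n - 1, m)) * h (n, m))
       = (\<Sum>\<^sub>\<infinity>(n, m). f (n, m) * (sqrt (real (Suc n)) * h (Suc n, m)))"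
    and "(\<Sum>\<^sub>\<infinity>(n, m). (sqrt (real m) * f (n, m - 1)) * h (n, m))
       = (\<Sum>\<^sub>\<infinity>(n, m). f (n, m) * (sqrt (real (Suc m)) * h (n, Suc m)))"
proof -
  have "(\<Sum>\<^sub>\<infinity>(n, m). (sqrt (real n) * f (n - 1, m)) * h (n, m))
      = (\<Sum>\<^sub>\<infinity>(n, m)\<in>range (\<lambda>(n, m). (Suc n, m)). (sqrt (real n) * f (n - 1, m)) * h (n, m))"
    by (rule infsum_cong_neutral) (auto simp: image_iff gr0_conv_Suc split: prod.splits)
  also have "\<dots> = (\<Sum>\<^sub>\<infinity>(n, m). f (n, m) * (sqrt (real (Suc n)) * h (Suc n, m)))"
    by (subst infsum_reindex) (auto simp: inj_on_def comp_def case_prod_beta' mult_ac)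
  finally show "(\<Sum>\<^sub>\<infinity>(n, m). (sqrt (real n) * f (n - 1, m)) * h (n, m))
       = (\<Sum>\<^sub>\<infinity>(n, m). f (n, m) * (sqrt (real (Suc n)) * h (Suc n, m)))" .
  have "(\<Sum>\<^sub>\<infinity>(n, m). (sqrt (real m) * f (n, m - 1)) * h (n, m))
      = (\<Sum>\<^sub>\<infinity>(n, m)\<in>range (\<lambda>(n, m). (n, Suc m)). (sqrt (real m) * f (n, m - 1)) * h (n, m))"
    by (rule infsum_cong_neutral) (auto simp: image_iff gr0_conv_Suc split: prod.splits)
  also have "\<dots> = (\<Sum>\<^sub>\<infinity>(n, m). f (n, m) * (sqrt (real (Suc m)) * h (n, Suc m)))"
    by (subst infsum_reindex) (auto simp: inj_on_def comp_def case_prod_beta' mult_ac)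
  finally show "(\<Sum>\<^sub>\<infinity>(n, m). (sqrt (real m) * f (n, m - 1)) * h (n, m))
       = (\<Sum>\<^sub>\<infinity>(n, m). f (n, m) * (sqrt (real (Suc m)) * h (n, Suc m)))" .
qed


section \<open>Composition of Gaussian operators\<close>

definition gauss_comp ::
  "real \<Rightarrow> real \<Rightarrow> real \<Rightarrow> real \<Rightarrow> real \<Rightarrow> real \<Rightarrow> real \<Rightarrow> real \<Rightarrow> nat \<times> nat \<Rightarrow> nat \<times> nat \<Rightarrow> real" where
  "gauss_comp p p' q\<^sub>1 q\<^sub>2 r r' s\<^sub>1 s\<^sub>2 x z = (\<Sum>\<^sub>\<infinity>y. gauss_op p p' q\<^sub>1 q\<^sub>2 x y * gauss_op r r' s\<^sub>1 s\<^sub>2 y z)"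

lemma gauss_comp_swap:
  "gauss_comp p p' q\<^sub>1 q\<^sub>2 r r' s\<^sub>1 s\<^sub>2 x z
     = gauss_comp p p' q\<^sub>2 q\<^sub>1 r r' s\<^sub>2 s\<^sub>1 (prod.swap x) (prod.swap z)"
proof -
  have "gauss_comp p p' q\<^sub>2 q\<^sub>1 r r' s\<^sub>2 s\<^sub>1 (prod.swap x) (prod.swap z)
      = (\<Sum>\<^sub>\<infinity>y\<in>UNIV. gauss_op p p' q\<^sub>2 q\<^sub>1 (prod.swap x) (prod.swap y)
          * gauss_op r r' s\<^sub>2 s\<^sub>1 (prod.swap y) (prod.swap z))"
    unfolding gauss_comp_def
    by (rule infsum_reindex_bij_betw[symmetric]) (rule bij_swap)
  then show ?thesis
    by (simp add: gauss_comp_def flip: gauss_op_swap)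
qed

lemma gauss_comp_transpose:
  "gauss_comp p p' q\<^sub>1 q\<^sub>2 r r' s\<^sub>1 s\<^sub>2 x z = gauss_comp r' r s\<^sub>1 s\<^sub>2 p' p q\<^sub>1 q\<^sub>2 z x"
  unfolding gauss_comp_def
  by (subst gauss_op_transpose, subst (2) gauss_op_transpose) (simp add: mult.commute)

lemma gauss_comp_summable:
  assumes "\<bar>p'\<bar> < 1" "\<bar>r\<bar> < 1"
  shows "(\<lambda>y. gauss_op p p' q\<^sub>1 q\<^sub>2 x y * gauss_op r r' s\<^sub>1 s\<^sub>2 y z) summable_on UNIV"
  by (intro geom_decay_summable geom_decay_mult gauss_op_row_decay gauss_op_col_decay assms)

text \<open>
  With \<open>a\<^sub>1\<close> and \<open>a\<^sub>2\<close> the lowering operators of the intermediate modes, the entries \<open>Y\<close> and \<open>Z\<close> of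
  \<open>A a\<^sub>1 B\<close> and \<open>A a\<^sub>2\<^sup>\<dagger> B\<close> satisfy a linear system of determinant \<open>1 - p' r\<close>.
\<close>

lemma gauss_comp_lower_fst:
  assumes p': "\<bar>p'\<bar> < 1" and r: "\<bar>r\<bar> < 1"
  defines "d \<equiv> 1 - p' * r"
  shows "sqrt (real (Suc b)) * gauss_comp p p' q\<^sub>1 q\<^sub>2 r r' s\<^sub>1 s\<^sub>2 (Suc b, i) (n, m) =
     (p + q\<^sub>1 * q\<^sub>2 * r / d) * sqrt (real i) * gauss_comp p p' q\<^sub>1 q\<^sub>2 r r' s\<^sub>1 s\<^sub>2 (b, i - 1) (n, m) +
     (q\<^sub>1 * s\<^sub>1 / d) * sqrt (real n) * gauss_comp p p' q\<^sub>1 q\<^sub>2 r r' s\<^sub>1 s\<^sub>2 (b, i) (n - 1, m)"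
proof -
  let ?A = "gauss_op p p' q\<^sub>1 q\<^sub>2" and ?B = "gauss_op r r' s\<^sub>1 s\<^sub>2"
  let ?X = "gauss_comp p p' q\<^sub>1 q\<^sub>2 r r' s\<^sub>1 s\<^sub>2" and ?z = "(n, m)"
  have A: "geom_decay (?A x)" for x by (rule gauss_op_row_decay[OF p'])
  have B: "geom_decay (\<lambda>y. ?B y z)" for z by (rule gauss_op_col_decay[OF r])
  have X: "((\<lambda>y. ?A x y * ?B y z) has_sum ?X x z) UNIV" for x z
    unfolding gauss_comp_def by (rule has_sum_infsum[OF gauss_comp_summable[OF p' r]])
  define Y where "Y = (\<Sum>\<^sub>\<infinity>(k, l). (sqrt (real k) * ?A (b, i) (k - 1, l)) * ?B (k, l) ?z)"
  define Z where "Z = (\<Sum>\<^sub>\<infinity>(k, l). ?A (b, i) (k, l) * (sqrt (real l) * ?B (k, l - 1) ?z))"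
  have Ys: "((\<lambda>(k, l). (sqrt (real k) * ?A (b, i) (k - 1, l)) * ?B (k, l) ?z) has_sum Y) UNIV"
    unfolding Y_def
    using has_sum_infsum[OF geom_decay_summable[OF geom_decay_mult[OF geom_decay_raise(1)[OF A] B]]]
    by (simp add: case_prod_beta')
  have Zs: "((\<lambda>(k, l). ?A (b, i) (k, l) * (sqrt (real l) * ?B (k, l - 1) ?z)) has_sum Z) UNIV"
    unfolding Z_def
    using has_sum_infsum[OF geom_decay_summable[OF geom_decay_mult[OF A geom_decay_raise(2)[OF B]]]]
    by (simp add: case_prod_beta')
  have "(\<lambda>y. sqrt (real (Suc b)) * (?A (Suc b, i) y * ?B y ?z)) =
      (\<lambda>y. p * sqrt (real i) * (?A (b, i - 1) y * ?B y ?z)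
         + q\<^sub>1 * (case y of (k, l) \<Rightarrow> (sqrt (real k) * ?A (b, i) (k - 1, l)) * ?B (k, l) ?z))"
    using gauss_op_lower_fst[of b p p' q\<^sub>1 q\<^sub>2 i]
    by (auto simp: fun_eq_iff simp flip: mult.assoc) (simp add: algebra_simps)
  moreover have "(\<dots> has_sum p * sqrt (real i) * ?X (b, i - 1) ?z + q\<^sub>1 * Y) UNIV"
    by (intro has_sum_add has_sum_cmult_right X Ys)
  ultimately have "((\<lambda>y. sqrt (real (Suc b)) * (?A (Suc b, i) y * ?B y ?z)) has_sum
      p * sqrt (real i) * ?X (b, i - 1) ?z + q\<^sub>1 * Y) UNIV"
    by simp
  from has_sum_unique[OF has_sum_cmult_right[OF X] this]
  have LX: "sqrt (real (Suc b)) * ?X (Suc b, i) ?z = p * sqrt (real i) * ?X (b, i - 1) ?z + q\<^sub>1 * Y" .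

  have "Y = (\<Sum>\<^sub>\<infinity>(k, l). ?A (b, i) (k, l) * (sqrt (real (Suc k)) * ?B (Suc k, l) ?z))"
    unfolding Y_def by (rule infsum_raise_lower(1))
  also have "(\<lambda>(k, l). ?A (b, i) (k, l) * (sqrt (real (Suc k)) * ?B (Suc k, l) ?z)) =
      (\<lambda>y. r * (case y of (k, l) \<Rightarrow> ?A (b, i) (k, l) * (sqrt (real l) * ?B (k, l - 1) ?z))
         + s\<^sub>1 * sqrt (real n) * (?A (b, i) y * ?B y (n - 1, m)))"
    using gauss_op_lower_fst[of _ r r' s\<^sub>1 s\<^sub>2 _ n m]
    by (auto simp: fun_eq_iff algebra_simps)
  also have "infsum \<dots> UNIV = r * Z + s\<^sub>1 * sqrt (real n) * ?X (b, i) (n - 1, m)"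
    by (intro infsumI has_sum_add has_sum_cmult_right X Zs)
  finally have Y: "Y = r * Z + s\<^sub>1 * sqrt (real n) * ?X (b, i) (n - 1, m)" .

  have "Z = (\<Sum>\<^sub>\<infinity>(k, l). (sqrt (real l) * ?B (k, l - 1) ?z) * ?A (b, i) (k, l))"
    unfolding Z_def by (simp add: mult.commute)
  also have "\<dots> = (\<Sum>\<^sub>\<infinity>(k, l). ?B (k, l) ?z * (sqrt (real (Suc l)) * ?A (b, i) (k, Suc l)))"
    by (rule infsum_raise_lower(2))
  also have "(\<lambda>(k, l). ?B (k, l) ?z * (sqrt (real (Suc l)) * ?A (b, i) (k, Suc l))) =
      (\<lambda>y. p' * (case y of (k, l) \<Rightarrow> (sqrt (real k) * ?A (b, i) (k - 1, l)) * ?B (k, l) ?z)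
         + q\<^sub>2 * sqrt (real i) * (?A (b, i - 1) y * ?B y ?z))"
  proof -
    \<comment> \<open>Lowering a column index of A is the ladder relation of its transpose, in which
      p and p' trade places.\<close>
    have "sqrt (real (Suc l)) * ?A (b, i) (k, Suc l)
        = p' * sqrt (real k) * ?A (b, i) (k - 1, l) + q\<^sub>2 * sqrt (real i) * ?A (b, i - 1) (k, l)" for k l
      using gauss_op_lower_snd[of l p' p q\<^sub>1 q\<^sub>2 k b i] by (simp only: gauss_op_transpose[of p'])
    then show ?thesis by (auto simp: fun_eq_iff algebra_simps)
  qed
  also have "infsum \<dots> UNIV = p' * Y + q\<^sub>2 * sqrt (real i) * ?X (b, i - 1) ?z"
    by (intro infsumI has_sum_add has_sum_cmult_right X Ys)
  finally have Z: "Z = p' * Y + q\<^sub>2 * sqrt (real i) * ?X (b, i - 1) ?z" .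

  have "\<bar>p' * r\<bar> < 1" using p' r mult_strict_mono'[of "\<bar>p'\<bar>" 1 "\<bar>r\<bar>" 1] by (simp add: abs_mult)
  then have "d \<noteq> 0" unfolding d_def by auto
  have "d * Y = r * q\<^sub>2 * sqrt (real i) * ?X (b, i - 1) ?z + s\<^sub>1 * sqrt (real n) * ?X (b, i) (n - 1, m)"
    using Y unfolding Z d_def by (simp add: algebra_simps)
  then have "Y = (r * q\<^sub>2 * sqrt (real i) * ?X (b, i - 1) ?z + s\<^sub>1 * sqrt (real n) * ?X (b, i) (n - 1, m)) / d"
    using \<open>d \<noteq> 0\<close> by (simp add: field_simps)
  then show ?thesis
    unfolding LX by (simp add: divide_inverse algebra_simps)
qed

lemma gauss_comp_rows:
  assumes "\<bar>p'\<bar> < 1" "\<bar>r\<bar> < 1"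
  shows "gauss_rows (p + q\<^sub>1 * q\<^sub>2 * r / (1 - p' * r)) (q\<^sub>1 * s\<^sub>1 / (1 - p' * r)) (q\<^sub>2 * s\<^sub>2 / (1 - p' * r))
    (gauss_comp p p' q\<^sub>1 q\<^sub>2 r r' s\<^sub>1 s\<^sub>2)"
  unfolding gauss_rows_def
proof (intro allI conjI)
  fix b i n m
  show "of_real (sqrt (real (Suc b))) * gauss_comp p p' q\<^sub>1 q\<^sub>2 r r' s\<^sub>1 s\<^sub>2 (Suc b, i) (n, m) =
     of_real ((p + q\<^sub>1 * q\<^sub>2 * r / (1 - p' * r)) * sqrt (real i)) * gauss_comp p p' q\<^sub>1 q\<^sub>2 r r' s\<^sub>1 s\<^sub>2 (b, i - 1) (n, m) +
     of_real (q\<^sub>1 * s\<^sub>1 / (1 - p' * r) * sqrt (real n)) * gauss_comp p p' q\<^sub>1 q\<^sub>2 r r' s\<^sub>1 s\<^sub>2 (b, i) (n - 1, m)"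
    using gauss_comp_lower_fst[OF assms, of b p q\<^sub>1 q\<^sub>2 r' s\<^sub>1 s\<^sub>2 i n m] by simp
  show "of_real (sqrt (real (Suc i))) * gauss_comp p p' q\<^sub>1 q\<^sub>2 r r' s\<^sub>1 s\<^sub>2 (b, Suc i) (n, m) =
     of_real ((p + q\<^sub>1 * q\<^sub>2 * r / (1 - p' * r)) * sqrt (real b)) * gauss_comp p p' q\<^sub>1 q\<^sub>2 r r' s\<^sub>1 s\<^sub>2 (b - 1, i) (n, m) +
     of_real (q\<^sub>2 * s\<^sub>2 / (1 - p' * r) * sqrt (real m)) * gauss_comp p p' q\<^sub>1 q\<^sub>2 r r' s\<^sub>1 s\<^sub>2 (b, i) (n, m - 1)"
    using gauss_comp_lower_fst[OF assms, of i p q\<^sub>2 q\<^sub>1 r' s\<^sub>2 s\<^sub>1 b m n]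
    by (simp add: gauss_comp_swap[of p p' q\<^sub>1 q\<^sub>2] mult.commute)
qed

lemma gauss_comp_eq:
  assumes p': "\<bar>p'\<bar> < 1" and r: "\<bar>r\<bar> < 1"
  shows "gauss_comp p p' q\<^sub>1 q\<^sub>2 r r' s\<^sub>1 s\<^sub>2 x z = 1 / (1 - p' * r) *
    gauss_op (p + q\<^sub>1 * q\<^sub>2 * r / (1 - p' * r)) (r' + s\<^sub>1 * s\<^sub>2 * p' / (1 - p' * r))
      (q\<^sub>1 * s\<^sub>1 / (1 - p' * r)) (q\<^sub>2 * s\<^sub>2 / (1 - p' * r)) x z"
proof -
  let ?P = "p + q\<^sub>1 * q\<^sub>2 * r / (1 - p' * r)" and ?P' = "r' + s\<^sub>1 * s\<^sub>2 * p' / (1 - p' * r)"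
  let ?Q1 = "q\<^sub>1 * s\<^sub>1 / (1 - p' * r)" and ?Q2 = "q\<^sub>2 * s\<^sub>2 / (1 - p' * r)"
  have abs: "\<bar>p' * r\<bar> < 1" using p' r mult_strict_mono'[of "\<bar>p'\<bar>" 1 "\<bar>r\<bar>" 1] by (simp add: abs_mult)
  \<comment> \<open>The normalization 1 / (1 - p' r) comes from the vacuum entry: the row and the
    column belonging to (0, 0) live on the diagonal, which leaves a geometric series in p'
    r.\<close>
  have 0: "gauss_comp p p' q\<^sub>1 q\<^sub>2 r r' s\<^sub>1 s\<^sub>2 (0, 0) (0, 0) = 1 / (1 - p' * r)"
  proof -
    have "gauss_comp p p' q\<^sub>1 q\<^sub>2 r r' s\<^sub>1 s\<^sub>2 (0, 0) (0, 0)
        = (\<Sum>\<^sub>\<infinity>y\<in>range (\<lambda>n. (n, n)). gauss_op p p' q\<^sub>1 q\<^sub>2 (0, 0) y * gauss_op r r' s\<^sub>1 s\<^sub>2 y (0, 0))"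
      unfolding gauss_comp_def
      by (rule infsum_cong_neutral) (auto simp: gauss_op_row_0 image_iff)
    also have "\<dots> = (\<Sum>\<^sub>\<infinity>n. (p' * r) ^ n)"
      by (subst infsum_reindex)
         (auto simp: inj_on_def comp_def gauss_op_row_0 gauss_op_transpose[of r] simp flip: power_mult_distrib)
    also have "\<dots> = 1 / (1 - p' * r)"
      using geometric_sums[of "p' * r"] abs summable_geometric[of "\<bar>p' * r\<bar>"]
      by (intro infsumI norm_summable_imp_has_sum) (auto simp: power_abs)
    finally show ?thesis .
  qed
  show ?thesis
  proof (rule gauss_rows_cols_unique[where X = "gauss_comp p p' q\<^sub>1 q\<^sub>2 r r' s\<^sub>1 s\<^sub>2"
        and Y = "\<lambda>x z. 1 / (1 - p' * r) * gauss_op ?P ?P' ?Q1 ?Q2 x z"])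
    show "gauss_rows ?P ?Q1 ?Q2 (gauss_comp p p' q\<^sub>1 q\<^sub>2 r r' s\<^sub>1 s\<^sub>2)"
      by (rule gauss_comp_rows[OF p' r])
    show "gauss_rows ?P' ?Q1 ?Q2 (\<lambda>y x. gauss_comp p p' q\<^sub>1 q\<^sub>2 r r' s\<^sub>1 s\<^sub>2 x y)"
      unfolding gauss_comp_transpose[of p]
      using gauss_comp_rows[OF r p', of r' s\<^sub>1 s\<^sub>2 q\<^sub>1 q\<^sub>2 p] by (simp add: mult_ac)
    show "gauss_rows ?P ?Q1 ?Q2 (\<lambda>x z. 1 / (1 - p' * r) * gauss_op ?P ?P' ?Q1 ?Q2 x z)"
      using gauss_rows_gauss_op[of ?P ?Q1 ?Q2 "1 / (1 - p' * r)" ?P', where ?'a = real] by simp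
    show "gauss_rows ?P' ?Q1 ?Q2 (\<lambda>y x. 1 / (1 - p' * r) * gauss_op ?P ?P' ?Q1 ?Q2 x y)"
      unfolding gauss_op_transpose[of ?P]
      using gauss_rows_gauss_op[of ?P' ?Q1 ?Q2 "1 / (1 - p' * r)" ?P, where ?'a = real] by simp
  qed (simp add: 0 gauss_op_row_0)
qed

subsection \<open>The output state of the channel\<close>

lemma op_mult_diag_left: "op_mult (op_diag d) A = (\<lambda>i j. d i * A i j)"
proof (intro ext)
  fix i j
  show "op_mult (op_diag d) A i j = d i * A i j"
    unfolding op_mult_def op_diag_def
    by (rule infsumI, rule has_sum_finite_neutralI[of "{i}"]) auto
qed

lemma op_adj_diag: "op_adj (op_diag d) = op_diag (\<lambda>i. cnj (d i))"
  by (auto simp: op_adj_def op_diag_def fun_eq_iff)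

lemma op_conjugate_by_diag: "op_conjugate (op_diag d) A i j = d i * A i j * cnj (d j)"
  by (simp add: op_conjugate_def op_mult_diag_left op_adj_diag op_mult_diag_right)

definition phase :: "real \<Rightarrow> nat \<Rightarrow> complex" where
  "phase \<theta> n = exp (\<i> * complex_of_real \<theta> * of_nat n)"

lemma phase_shift_tensor_id: "op_tensor (phase_shift \<theta>) op_id = op_diag (\<lambda>x. phase \<theta> (fst x))"
  by (auto simp: op_tensor_def phase_shift_def op_diag_def op_id_def phase_def fun_eq_iff)

lemma phase_cnj: "phase \<theta> n * cnj (phase \<theta> n) = 1"
  by (simp add: phase_def exp_cnj flip: exp_add)

text \<open>
  The output state is \<open>K K\<^sup>\<dagger>\<close>, the columns of \<open>K\<close> being indexed by the photon number \<open>c\<close> of the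
  environment before the beamsplitter and the photon number \<open>e\<close> of the lost mode.
\<close>

definition kraus_op :: "real \<Rightarrow> real \<Rightarrow> real \<Rightarrow> nat \<times> nat \<Rightarrow> nat \<times> nat \<Rightarrow> complex" where
  "kraus_op \<eta> N\<^sub>B N\<^sub>S x y = beamsplitter_ket \<eta> (snd x) (fst y) (fst x, snd y) *
     complex_of_real (sqrt (N\<^sub>S ^ snd x / (N\<^sub>S + 1) ^ (snd x + 1)) * sqrt (N\<^sub>B ^ fst y / (N\<^sub>B + 1) ^ (fst y + 1)))"

text \<open>The beamsplitter fixes the idler index and \<rho> lives on equal signal and idler
  numbers, so both matrix products collapse and only the environment number c remains to be
  summed.\<close>

lemma conjugate_beamsplitter_ext:
  fixes \<Phi> :: "nat \<Rightarrow> complex" and \<tau> :: "nat \<Rightarrow> real"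
  assumes \<rho>: "\<rho> = (\<lambda>y y'. if fst y = snd y \<and> fst y' = snd y' then \<Phi> (fst y) * cnj (\<Phi> (fst y')) else 0)"
  shows "op_conjugate (beamsplitter_ext \<eta>) (op_tensor \<rho> (op_diag (\<lambda>n. complex_of_real (\<tau> n)))) ((b, i), e) ((b', i'), e') =
    (\<Sum>\<^sub>\<infinity>c. beamsplitter_ket \<eta> i c (b, e) * \<Phi> i * complex_of_real (\<tau> c) *
       cnj (beamsplitter_ket \<eta> i' c (b', e') * \<Phi> i'))"
proof -
  let ?\<sigma> = "op_tensor \<rho> (op_diag (\<lambda>n. complex_of_real (\<tau> n)))"
  have 1: "op_mult (beamsplitter_ext \<eta>) ?\<sigma> ((b, i), e) y
      = beamsplitter_ket \<eta> i (snd y) (b, e) * ?\<sigma> ((i, i), snd y) y" for y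
    unfolding op_mult_def
    by (rule infsumI, rule has_sum_finite_neutralI[of "{((i, i), snd y)}"])
       (auto simp: beamsplitter_ext_def op_id_def op_tensor_def \<rho> op_diag_def beamsplitter_def)
  have "op_conjugate (beamsplitter_ext \<eta>) ?\<sigma> ((b, i), e) ((b', i'), e') =
      (\<Sum>\<^sub>\<infinity>y. beamsplitter_ket \<eta> i (snd y) (b, e) * ?\<sigma> ((i, i), snd y) y
        * cnj (beamsplitter_ext \<eta> ((b', i'), e') y))"
    unfolding op_conjugate_def op_mult_def[of "op_mult (beamsplitter_ext \<eta>) ?\<sigma>"] 1 op_adj_def ..
  also have "\<dots> = (\<Sum>\<^sub>\<infinity>y\<in>range (\<lambda>c. ((i', i'), c)). beamsplitter_ket \<eta> i (snd y) (b, e) * ?\<sigma> ((i, i), snd y) y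
        * cnj (beamsplitter_ext \<eta> ((b', i'), e') y))"
    by (rule infsum_cong_neutral)
       (auto simp: beamsplitter_ext_def op_id_def op_tensor_def \<rho> image_iff)
  also have "\<dots> = (\<Sum>\<^sub>\<infinity>c. beamsplitter_ket \<eta> i c (b, e) * \<Phi> i * complex_of_real (\<tau> c) *
       cnj (beamsplitter_ket \<eta> i' c (b', e') * \<Phi> i'))"
    by (subst infsum_reindex)
       (auto simp: inj_on_def comp_def beamsplitter_ext_def op_id_def op_tensor_def \<rho> op_diag_def
          beamsplitter_def mult_ac)
  finally show ?thesis .
qed

text \<open>As signal and idler numbers agree in the TMSV state, a phase on the signal is a phase on
  the idler number, which the channel does not touch; it factors out. Summability over pairs merges
  the iterated sums over e and c.\<close>

lemma output_state_tmsv: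
  assumes "N\<^sub>B \<ge> 0" "N\<^sub>S \<ge> 0"
    and sm: "(\<lambda>y. kraus_op \<eta> N\<^sub>B N\<^sub>S x y * cnj (kraus_op \<eta> N\<^sub>B N\<^sub>S x' y)) summable_on UNIV"
  shows "output_state \<eta> N\<^sub>B (tmsv_state N\<^sub>S) \<theta> x x' = phase \<theta> (snd x) * cnj (phase \<theta> (snd x')) *
    (\<Sum>\<^sub>\<infinity>y. kraus_op \<eta> N\<^sub>B N\<^sub>S x y * cnj (kraus_op \<eta> N\<^sub>B N\<^sub>S x' y))"
proof -
  obtain b i b' i' where x: "x = (b, i)" "x' = (b', i')" by (cases x; cases x')
  let ?ph = "phase \<theta> i * cnj (phase \<theta> i')"
  let ?K = "kraus_op \<eta> N\<^sub>B N\<^sub>S"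
  define \<Phi> where "\<Phi> n = phase \<theta> n * complex_of_real (sqrt (N\<^sub>S ^ n / (N\<^sub>S + 1) ^ (n + 1)))" for n
  define \<tau> where "\<tau> c = N\<^sub>B ^ c / (N\<^sub>B + 1) ^ (c + 1)" for c
  have \<tau>: "complex_of_real (\<tau> c) = complex_of_real (sqrt (\<tau> c)) * complex_of_real (sqrt (\<tau> c))" for c
    using assms(1) by (simp add: \<tau>_def flip: of_real_mult)
  have \<rho>: "op_conjugate (op_tensor (phase_shift \<theta>) op_id) (tmsv_state N\<^sub>S)
      = (\<lambda>y y'. if fst y = snd y \<and> fst y' = snd y' then \<Phi> (fst y) * cnj (\<Phi> (fst y')) else 0)"
    by (auto simp: fun_eq_iff phase_shift_tensor_id op_conjugate_by_diag tmsv_state_def projector_def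
        tmsv_ket_def \<Phi>_def)
  have "output_state \<eta> N\<^sub>B (tmsv_state N\<^sub>S) \<theta> x x' =
      (\<Sum>\<^sub>\<infinity>e. \<Sum>\<^sub>\<infinity>c. beamsplitter_ket \<eta> i c (b, e) * \<Phi> i * complex_of_real (\<tau> c) *
       cnj (beamsplitter_ket \<eta> i' c (b', e) * \<Phi> i'))"
    unfolding output_state_def lossy_thermal_channel_def partial_trace_snd_def thermal_state_def
      \<tau>_def[symmetric] x
    by (subst conjugate_beamsplitter_ext[OF \<rho>]) simp
  also have "\<dots> = (\<Sum>\<^sub>\<infinity>e. \<Sum>\<^sub>\<infinity>c. ?ph * (?K x (c, e) * cnj (?K x' (c, e))))"
    unfolding \<tau> by (simp add: kraus_op_def x \<Phi>_def \<tau>_def mult_ac)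
  also have "\<dots> = ?ph * (\<Sum>\<^sub>\<infinity>e. \<Sum>\<^sub>\<infinity>c. ?K x (c, e) * cnj (?K x' (c, e)))"
    by (simp only: infsum_cmult_right')
  also have "(\<Sum>\<^sub>\<infinity>e. \<Sum>\<^sub>\<infinity>c. ?K x (c, e) * cnj (?K x' (c, e))) = (\<Sum>\<^sub>\<infinity>y. ?K x y * cnj (?K x' y))"
  proof -
    let ?S = "\<Sum>\<^sub>\<infinity>y. ?K x y * cnj (?K x' y)"
    have "((\<lambda>y. ?K x y * cnj (?K x' y)) has_sum ?S) (UNIV \<times> UNIV)"
      using has_sum_infsum[OF sm] by simp
    then have swapped: "((\<lambda>(e, c). ?K x (c, e) * cnj (?K x' (c, e))) has_sum ?S) (UNIV \<times> UNIV)"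
      by (subst (asm) has_sum_swap)
    show ?thesis
    proof (rule infsumI, rule has_sum_SigmaD[OF swapped])
      fix e
      have "(\<lambda>c. ?K x (c, e) * cnj (?K x' (c, e))) summable_on UNIV"
        by (rule summable_on_SigmaD1[OF has_sum_imp_summable[OF swapped]]) simp
      then show "((\<lambda>c. case (e, c) of (e, c) \<Rightarrow> ?K x (c, e) * cnj (?K x' (c, e))) has_sum
          (\<Sum>\<^sub>\<infinity>c. ?K x (c, e) * cnj (?K x' (c, e)))) UNIV"
        by simp
    qed
  qed
  finally show ?thesis by (simp add: x)
qed

section \<open>Beamsplitter amplitudes as a Gaussian kernel\<close>

lemma beamsplitter_ket_row_0:
  "beamsplitter_ket \<eta> 0 m (0, e) = (if m = e then complex_of_real (sqrt \<eta> ^ m) else 0)"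
proof -
  have "(raise_comb (sqrt (1 - \<eta>)) (sqrt \<eta>) ^^ m) vacuum (0, e) =
      (if m = e then complex_of_real (sqrt \<eta> ^ m * sqrt (fact m)) else 0)" for e
  proof (induction m arbitrary: e)
    case 0
    then show ?case by (simp add: vacuum_def)
  next
    case (Suc m)
    then show ?case
      by (cases e) (simp_all add: raise_comb_def raise_fst_def raise_snd_def real_sqrt_mult del: of_nat_Suc)
  qed
  then show ?thesis
    by (simp add: beamsplitter_ket_def)
qed

lemma beamsplitter_ket_Suc:
  "complex_of_real (sqrt (real (Suc n))) * beamsplitter_ket \<eta> (Suc n) m x =
     raise_comb (sqrt \<eta>) (- sqrt (1 - \<eta>)) (beamsplitter_ket \<eta> n m) x"
proof -
  let ?R = "raise_comb (sqrt \<eta>) (- sqrt (1 - \<eta>))"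
  let ?\<psi> = "(?R ^^ n) ((raise_comb (sqrt (1 - \<eta>)) (sqrt \<eta>) ^^ m) vacuum)"
  have "complex_of_real (sqrt (real (Suc n))) * beamsplitter_ket \<eta> (Suc n) m x
      = ?R ?\<psi> x / complex_of_real (sqrt (fact n * fact m))"
    by (simp add: beamsplitter_ket_def real_sqrt_mult field_simps del: of_nat_Suc)
  also have "\<dots> = ?R (beamsplitter_ket \<eta> n m) x"
    by (simp add: raise_comb_def raise_fst_def raise_snd_def beamsplitter_ket_def add_divide_distrib diff_divide_distrib)
  finally show ?thesis .
qed

text \<open>The relation in b is the defining mode relation \<open>beamsplitter_mode_b\<close>, and
  the relation in i expresses the creation of one more signal photon at the input. The weights l and
  u carry the TMSV amplitude per idler photon and the thermal amplitude per environment
  photon.\<close>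

lemma beamsplitter_ket_eq_gauss_op:
  "beamsplitter_ket \<eta> i c (b, e) * complex_of_real (l ^ i * u ^ c) =
     complex_of_real (gauss_op (l * sqrt \<eta>) (u * sqrt \<eta>) (u * sqrt (1 - \<eta>)) (- (l * sqrt (1 - \<eta>))) (b, i) (c, e))"
proof -
  define X where "X = (\<lambda>(b, i) (c, e). beamsplitter_ket \<eta> i c (b, e) * complex_of_real (l ^ i * u ^ c))"
  let ?G = "gauss_op (l * sqrt \<eta>) (u * sqrt \<eta>) (u * sqrt (1 - \<eta>)) (- (l * sqrt (1 - \<eta>)))"
  \<comment> \<open>At n = 0 the truncated exponent is harmless, since \<open>sqrt 0\<close>
    annihilates both sides.\<close>
  have pow: "complex_of_real (sqrt (real n)) * complex_of_real a ^ n
      = complex_of_real (sqrt (real n)) * (complex_of_real a * complex_of_real a ^ (n - 1))" for n a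
    by (cases n) auto
  have "X x y = complex_of_real (?G x y)" for x y
  proof (rule gauss_rows_unique[where V = UNIV])
    show "gauss_rows (l * sqrt \<eta>) (u * sqrt (1 - \<eta>)) (- (l * sqrt (1 - \<eta>))) X"
      unfolding gauss_rows_def
    proof (intro allI conjI)
      fix b i c e
      let ?k = "beamsplitter_ket \<eta>"
      have "complex_of_real (sqrt (real (Suc b))) * ?k i c (Suc b, e) =
          complex_of_real (sqrt \<eta>) * complex_of_real (sqrt (real i)) * ?k (i - 1) c (b, e) +
          complex_of_real (sqrt (1 - \<eta>)) * complex_of_real (sqrt (real c)) * ?k i (c - 1) (b, e)"
        using fun_cong[OF beamsplitter_mode_b[of \<eta> i c], of "(b, e)"] by (simp add: lower_fst_def)
      then have "complex_of_real (sqrt (real (Suc b))) * X (Suc b, i) (c, e) =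
          (complex_of_real (sqrt \<eta>) * complex_of_real (sqrt (real i)) * ?k (i - 1) c (b, e) +
          complex_of_real (sqrt (1 - \<eta>)) * complex_of_real (sqrt (real c)) * ?k i (c - 1) (b, e))
          * complex_of_real (l ^ i * u ^ c)"
        by (simp add: X_def mult.assoc flip: mult.assoc[of "complex_of_real (sqrt (real (Suc b)))"] del: of_nat_Suc)
      also have "\<dots> = complex_of_real (sqrt \<eta>) * ?k (i - 1) c (b, e) * complex_of_real u ^ c
            * (complex_of_real (sqrt (real i)) * complex_of_real l ^ i)
          + complex_of_real (sqrt (1 - \<eta>)) * ?k i (c - 1) (b, e) * complex_of_real l ^ i
            * (complex_of_real (sqrt (real c)) * complex_of_real u ^ c)"
        by (simp add: algebra_simps)
      also have "\<dots> = complex_of_real (l * sqrt \<eta> * sqrt (real i)) * X (b, i - 1) (c, e) +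
          complex_of_real (u * sqrt (1 - \<eta>) * sqrt (real c)) * X (b, i) (c - 1, e)"
        unfolding pow[of i] pow[of c] by (simp add: X_def algebra_simps)
      finally show "complex_of_real (sqrt (real (Suc b))) * X (Suc b, i) (c, e) =
          complex_of_real (l * sqrt \<eta> * sqrt (real i)) * X (b, i - 1) (c, e) +
          complex_of_real (u * sqrt (1 - \<eta>) * sqrt (real c)) * X (b, i) (c - 1, e)" .
      have "complex_of_real (sqrt (real (Suc i))) * X (b, Suc i) (c, e) =
          raise_comb (sqrt \<eta>) (- sqrt (1 - \<eta>)) (?k i c) (b, e) * complex_of_real (l ^ Suc i * u ^ c)"
        unfolding beamsplitter_ket_Suc[symmetric] by (simp add: X_def del: of_nat_Suc)
      then show "complex_of_real (sqrt (real (Suc i))) * X (b, Suc i) (c, e) =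
          complex_of_real (l * sqrt \<eta> * sqrt (real b)) * X (b - 1, i) (c, e) +
          complex_of_real (- (l * sqrt (1 - \<eta>)) * sqrt (real e)) * X (b, i) (c, e - 1)"
        by (simp add: X_def raise_comb_def raise_fst_def raise_snd_def algebra_simps del: of_nat_Suc)
    qed
    show "gauss_rows (l * sqrt \<eta>) (u * sqrt (1 - \<eta>)) (- (l * sqrt (1 - \<eta>))) (\<lambda>x y. complex_of_real (?G x y))"
      using gauss_rows_gauss_op[of "l * sqrt \<eta>" "u * sqrt (1 - \<eta>)" "- (l * sqrt (1 - \<eta>))" 1 "u * sqrt \<eta>",
        where ?'a = complex] by simp
    show "X (0, 0) y = complex_of_real (?G (0, 0) y)" for y
      by (cases y) (auto simp: X_def beamsplitter_ket_row_0 gauss_op_row_0 power_mult_distrib)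
  qed auto
  from this[of "(b, i)" "(c, e)"] show ?thesis by (simp add: X_def)
qed

lemma kraus_op_eq_gauss_op:
  assumes "N\<^sub>B \<ge> 0" "N\<^sub>S \<ge> 0"
  defines "l \<equiv> sqrt (N\<^sub>S / (N\<^sub>S + 1))" and "u \<equiv> sqrt (N\<^sub>B / (N\<^sub>B + 1))"
  shows "kraus_op \<eta> N\<^sub>B N\<^sub>S x y = complex_of_real (sqrt (1 / (N\<^sub>S + 1)) * sqrt (1 / (N\<^sub>B + 1)) *
    gauss_op (l * sqrt \<eta>) (u * sqrt \<eta>) (u * sqrt (1 - \<eta>)) (- (l * sqrt (1 - \<eta>))) x y)"
proof -
  have p: "sqrt (N ^ n / (N + 1) ^ (n + 1)) = sqrt (1 / (N + 1)) * sqrt (N / (N + 1)) ^ n" for N :: real and n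
    by (simp add: power_divide real_sqrt_divide real_sqrt_mult real_sqrt_power)
  show ?thesis
    unfolding kraus_op_def p l_def[symmetric] u_def[symmetric]
    using beamsplitter_ket_eq_gauss_op[of \<eta> "snd x" "fst y" "fst x" "snd y" l u]
    by (simp add: mult_ac)
qed

text \<open>The Gaussian matrix K is real, so its adjoint is its transpose and K times its adjoint
  is one instance of \<open>gauss_comp_eq\<close>, with p' * p' below 1.\<close>

lemma output_state_gauss:
  assumes \<eta>: "0 < \<eta>" "\<eta> < 1" and "N\<^sub>B \<ge> 0" "N\<^sub>S \<ge> 0"
  defines "N\<^sub>T \<equiv> (1 - \<eta>) * N\<^sub>B" and "l \<equiv> sqrt (N\<^sub>S / (N\<^sub>S + 1))"
  shows "output_state \<eta> N\<^sub>B (tmsv_state N\<^sub>S) \<theta> x x' = phase \<theta> (snd x) * cnj (phase \<theta> (snd x')) *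
    complex_of_real (1 / ((N\<^sub>S + 1) * (N\<^sub>T + 1)) *
      gauss_op (l * sqrt \<eta> / (N\<^sub>T + 1)) (l * sqrt \<eta> / (N\<^sub>T + 1)) (N\<^sub>T / (N\<^sub>T + 1))
        (N\<^sub>S / (N\<^sub>S + 1) * (N\<^sub>T + 1 - \<eta>) / (N\<^sub>T + 1)) x x')"
proof -
  define u where "u = sqrt (N\<^sub>B / (N\<^sub>B + 1))"
  define p where "p = l * sqrt \<eta>"
  define p' where "p' = u * sqrt \<eta>"
  define q\<^sub>1 where "q\<^sub>1 = u * sqrt (1 - \<eta>)"
  define q\<^sub>2 where "q\<^sub>2 = - (l * sqrt (1 - \<eta>))"
  define \<kappa> where "\<kappa> = sqrt (1 / (N\<^sub>S + 1)) * sqrt (1 / (N\<^sub>B + 1))"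
  have NT: "N\<^sub>T \<ge> 0" using assms by (simp add: N\<^sub>T_def)
  have u2: "u * u = N\<^sub>B / (N\<^sub>B + 1)" and l2: "l * l = N\<^sub>S / (N\<^sub>S + 1)"
    using assms by (simp_all add: u_def l_def)
  have s1: "sqrt \<eta> * sqrt \<eta> = \<eta>" "sqrt (1 - \<eta>) * sqrt (1 - \<eta>) = 1 - \<eta>" using \<eta> by simp_all
  have \<kappa>2: "\<kappa> * \<kappa> = 1 / ((N\<^sub>S + 1) * (N\<^sub>B + 1))"
    using assms unfolding \<kappa>_def
    by (simp add: real_sqrt_divide divide_simps mult_ac)
  have p'2: "p' * p' = N\<^sub>B / (N\<^sub>B + 1) * \<eta>"
    unfolding p'_def using u2 s1 by (metis mult.assoc mult.commute)
  have "N\<^sub>B / (N\<^sub>B + 1) * \<eta> < 1 * 1"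
    using assms by (intro mult_less_le_imp_less) (auto simp: divide_simps)
  then have "p' * p' < 1" by (simp add: p'2)
  then have p': "\<bar>p'\<bar> < 1"
    using abs_square_less_1[of p'] by (simp add: power2_eq_square)
  have K: "kraus_op \<eta> N\<^sub>B N\<^sub>S x y = complex_of_real (\<kappa> * gauss_op p p' q\<^sub>1 q\<^sub>2 x y)" for x y
    using kraus_op_eq_gauss_op[OF assms(3,4)]
    unfolding \<kappa>_def p_def p'_def q\<^sub>1_def q\<^sub>2_def l_def u_def by simp
  have KK: "kraus_op \<eta> N\<^sub>B N\<^sub>S x y * cnj (kraus_op \<eta> N\<^sub>B N\<^sub>S x' y) =
      complex_of_real ((\<kappa> * \<kappa>) * (gauss_op p p' q\<^sub>1 q\<^sub>2 x y * gauss_op p' p q\<^sub>1 q\<^sub>2 y x'))" for y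
    unfolding K gauss_op_transpose[of p p' q\<^sub>1 q\<^sub>2 x'] by simp
  have hs: "((\<lambda>y. kraus_op \<eta> N\<^sub>B N\<^sub>S x y * cnj (kraus_op \<eta> N\<^sub>B N\<^sub>S x' y)) has_sum
      complex_of_real ((\<kappa> * \<kappa>) * gauss_comp p p' q\<^sub>1 q\<^sub>2 p' p q\<^sub>1 q\<^sub>2 x x')) UNIV"
    unfolding KK gauss_comp_def
    by (intro has_sum_of_real has_sum_cmult_right has_sum_infsum gauss_comp_summable p')
  \<comment> \<open>Through this identity the determinant of the composition eliminates
    \<open>N\<^sub>B\<close> in favour of \<open>N\<^sub>T\<close>.\<close>
  have NB: "(N\<^sub>B + 1) * (1 - p' * p') = N\<^sub>T + 1"
    unfolding p'2 N\<^sub>T_def using assms by (simp add: field_simps)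
  have d: "1 - p' * p' = (N\<^sub>T + 1) / (N\<^sub>B + 1)"
    using NB \<open>N\<^sub>B \<ge> 0\<close> by (simp add: eq_divide_eq mult.commute)
  have e1: "(\<kappa> * \<kappa>) * (1 / (1 - p' * p')) = 1 / ((N\<^sub>S + 1) * (N\<^sub>T + 1))"
    unfolding \<kappa>2 d using assms(1-4) NT by (simp add: divide_simps)
  have "q\<^sub>1 * q\<^sub>2 * p' = - (l * sqrt \<eta>) * (u * u) * (sqrt (1 - \<eta>) * sqrt (1 - \<eta>))"
    by (simp add: q\<^sub>1_def q\<^sub>2_def p'_def)
  then have qqp: "q\<^sub>1 * q\<^sub>2 * p' = - (l * sqrt \<eta>) * (N\<^sub>T / (N\<^sub>B + 1))"
    unfolding u2 s1 N\<^sub>T_def by simp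
  have e2: "p + q\<^sub>1 * q\<^sub>2 * p' / (1 - p' * p') = l * sqrt \<eta> / (N\<^sub>T + 1)"
    unfolding qqp d p_def using assms(1-4) NT by (simp add: divide_simps) (simp add: algebra_simps)
  have "q\<^sub>1 * q\<^sub>1 = (u * u) * (sqrt (1 - \<eta>) * sqrt (1 - \<eta>))" by (simp add: q\<^sub>1_def)
  then have "q\<^sub>1 * q\<^sub>1 = N\<^sub>T / (N\<^sub>B + 1)" unfolding u2 s1 N\<^sub>T_def by simp
  then have e3: "q\<^sub>1 * q\<^sub>1 / (1 - p' * p') = N\<^sub>T / (N\<^sub>T + 1)"
    unfolding d using assms(1-4) NT by (simp add: divide_simps)
  have "q\<^sub>2 * q\<^sub>2 = (l * l) * (sqrt (1 - \<eta>) * sqrt (1 - \<eta>))" by (simp add: q\<^sub>2_def)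
  then have "q\<^sub>2 * q\<^sub>2 = N\<^sub>S / (N\<^sub>S + 1) * (1 - \<eta>)" unfolding l2 s1 by simp
  then have "q\<^sub>2 * q\<^sub>2 / (1 - p' * p') = N\<^sub>S / (N\<^sub>S + 1) * ((1 - \<eta>) * (N\<^sub>B + 1)) / (N\<^sub>T + 1)"
    unfolding d by simp
  also have "(1 - \<eta>) * (N\<^sub>B + 1) = N\<^sub>T + 1 - \<eta>" by (simp add: N\<^sub>T_def algebra_simps)
  finally have e4: "q\<^sub>2 * q\<^sub>2 / (1 - p' * p') = N\<^sub>S / (N\<^sub>S + 1) * (N\<^sub>T + 1 - \<eta>) / (N\<^sub>T + 1)" .
  show ?thesis
    unfolding output_state_tmsv[OF assms(3,4) has_sum_imp_summable[OF hs]] infsumI[OF hs]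
      gauss_comp_eq[OF p' p'] mult.assoc[symmetric, of "\<kappa> * \<kappa>"] e1 e2 e3 e4 ..
qed

subsection \<open>Two-mode squeezing\<close>

text \<open>The two-mode squeezing operator with t = tanh r, where sqrt (1 - t^2) = 1 / cosh r,
  followed by a phase on the second mode. The phase is included so that one family of unitaries
  diagonalizes the output states for all \<theta>.\<close>

definition squeeze_op :: "real \<Rightarrow> real \<Rightarrow> (nat \<times> nat) operator" where
  "squeeze_op \<theta> t x y = phase \<theta> (snd x) *
     complex_of_real (sqrt (1 - t\<^sup>2) * gauss_op t (- t) (sqrt (1 - t\<^sup>2)) (sqrt (1 - t\<^sup>2)) x y)"

lemma gauss_op_id: "gauss_op 0 0 1 1 x y = (if x = y then 1 else 0)"
proof (rule gauss_rows_unique[where V = UNIV])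
  show "gauss_rows 0 1 1 (gauss_op 0 0 1 1)"
    using gauss_rows_gauss_op[of 0 1 1 1 0, where ?'a = real] by simp
  show "gauss_rows 0 1 1 (\<lambda>x y. if x = y then 1 else 0 :: real)"
    unfolding gauss_rows_def
  proof (intro allI conjI)
    fix b i n m :: nat
    show "of_real (sqrt (real (Suc b))) * (if (Suc b, i) = (n, m) then 1 else 0) =
      of_real (0 * sqrt (real i)) * (if (b, i - 1) = (n, m) then 1 else 0) +
      of_real (1 * sqrt (real n)) * (if (b, i) = (n - 1, m) then 1 else 0 :: real)"
      by (cases n) auto
    show "of_real (sqrt (real (Suc i))) * (if (b, Suc i) = (n, m) then 1 else 0) =
      of_real (0 * sqrt (real b)) * (if (b - 1, i) = (n, m) then 1 else 0) +
      of_real (1 * sqrt (real m)) * (if (b, i) = (n, m - 1) then 1 else 0 :: real)"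
      by (cases m) auto
  qed
  show "gauss_op 0 0 1 1 (0, 0) y = (if (0, 0) = y then 1 else 0)" for y
    by (cases y) (auto simp: gauss_op_row_0)
qed auto

text \<open>Transposition exchanges t and - t, so apart from the phase the adjoint squeezes by the
  opposite amount. In the composition the pair terms cancel because c * c = 1 - t^2, leaving the
  identity kernel z1 w1 + z2 w2.\<close>

lemma squeeze_op_unitary:
  assumes t: "\<bar>t\<bar> < 1"
  shows "op_unitary (squeeze_op \<theta> t)"
proof -
  define c where "c = sqrt (1 - t\<^sup>2)"
  have t2: "t\<^sup>2 < 1" using t by (simp add: abs_square_less_1)
  have c2: "c * c = 1 - t\<^sup>2" "c * c \<noteq> 0" using t2 by (simp_all add: c_def)
  have comp: "gauss_comp s (- s) c c (- s) s c c x y = (if x = y then 1 / (c * c) else 0)"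
    if "s = t \<or> s = - t" for s x y
  proof -
    have s: "\<bar>- s\<bar> < 1" "1 - - s * - s = c * c"
      using that t by (auto simp: c2 power2_eq_square)
    have "gauss_comp s (- s) c c (- s) s c c x y = 1 / (c * c) * gauss_op 0 0 1 1 x y"
      unfolding gauss_comp_eq[OF s(1) s(1)] s(2) using c2(2) by simp
    then show ?thesis by (simp add: gauss_op_id)
  qed
  have "op_mult (squeeze_op \<theta> t) (op_adj (squeeze_op \<theta> t)) x y = op_id x y" for x y
  proof -
    have "op_mult (squeeze_op \<theta> t) (op_adj (squeeze_op \<theta> t)) x y =
        (\<Sum>\<^sub>\<infinity>k. (phase \<theta> (snd x) * cnj (phase \<theta> (snd y))) *
          complex_of_real ((c * c) * (gauss_op t (- t) c c x k * gauss_op (- t) t c c k y)))"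
      unfolding op_mult_def op_adj_def squeeze_op_def c_def[symmetric] gauss_op_transpose[of t "- t" c c y]
      by (simp add: mult_ac)
    also have "\<dots> = (phase \<theta> (snd x) * cnj (phase \<theta> (snd y))) *
        complex_of_real ((c * c) * gauss_comp t (- t) c c (- t) t c c x y)"
      by (simp only: infsum_cmult_right' infsum_complex_of_real gauss_comp_def)
    also have "\<dots> = op_id x y"
      using c2(2) by (auto simp: comp op_id_def phase_cnj)
    finally show ?thesis .
  qed
  moreover have "op_mult (op_adj (squeeze_op \<theta> t)) (squeeze_op \<theta> t) x y = op_id x y" for x y
  proof -
    have "cnj (squeeze_op \<theta> t k x) * squeeze_op \<theta> t k y = (phase \<theta> (snd k) * cnj (phase \<theta> (snd k))) *
        complex_of_real ((c * c) * (gauss_op (- t) t c c x k * gauss_op t (- t) c c k y))" for k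
      unfolding squeeze_op_def c_def[symmetric] gauss_op_transpose[of "- t" t c c x]
      by (simp add: mult_ac)
    then have "op_mult (op_adj (squeeze_op \<theta> t)) (squeeze_op \<theta> t) x y =
        (\<Sum>\<^sub>\<infinity>k. complex_of_real ((c * c) * (gauss_op (- t) t c c x k * gauss_op t (- t) c c k y)))"
      unfolding op_mult_def op_adj_def phase_cnj by simp
    also have "\<dots> = complex_of_real ((c * c) * gauss_comp (- t) t c c t (- t) c c x y)"
      by (simp only: infsum_cmult_right' infsum_complex_of_real gauss_comp_def)
    also have "\<dots> = op_id x y"
      using comp[of "- t" x y] c2(2) by (auto simp: op_id_def)
    finally show ?thesis .
  qed
  ultimately show ?thesis
    unfolding op_unitary_def by (auto simp: fun_eq_iff)
qed

definition geom_prod :: "real \<Rightarrow> real \<Rightarrow> nat \<times> nat \<Rightarrow> real" where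
  "geom_prod X Y k = (1 - X) * (1 - Y) * (X ^ fst k * Y ^ snd k)"

text \<open>The geometric spectrum is absorbed into the columns of the left factor by
  \<open>gauss_op_scale\<close>, so conjugation becomes a single composition with determinant
  d.\<close>

lemma conjugate_squeeze_op:
  assumes t: "\<bar>t\<bar> < 1" and X: "0 \<le> X" "X < 1" and Y: "0 \<le> Y" "Y < 1"
  defines "d \<equiv> 1 - t\<^sup>2 * (X * Y)"
  shows "op_conjugate (squeeze_op \<theta> t) (op_diag (\<lambda>k. complex_of_real (geom_prod X Y k))) x y =
    phase \<theta> (snd x) * cnj (phase \<theta> (snd y)) *
    complex_of_real ((1 - X) * (1 - Y) * (1 - t\<^sup>2) / d *
      gauss_op (t * (1 - X * Y) / d) (t * (1 - X * Y) / d) (X * (1 - t\<^sup>2) / d) (Y * (1 - t\<^sup>2) / d) x y)"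
proof -
  define c where "c = sqrt (1 - t\<^sup>2)"
  have t2: "t\<^sup>2 < 1" using t by (simp add: abs_square_less_1)
  have c2: "c * c = 1 - t\<^sup>2" using t2 by (simp add: c_def)
  let ?A = "(1 - X) * (1 - Y)"
  have XY: "0 \<le> X * Y" "X * Y < 1" using X Y mult_strict_mono'[of X 1 Y 1] by auto
  have "t\<^sup>2 * (X * Y) < 1 * 1"
    using t2 XY by (intro mult_strict_mono') auto
  then have d0: "d \<noteq> 0" unfolding d_def by simp
  have "\<bar>t\<bar> * (X * Y) < 1 * 1" using t XY by (intro mult_strict_mono') auto
  then have tXY: "\<bar>- t * (X * Y)\<bar> < 1" "\<bar>- t\<bar> < 1" using t XY X Y by (simp_all add: abs_mult)
  have scale: "gauss_op t (- t) c c x k * (X ^ fst k * Y ^ snd k) = gauss_op t (- t * (X * Y)) (c * X) (c * Y) x k" for k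
    using gauss_op_scale[of t "- t" c c x "fst k" "snd k" X Y] by simp
  have "squeeze_op \<theta> t x k * complex_of_real (geom_prod X Y k) * cnj (squeeze_op \<theta> t y k) =
      (phase \<theta> (snd x) * cnj (phase \<theta> (snd y))) * complex_of_real ((?A * (c * c)) *
        (gauss_op t (- t * (X * Y)) (c * X) (c * Y) x k * gauss_op (- t) t c c k y))" for k
    unfolding squeeze_op_def c_def[symmetric] geom_prod_def gauss_op_transpose[of t "- t" c c y] scale[symmetric]
    by (simp add: mult_ac)
  then have "op_conjugate (squeeze_op \<theta> t) (op_diag (\<lambda>k. complex_of_real (geom_prod X Y k))) x y =
      (phase \<theta> (snd x) * cnj (phase \<theta> (snd y))) * complex_of_real ((?A * (c * c)) *
        gauss_comp t (- t * (X * Y)) (c * X) (c * Y) (- t) t c c x y)"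
    unfolding op_conjugate_diag
    by (simp only: infsum_cmult_right' infsum_complex_of_real gauss_comp_def)
  also have "(?A * (c * c)) * gauss_comp t (- t * (X * Y)) (c * X) (c * Y) (- t) t c c x y =
      ?A * (1 - t\<^sup>2) / d *
      gauss_op (t * (1 - X * Y) / d) (t * (1 - X * Y) / d) (X * (1 - t\<^sup>2) / d) (Y * (1 - t\<^sup>2) / d) x y"
  proof -
    have d': "1 - - t * (X * Y) * - t = d" by (simp add: d_def power2_eq_square)
    have "c * X * (c * Y) = (1 - t\<^sup>2) * (X * Y)" "c * X * c = X * (1 - t\<^sup>2)" "c * Y * c = Y * (1 - t\<^sup>2)"
      by (simp_all add: mult_ac flip: c2)
    then have e: "t + c * X * (c * Y) * - t / d = t * (1 - X * Y) / d"
      "t + (1 - t\<^sup>2) * (- t * (X * Y)) / d = t * (1 - X * Y) / d"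
      "c * X * c / d = X * (1 - t\<^sup>2) / d" "c * Y * c / d = Y * (1 - t\<^sup>2) / d"
      using d0 by (simp_all add: c2 field_simps) (simp_all add: d_def algebra_simps)
    show ?thesis
      unfolding gauss_comp_eq[OF tXY] d' e c2 by simp
  qed
  finally show ?thesis .
qed

text \<open>The output has mean photon number a in the channel mode, \<open>N\<^sub>S\<close> in the
  idler, and correlation k. It should be a squeezed pair of thermal modes with means nu1 and nu2.
  Squeezing preserves the difference a - \<open>N\<^sub>S\<close> of the means, the sum nu1 + nu2 +
  1 is D, and the squeezing strength satisfies tanh (2 r) = 2 k / (a + \<open>N\<^sub>S\<close> +
  1).\<close>

lemma ex_squeeze_parameters:
  fixes \<eta> N\<^sub>S N\<^sub>T :: real
  assumes \<eta>: "0 < \<eta>" "\<eta> < 1" and NS: "0 < N\<^sub>S" and NT: "0 < N\<^sub>T"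
  defines "\<nu>\<^sub>1 \<equiv> (mu_plus \<eta> N\<^sub>S N\<^sub>T - 1) / 2" and "\<nu>\<^sub>2 \<equiv> (mu_minus \<eta> N\<^sub>S N\<^sub>T - 1) / 2"
  defines "X \<equiv> \<nu>\<^sub>1 / (\<nu>\<^sub>1 + 1)" and "Y \<equiv> \<nu>\<^sub>2 / (\<nu>\<^sub>2 + 1)" and "l \<equiv> sqrt (N\<^sub>S / (N\<^sub>S + 1))"
  shows "\<nu>\<^sub>1 > 0" "\<nu>\<^sub>2 > 0"
    and "\<exists>t. \<bar>t\<bar> < 1 \<and> t * (1 - X * Y) / (1 - t\<^sup>2 * (X * Y)) = l * sqrt \<eta> / (N\<^sub>T + 1) \<and>
      X * (1 - t\<^sup>2) / (1 - t\<^sup>2 * (X * Y)) = N\<^sub>T / (N\<^sub>T + 1) \<and>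
      Y * (1 - t\<^sup>2) / (1 - t\<^sup>2 * (X * Y)) = N\<^sub>S / (N\<^sub>S + 1) * (N\<^sub>T + 1 - \<eta>) / (N\<^sub>T + 1) \<and>
      (1 - X) * (1 - Y) * (1 - t\<^sup>2) / (1 - t\<^sup>2 * (X * Y)) = 1 / ((N\<^sub>S + 1) * (N\<^sub>T + 1))"
proof -
  define a where "a = \<eta> * N\<^sub>S + N\<^sub>T"
  define k2 where "k2 = \<eta> * N\<^sub>S * (N\<^sub>S + 1)"
  define k where "k = sqrt k2"
  define D where "D = sqrt ((N\<^sub>S + \<eta> * N\<^sub>S + N\<^sub>T + 1)\<^sup>2 - 4 * \<eta> * N\<^sub>S * (N\<^sub>S + 1))"
  have k2pos: "k2 > 0" using \<eta> NS by (simp add: k2_def)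
  have kk: "k * k = k2" "k > 0" using k2pos by (simp_all add: k_def)
  have apos: "a > 0" using \<eta> NS NT by (simp add: a_def add_pos_pos)
  have r1: "a * (N\<^sub>S + 1) - k2 = (N\<^sub>S + 1) * N\<^sub>T" by (simp add: a_def k2_def algebra_simps)
  have r2: "N\<^sub>S * (a + 1) - k2 = N\<^sub>S * (N\<^sub>T + 1 - \<eta>)" by (simp add: a_def k2_def algebra_simps)
  have r3: "(a + 1) * (N\<^sub>S + 1) - k2 = (N\<^sub>S + 1) * (N\<^sub>T + 1)" by (simp add: a_def k2_def algebra_simps)
  have p1: "(N\<^sub>S + 1) * N\<^sub>T > 0" and p2: "N\<^sub>S * (N\<^sub>T + 1 - \<eta>) > 0" and p3: "(N\<^sub>S + 1) * (N\<^sub>T + 1) > 0"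
    using \<eta> NS NT by simp_all
  have Deq: "D = sqrt ((a + N\<^sub>S + 1)\<^sup>2 - 4 * k2)"
    by (simp add: D_def a_def k2_def algebra_simps)
  \<comment> \<open>Writing the radicand as a sum of nonnegative terms plus 1 shows that D is a
    genuine positive root.\<close>
  have rad: "(a + N\<^sub>S + 1)\<^sup>2 - 4 * k2 = (a - N\<^sub>S)\<^sup>2 + 1 + 2 * ((N\<^sub>S + 1) * N\<^sub>T) + 2 * (N\<^sub>S * (N\<^sub>T + 1 - \<eta>))"
    unfolding r1[symmetric] r2[symmetric] by (simp add: power2_eq_square algebra_simps)
  have "(a + N\<^sub>S + 1)\<^sup>2 - 4 * k2 > 0"
    unfolding rad using p1 p2 by (smt (verit) zero_le_power2)
  then have D2: "D * D = (a + N\<^sub>S + 1)\<^sup>2 - 4 * k2" and Dpos: "D > 0" by (simp_all add: Deq)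
  have n1: "2 * \<nu>\<^sub>1 = D - 1 + (a - N\<^sub>S)" and n2: "2 * \<nu>\<^sub>2 = D - 1 - (a - N\<^sub>S)"
    unfolding \<nu>\<^sub>1_def \<nu>\<^sub>2_def mu_plus_def mu_minus_def D_def[symmetric] by (simp_all add: a_def field_simps)
  \<comment> \<open>The products nu1 (nu2 + 1) and nu2 (nu1 + 1) become the numerators of the two
    diagonal kernel parameters over the common denominator M.\<close>
  have "4 * (\<nu>\<^sub>1 * (\<nu>\<^sub>2 + 1)) = (2 * \<nu>\<^sub>1) * (2 * \<nu>\<^sub>2 + 2)" by (simp add: algebra_simps)
  also have "\<dots> = D * D - (a - N\<^sub>S - 1)\<^sup>2" unfolding n1 n2 by (simp add: power2_eq_square algebra_simps)
  also have "\<dots> = 4 * (a * (N\<^sub>S + 1) - k2)" unfolding D2 by (simp add: power2_eq_square algebra_simps)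
  finally have q1: "\<nu>\<^sub>1 * (\<nu>\<^sub>2 + 1) = (N\<^sub>S + 1) * N\<^sub>T" unfolding r1 by simp
  have "4 * (\<nu>\<^sub>2 * (\<nu>\<^sub>1 + 1)) = (2 * \<nu>\<^sub>2) * (2 * \<nu>\<^sub>1 + 2)" by (simp add: algebra_simps)
  also have "\<dots> = D * D - (a - N\<^sub>S + 1)\<^sup>2" unfolding n1 n2 by (simp add: power2_eq_square algebra_simps)
  also have "\<dots> = 4 * (N\<^sub>S * (a + 1) - k2)" unfolding D2 by (simp add: power2_eq_square algebra_simps)
  finally have q2: "\<nu>\<^sub>2 * (\<nu>\<^sub>1 + 1) = N\<^sub>S * (N\<^sub>T + 1 - \<eta>)" unfolding r2 by simp
  have sum: "\<nu>\<^sub>1 + \<nu>\<^sub>2 + 1 = D" using n1 n2 by simp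
  \<comment> \<open>If nu1 were not positive, then nu2 + 1 = D - nu1 would be positive, and the
    product in \<open>q1\<close> could not be positive.\<close>
  show n1pos: "\<nu>\<^sub>1 > 0"
  proof (rule ccontr)
    assume "\<not> \<nu>\<^sub>1 > 0"
    then show False using q1 p1 sum Dpos by (smt (verit) mult_nonpos_nonneg)
  qed
  show n2pos: "\<nu>\<^sub>2 > 0"
  proof (rule ccontr)
    assume "\<not> \<nu>\<^sub>2 > 0"
    then show False using q2 p2 sum Dpos n1pos by (smt (verit) mult_nonpos_nonneg)
  qed
  define E where "E = D + a + N\<^sub>S + 1"
  \<comment> \<open>The smaller root of k t^2 - (a + \<open>N\<^sub>S\<close> + 1) t + k = 0, that
    is tanh r, written with k in the numerator.\<close>
  define t where "t = 2 * k / E"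
  have Epos: "E > 0" using Dpos apos NS by (simp add: E_def)
  have "E * (E - 2 * D) = (a + N\<^sub>S + 1)\<^sup>2 - D * D" by (simp add: E_def power2_eq_square algebra_simps)
  then have EE: "4 * k2 = E * (E - 2 * D)" unfolding D2 by simp
  have t2: "t\<^sup>2 = (E - 2 * D) / E"
  proof -
    have "t\<^sup>2 = 4 * (k * k) / (E * E)" by (simp add: t_def power2_eq_square)
    then show ?thesis unfolding kk EE using Epos by simp
  qed
  have omt: "1 - t\<^sup>2 = 2 * D / E" unfolding t2 using Epos by (simp add: field_simps)
  have "t\<^sup>2 < 1" using omt Dpos Epos by (smt (verit) divide_pos_pos)
  then have tabs: "\<bar>t\<bar> < 1" by (simp add: abs_square_less_1)
  define v where "v = (\<nu>\<^sub>1 + 1) * (\<nu>\<^sub>2 + 1)"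
  have vpos: "v > 0" using n1pos n2pos by (simp add: v_def)
  have XY: "X * Y = \<nu>\<^sub>1 * \<nu>\<^sub>2 / v" by (simp add: X_def Y_def v_def)
  have omXY: "1 - X * Y = D / v"
    unfolding XY using vpos by (simp add: field_simps) (simp add: v_def algebra_simps flip: sum)
  have Ev: "E + 2 * (\<nu>\<^sub>1 * \<nu>\<^sub>2) = 2 * ((N\<^sub>S + 1) * (N\<^sub>T + 1))"
  proof -
    have "v = \<nu>\<^sub>1 * \<nu>\<^sub>2 + D" by (simp add: v_def algebra_simps flip: sum)
    moreover have "\<nu>\<^sub>1 * (\<nu>\<^sub>2 + 1) + \<nu>\<^sub>2 * (\<nu>\<^sub>1 + 1) = 2 * (\<nu>\<^sub>1 * \<nu>\<^sub>2) + (D - 1)"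
      by (simp add: algebra_simps flip: sum)
    then have "2 * (\<nu>\<^sub>1 * \<nu>\<^sub>2) + D = (a * (N\<^sub>S + 1) - k2) + (N\<^sub>S * (a + 1) - k2) + 1"
      unfolding q1 q2 r1 r2 by simp
    then show ?thesis unfolding E_def r3[symmetric] by (simp add: algebra_simps)
  qed
  define M where "M = (N\<^sub>S + 1) * (N\<^sub>T + 1)"
  have NS1: "N\<^sub>S + 1 \<noteq> 0" using NS by linarith
  have Mpos: "M > 0" using p3 by (simp add: M_def)
  have den: "1 - t\<^sup>2 * (X * Y) = 2 * D * M / (E * v)"
  proof -
    have "1 - t\<^sup>2 * (X * Y) = (1 - X * Y) + (1 - t\<^sup>2) * (X * Y)" by (simp add: algebra_simps)
    also have "\<dots> = D / v + 2 * D / E * (\<nu>\<^sub>1 * \<nu>\<^sub>2 / v)" unfolding omXY omt by (simp only: XY)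
    also have "\<dots> = D * (E + 2 * (\<nu>\<^sub>1 * \<nu>\<^sub>2)) / (E * v)" using Epos vpos by (simp add: field_simps)
    finally show ?thesis unfolding Ev M_def by simp
  qed
  have X1: "X = \<nu>\<^sub>1 * (\<nu>\<^sub>2 + 1) / v" "Y = \<nu>\<^sub>2 * (\<nu>\<^sub>1 + 1) / v"
    unfolding X_def Y_def v_def using n1pos n2pos by simp_all
  have k_eq: "k = (N\<^sub>S + 1) * (l * sqrt \<eta>)"
  proof -
    have "k = sqrt ((N\<^sub>S + 1)\<^sup>2 * (N\<^sub>S / (N\<^sub>S + 1)) * \<eta>)"
      unfolding k_def k2_def using NS by (simp add: power2_eq_square)
    also have "\<dots> = sqrt ((N\<^sub>S + 1)\<^sup>2) * (sqrt (N\<^sub>S / (N\<^sub>S + 1)) * sqrt \<eta>)"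
      by (simp only: real_sqrt_mult mult.assoc)
    finally show ?thesis using NS by (simp add: l_def)
  qed
  show "\<exists>t. \<bar>t\<bar> < 1 \<and> t * (1 - X * Y) / (1 - t\<^sup>2 * (X * Y)) = l * sqrt \<eta> / (N\<^sub>T + 1) \<and>
      X * (1 - t\<^sup>2) / (1 - t\<^sup>2 * (X * Y)) = N\<^sub>T / (N\<^sub>T + 1) \<and>
      Y * (1 - t\<^sup>2) / (1 - t\<^sup>2 * (X * Y)) = N\<^sub>S / (N\<^sub>S + 1) * (N\<^sub>T + 1 - \<eta>) / (N\<^sub>T + 1) \<and>
      (1 - X) * (1 - Y) * (1 - t\<^sup>2) / (1 - t\<^sup>2 * (X * Y)) = 1 / ((N\<^sub>S + 1) * (N\<^sub>T + 1))"
  proof (intro exI conjI)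
    show "t * (1 - X * Y) / (1 - t\<^sup>2 * (X * Y)) = l * sqrt \<eta> / (N\<^sub>T + 1)"
    proof -
      have "t * (1 - X * Y) / (1 - t\<^sup>2 * (X * Y)) = k / M"
        unfolding den omXY unfolding t_def using Epos vpos Dpos Mpos by (simp add: field_simps)
      then show ?thesis unfolding k_eq M_def using NS1 by simp
    qed
    show "X * (1 - t\<^sup>2) / (1 - t\<^sup>2 * (X * Y)) = N\<^sub>T / (N\<^sub>T + 1)"
    proof -
      have "X * (1 - t\<^sup>2) / (1 - t\<^sup>2 * (X * Y)) = \<nu>\<^sub>1 * (\<nu>\<^sub>2 + 1) / M"
        unfolding den omt unfolding X1(1) using Epos vpos Dpos Mpos by (simp add: field_simps)
      then show ?thesis unfolding q1 M_def using NS1 by simp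
    qed
    show "Y * (1 - t\<^sup>2) / (1 - t\<^sup>2 * (X * Y)) = N\<^sub>S / (N\<^sub>S + 1) * (N\<^sub>T + 1 - \<eta>) / (N\<^sub>T + 1)"
    proof -
      have "Y * (1 - t\<^sup>2) / (1 - t\<^sup>2 * (X * Y)) = \<nu>\<^sub>2 * (\<nu>\<^sub>1 + 1) / M"
        unfolding den omt unfolding X1(2) using Epos vpos Dpos Mpos by (simp add: field_simps)
      then show ?thesis unfolding q2 M_def by simp
    qed
    show "(1 - X) * (1 - Y) * (1 - t\<^sup>2) / (1 - t\<^sup>2 * (X * Y)) = 1 / ((N\<^sub>S + 1) * (N\<^sub>T + 1))"
    proof -
      have "1 - X = 1 / (\<nu>\<^sub>1 + 1)" "1 - Y = 1 / (\<nu>\<^sub>2 + 1)"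
        unfolding X_def Y_def using n1pos n2pos by (simp_all add: field_simps)
      then have omXomY: "(1 - X) * (1 - Y) = 1 / v" by (simp add: v_def)
      show ?thesis unfolding omXomY den omt M_def[symmetric] using Epos vpos Dpos Mpos by (simp add: field_simps)
    qed
  qed (rule tabs)
qed

subsection \<open>Entropy of the output state\<close>

text \<open>Raising m by one multiplies the generating function by x / (1 - x): the Cauchy product
  with the geometric series adds up the binomials by the hockey-stick identity.\<close>

lemma choose_power_has_sum:
  fixes x :: real
  assumes "0 \<le> x" "x < 1"
  shows "((\<lambda>b. real (b choose m) * x ^ b) has_sum x ^ m / (1 - x) ^ Suc m) UNIV"
proof -
  have "(\<lambda>b. real (b choose m) * x ^ b) sums (x ^ m / (1 - x) ^ Suc m)"
  proof (induction m)
    case 0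
    then show ?case using geometric_sums[of x] assms by simp
  next
    case (Suc m)
    have "(\<lambda>k. \<Sum>i\<le>k. (real (i choose m) * x ^ i) * x ^ (k - i)) sums
        ((\<Sum>k. real (k choose m) * x ^ k) * (\<Sum>k. x ^ k))"
      by (rule Cauchy_product_sums)
         (use Suc.IH assms in \<open>auto simp: abs_mult power_abs sums_iff\<close>)
    also have "(\<lambda>k. \<Sum>i\<le>k. (real (i choose m) * x ^ i) * x ^ (k - i)) = (\<lambda>k. real (Suc k choose Suc m) * x ^ k)"
    proof
      fix k
      have "(\<Sum>i\<le>k. (real (i choose m) * x ^ i) * x ^ (k - i)) = (\<Sum>i\<le>k. real (i choose m) * x ^ k)"
        by (rule sum.cong) (auto simp flip: power_add)
      also have "\<dots> = real (\<Sum>i\<le>k. i choose m) * x ^ k"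
        by (simp add: sum_distrib_right)
      also have "(\<Sum>i\<le>k. i choose m) = Suc k choose Suc m"
        using sum_choose_upper[of m k] by (simp add: atMost_atLeast0)
      finally show "(\<Sum>i\<le>k. (real (i choose m) * x ^ i) * x ^ (k - i)) = real (Suc k choose Suc m) * x ^ k" .
    qed
    finally have "(\<lambda>k. x * (real (Suc k choose Suc m) * x ^ k)) sums
        (x * ((\<Sum>k. real (k choose m) * x ^ k) * (\<Sum>k. x ^ k)))"
      by (rule sums_mult)
    moreover have "(\<Sum>k. real (k choose m) * x ^ k) = x ^ m / (1 - x) ^ Suc m" "(\<Sum>k. x ^ k) = 1 / (1 - x)"
      using Suc.IH geometric_sums[of x] assms by (simp_all add: sums_iff)
    ultimately have "(\<lambda>k. real (Suc k choose Suc m) * x ^ Suc k) sums (x ^ Suc m / (1 - x) ^ Suc (Suc m))"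
      by (simp add: mult_ac)
    then show ?case
      using sums_Suc[of "\<lambda>k. real (k choose Suc m) * x ^ k"] by fastforce
  qed
  then show ?thesis
    using assms by (intro sums_nonneg_imp_has_sum) auto
qed

definition geom_pmf :: "real \<Rightarrow> nat \<Rightarrow> real" where
  "geom_pmf N n = 1 / (N + 1) * (N / (N + 1)) ^ n"

text \<open>All binomial moments are powers N ^ m, and n^2 is twice the second binomial coefficient
  plus the first.\<close>

lemma geom_pmf_moments:
  assumes N: "N \<ge> 0"
  shows "(geom_pmf N has_sum 1) UNIV"
    and "((\<lambda>n. real n * geom_pmf N n) has_sum N) UNIV"
    and "((\<lambda>n. (real n)\<^sup>2 * geom_pmf N n) has_sum (2 * N\<^sup>2 + N)) UNIV"
proof -
  let ?x = "N / (N + 1)"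
  have x: "0 \<le> ?x" "?x < 1" and omx: "1 - ?x = 1 / (N + 1)"
    using N by (auto simp: field_simps)
  have c: "((\<lambda>n. real (n choose m) * geom_pmf N n) has_sum N ^ m) UNIV" for m
  proof -
    have "((\<lambda>n. 1 / (N + 1) * (real (n choose m) * ?x ^ n)) has_sum
        1 / (N + 1) * (?x ^ m / (1 - ?x) ^ Suc m)) UNIV"
      by (intro has_sum_cmult_right choose_power_has_sum x)
    moreover have "1 / (N + 1) * (?x ^ m / (1 - ?x) ^ Suc m) = N ^ m"
      unfolding omx using N by (simp add: power_divide)
    ultimately show ?thesis by (simp add: geom_pmf_def mult_ac)
  qed
  show "(geom_pmf N has_sum 1) UNIV" using c[of 0] by simp
  show "((\<lambda>n. real n * geom_pmf N n) has_sum N) UNIV" using c[of 1] by simp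
  have "(real n)\<^sup>2 * geom_pmf N n = 2 * (real (n choose 2) * geom_pmf N n) + real (n choose 1) * geom_pmf N n" for n
  proof -
    have "real (n choose 2) = real n * (real n - 1) / 2"
      by (cases n) (simp_all add: choose_two real_of_nat_div algebra_simps)
    then have "(real n)\<^sup>2 = 2 * real (n choose 2) + real (n choose 1)"
      by (simp add: power2_eq_square algebra_simps)
    then show ?thesis by (simp only: distrib_right mult.assoc)
  qed
  then show "((\<lambda>n. (real n)\<^sup>2 * geom_pmf N n) has_sum (2 * N\<^sup>2 + N)) UNIV"
    using has_sum_add[OF has_sum_cmult_right[OF c[of 2], of 2] c[of 1]] by simp
qed

lemma geom_pmf_nonneg: "N \<ge> 0 \<Longrightarrow> geom_pmf N n \<ge> 0"
  by (simp add: geom_pmf_def)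

lemma has_sum_product:
  fixes f h :: "nat \<Rightarrow> real"
  assumes f: "(f has_sum a) UNIV" and h: "(h has_sum b) UNIV"
    and nonneg: "\<And>n. f n \<ge> 0" "\<And>n. h n \<ge> 0"
  shows "((\<lambda>k. f (fst k) * h (snd k)) has_sum a * b) UNIV"
proof -
  have 1: "((\<lambda>m. f (fst (n, m)) * h (snd (n, m))) has_sum f n * b) UNIV" for n
    using has_sum_cmult_right[OF h, of "f n"] by simp
  have 2: "((\<lambda>n. f n * b) has_sum a * b) UNIV"
    by (rule has_sum_cmult_left[OF f])
  have "(\<lambda>k. f (fst k) * h (snd k)) summable_on UNIV \<times> UNIV"
    by (rule summable_on_SigmaI[OF 1 has_sum_imp_summable[OF 2]]) (use nonneg in auto)
  then have "((\<lambda>k. f (fst k) * h (snd k)) has_sum a * b) (UNIV \<times> UNIV)"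
    by (rule has_sum_SigmaI[OF 1 2])
  then show ?thesis by simp
qed

lemma geom_prod_eq_geom_pmf:
  assumes "\<nu>\<^sub>1 \<ge> 0" "\<nu>\<^sub>2 \<ge> 0"
  shows "geom_prod (\<nu>\<^sub>1 / (\<nu>\<^sub>1 + 1)) (\<nu>\<^sub>2 / (\<nu>\<^sub>2 + 1)) k = geom_pmf \<nu>\<^sub>1 (fst k) * geom_pmf \<nu>\<^sub>2 (snd k)"
proof -
  have "1 - \<nu>\<^sub>1 / (\<nu>\<^sub>1 + 1) = 1 / (\<nu>\<^sub>1 + 1)" "1 - \<nu>\<^sub>2 / (\<nu>\<^sub>2 + 1) = 1 / (\<nu>\<^sub>2 + 1)"
    using assms by (simp_all add: field_simps)
  then show ?thesis by (simp add: geom_prod_def geom_pmf_def)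
qed

text \<open>The logarithm of a geometric weight is affine in n, so its expectation needs only the
  mean and equals g; for the product the logarithm splits and the entropies add.\<close>

lemma geom_prod_entropy:
  assumes \<nu>: "\<nu>\<^sub>1 > 0" "\<nu>\<^sub>2 > 0"
  defines "d \<equiv> geom_prod (\<nu>\<^sub>1 / (\<nu>\<^sub>1 + 1)) (\<nu>\<^sub>2 / (\<nu>\<^sub>2 + 1))"
  shows "((\<lambda>k. - (d k * ln (d k))) has_sum g \<nu>\<^sub>1 + g \<nu>\<^sub>2) UNIV"
proof -
  have d: "d k = geom_pmf \<nu>\<^sub>1 (fst k) * geom_pmf \<nu>\<^sub>2 (snd k)" for k
    unfolding d_def using \<nu> by (intro geom_prod_eq_geom_pmf) auto
  have pos: "geom_pmf N n > 0" if "N > 0" for N n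
    using that by (simp add: geom_pmf_def)
  have lnpmf: "- ln (geom_pmf N n) = ln (N + 1) + real n * (ln (N + 1) - ln N)" if "N > 0" for N n
    using that by (simp add: geom_pmf_def ln_mult ln_div ln_realpow algebra_simps)
  have ent: "((\<lambda>n. geom_pmf N n * - ln (geom_pmf N n)) has_sum g N) UNIV" if N: "N > 0" for N
  proof -
    have "((\<lambda>n. ln (N + 1) * geom_pmf N n + (ln (N + 1) - ln N) * (real n * geom_pmf N n)) has_sum
        ln (N + 1) * 1 + (ln (N + 1) - ln N) * N) UNIV"
      using N by (intro has_sum_add has_sum_cmult_right geom_pmf_moments) auto
    then show ?thesis unfolding lnpmf[OF N] g_def by (simp add: algebra_simps)
  qed
  have le1: "geom_pmf N n \<le> 1" if "N > 0" for N n
  proof -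
    have "1 / (N + 1) * (N / (N + 1)) ^ n \<le> 1 * 1"
      using that by (intro mult_mono power_le_one) auto
    then show ?thesis by (simp add: geom_pmf_def)
  qed
  have lnneg: "- ln (geom_pmf N n) \<ge> 0" if "N > 0" for N n
    using le1[OF that, of n] pos[OF that, of n] by simp
  let ?f = "geom_pmf \<nu>\<^sub>1" and ?h = "geom_pmf \<nu>\<^sub>2"
  have "((\<lambda>k. (?f (fst k) * - ln (?f (fst k))) * ?h (snd k) + ?f (fst k) * (?h (snd k) * - ln (?h (snd k))))
      has_sum g \<nu>\<^sub>1 * 1 + 1 * g \<nu>\<^sub>2) UNIV"
    using \<nu> lnneg pos
    by (intro has_sum_add has_sum_product[where f = "\<lambda>n. ?f n * - ln (?f n)" and h = ?h]
        has_sum_product[where f = ?f and h = "\<lambda>n. ?h n * - ln (?h n)"] ent geom_pmf_moments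
        mult_nonneg_nonneg geom_pmf_nonneg) auto
  also have "(\<lambda>k. (?f (fst k) * - ln (?f (fst k))) * ?h (snd k) + ?f (fst k) * (?h (snd k) * - ln (?h (snd k))))
      = (\<lambda>k. - (d k * ln (d k)))"
    using pos[OF \<nu>(1)] pos[OF \<nu>(2)] by (auto simp: d ln_mult less_imp_neq[symmetric] algebra_simps fun_eq_iff)
  finally show ?thesis by simp
qed

text \<open>Equality of operators reduces to equality of kernel parameters and prefactors, which
  \<open>ex_squeeze_parameters\<close> supplies. The value is independent of \<theta>, as only the
  diagonalizing unitary contains the phase.\<close>

lemma vN_entropy_output_state:
  assumes \<eta>: "0 < \<eta>" "\<eta> < 1" and NB: "N\<^sub>B \<ge> 0" and NT: "N\<^sub>T = (1 - \<eta>) * N\<^sub>B" and NS: "N\<^sub>S > 0" and NT0: "N\<^sub>T > 0"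
  shows "vN_entropy (output_state \<eta> N\<^sub>B (tmsv_state N\<^sub>S) \<theta>) =
    g ((mu_plus \<eta> N\<^sub>S N\<^sub>T - 1) / 2) + g ((mu_minus \<eta> N\<^sub>S N\<^sub>T - 1) / 2)"
proof -
  define \<nu>\<^sub>1 where "\<nu>\<^sub>1 = (mu_plus \<eta> N\<^sub>S N\<^sub>T - 1) / 2"
  define \<nu>\<^sub>2 where "\<nu>\<^sub>2 = (mu_minus \<eta> N\<^sub>S N\<^sub>T - 1) / 2"
  define X where "X = \<nu>\<^sub>1 / (\<nu>\<^sub>1 + 1)"
  define Y where "Y = \<nu>\<^sub>2 / (\<nu>\<^sub>2 + 1)"
  note pars = ex_squeeze_parameters[OF \<eta> NS NT0, folded \<nu>\<^sub>1_def \<nu>\<^sub>2_def, folded X_def Y_def]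
  have \<nu>: "\<nu>\<^sub>1 > 0" "\<nu>\<^sub>2 > 0" by (fact pars)+
  obtain t where t: "\<bar>t\<bar> < 1"
    "t * (1 - X * Y) / (1 - t\<^sup>2 * (X * Y)) = sqrt (N\<^sub>S / (N\<^sub>S + 1)) * sqrt \<eta> / (N\<^sub>T + 1)"
    "X * (1 - t\<^sup>2) / (1 - t\<^sup>2 * (X * Y)) = N\<^sub>T / (N\<^sub>T + 1)"
    "Y * (1 - t\<^sup>2) / (1 - t\<^sup>2 * (X * Y)) = N\<^sub>S / (N\<^sub>S + 1) * (N\<^sub>T + 1 - \<eta>) / (N\<^sub>T + 1)"
    "(1 - X) * (1 - Y) * (1 - t\<^sup>2) / (1 - t\<^sup>2 * (X * Y)) = 1 / ((N\<^sub>S + 1) * (N\<^sub>T + 1))"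
    using pars(3) by blast
  have XY: "0 \<le> X" "X < 1" "0 \<le> Y" "Y < 1" using \<nu> by (simp_all add: X_def Y_def field_simps)
  have d: "0 \<le> geom_prod X Y k" "geom_prod X Y k \<le> 1" for k
  proof -
    show "0 \<le> geom_prod X Y k" using XY by (simp add: geom_prod_def)
    have "(1 - X) * (1 - Y) * (X ^ fst k * Y ^ snd k) \<le> 1 * 1 * (1 * 1)"
      using XY by (intro mult_mono power_le_one mult_nonneg_nonneg) auto
    then show "geom_prod X Y k \<le> 1" by (simp add: geom_prod_def)
  qed
  have "output_state \<eta> N\<^sub>B (tmsv_state N\<^sub>S) \<theta> =
      op_conjugate (squeeze_op \<theta> t) (op_diag (\<lambda>k. complex_of_real (geom_prod X Y k)))"
    by (intro ext)
       (use NS in \<open>simp only: output_state_gauss[OF \<eta> NB less_imp_le[OF NS], folded NT]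
          conjugate_squeeze_op[OF t(1) XY] t(2-5)\<close>)
  then have "diagonalizes (squeeze_op \<theta> t) (geom_prod X Y) (output_state \<eta> N\<^sub>B (tmsv_state N\<^sub>S) \<theta>)"
    unfolding diagonalizes_def using squeeze_op_unitary[OF t(1)] d
    by (auto simp: bounded_iff intro!: exI[of _ 1])
  from vN_entropy_diagonalizes[OF this d] show ?thesis
    using geom_prod_entropy[OF \<nu>] unfolding X_def Y_def \<nu>\<^sub>1_def \<nu>\<^sub>2_def by blast
qed

subsection \<open>Entropy of the phase average\<close>

lemma phase_eq_power: "phase \<theta> n = exp (\<i> * complex_of_real \<theta>) ^ n"
  unfolding phase_def by (metis exp_of_nat_mult mult.commute)

lemma phase_2pi: "phase (2 * pi) n = 1"
  unfolding phase_eq_power using cis_2pi by (simp add: cis_conv_exp)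

lemma phase_integral:
  "integral {0..2 * pi} (\<lambda>\<theta>. phase \<theta> i * cnj (phase \<theta> i') * c) = (if i = i' then complex_of_real (2 * pi) * c else 0)"
proof (cases "i = i'")
  case True
  then show ?thesis by (simp add: phase_cnj scaleR_conv_of_real)
next
  case False
  define k where "k = \<i> * (of_nat i - of_nat i' :: complex)"
  have k: "k \<noteq> 0" using False by (simp add: k_def)
  have ph: "phase \<theta> i * cnj (phase \<theta> i') = exp (k * complex_of_real \<theta>)" for \<theta>
    by (simp add: phase_def exp_cnj k_def algebra_simps flip: exp_add)
  have "((\<lambda>\<theta>. exp (k * complex_of_real \<theta>) * c) has_integral
      exp (k * complex_of_real (2 * pi)) * (c / k) - exp (k * complex_of_real 0) * (c / k)) {0..2 * pi}"
  proof (rule fundamental_theorem_of_calculus)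
    fix \<theta> :: real
    have "((\<lambda>z. exp (k * z) * (c / k)) has_field_derivative exp (k * complex_of_real \<theta>) * c) (at (complex_of_real \<theta>))"
      using k by (auto intro!: derivative_eq_intros)
    then show "((\<lambda>\<theta>. exp (k * complex_of_real \<theta>) * (c / k)) has_vector_derivative exp (k * complex_of_real \<theta>) * c)
        (at \<theta> within {0..2 * pi})"
      by (rule has_vector_derivative_real_field)
  qed simp
  moreover have "exp (k * complex_of_real (2 * pi)) = 1"
    using ph[of "2 * pi"] phase_2pi by simp
  ultimately have "((\<lambda>\<theta>. exp (k * complex_of_real \<theta>) * c) has_integral 0) {0..2 * pi}"
    by simp
  from integral_unique[OF this] show ?thesis
    unfolding ph using False by (simp only: if_False)
qed

text \<open>The diagonal of the output state. The base of the m-th power is p * p / (q1 * q2) for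
  its kernel parameters; it is the w of the entropy bound.\<close>

definition avg_pmf :: "real \<Rightarrow> real \<Rightarrow> real \<Rightarrow> nat \<times> nat \<Rightarrow> real" where
  "avg_pmf \<eta> N\<^sub>T N\<^sub>S x = 1 / ((N\<^sub>S + 1) * (N\<^sub>T + 1)) *
     (N\<^sub>T / (N\<^sub>T + 1)) ^ fst x * (N\<^sub>S / (N\<^sub>S + 1) * (N\<^sub>T + 1 - \<eta>) / (N\<^sub>T + 1)) ^ snd x *
     (\<Sum>m\<le>snd x. real (fst x choose m) * real (snd x choose m) * (\<eta> / (N\<^sub>T * (N\<^sub>T + 1 - \<eta>))) ^ m)"

text \<open>On the diagonal only one free index m is left, with \<alpha> = \<beta> = m, \<gamma> = b
  - m and \<delta> = k - m; the factorials then pair up into two binomial coefficients.\<close>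

lemma gauss_op_diag:
  assumes q: "q\<^sub>1 \<noteq> 0" "q\<^sub>2 \<noteq> 0"
  shows "gauss_op p p q\<^sub>1 q\<^sub>2 (b, k) (b, k) =
    q\<^sub>1 ^ b * q\<^sub>2 ^ k * (\<Sum>m\<le>k. real (b choose m) * real (k choose m) * (p * p / (q\<^sub>1 * q\<^sub>2)) ^ m)"
proof -
  have "gauss_indices (b, k) (b, k) = (\<lambda>m. (m, m, b - m, k - m)) ` {m. m \<le> b \<and> m \<le> k}"
    by (auto simp: gauss_indices_def image_iff)
  then have "gauss_coeff p p q\<^sub>1 q\<^sub>2 (b, k) (b, k) = (\<Sum>m | m \<le> b \<and> m \<le> k.
      (p ^ m / fact m) * (p ^ m / fact m) * (q\<^sub>1 ^ (b - m) / fact (b - m)) * (q\<^sub>2 ^ (k - m) / fact (k - m)))"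
    by (simp add: gauss_coeff_def sum.reindex inj_on_def)
  moreover have "sqrt (fact b * fact k * fact b * fact k) = (fact b * fact k :: real)"
    by (rule real_sqrt_unique) (simp_all add: power2_eq_square mult_ac)
  ultimately have "gauss_op p p q\<^sub>1 q\<^sub>2 (b, k) (b, k) = (\<Sum>m | m \<le> b \<and> m \<le> k. (fact b * fact k) *
      ((p ^ m / fact m) * (p ^ m / fact m) * (q\<^sub>1 ^ (b - m) / fact (b - m)) * (q\<^sub>2 ^ (k - m) / fact (k - m))))"
    by (simp add: gauss_op_def sum_distrib_left)
  also have "\<dots> = (\<Sum>m | m \<le> b \<and> m \<le> k. q\<^sub>1 ^ b * q\<^sub>2 ^ k *
      (real (b choose m) * real (k choose m) * (p * p / (q\<^sub>1 * q\<^sub>2)) ^ m))"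
  proof (rule sum.cong[OF refl])
    fix m assume "m \<in> {m. m \<le> b \<and> m \<le> k}"
    then have m: "m \<le> b" "m \<le> k" by auto
    have "q\<^sub>1 ^ b = q\<^sub>1 ^ (b - m) * q\<^sub>1 ^ m" "q\<^sub>2 ^ k = q\<^sub>2 ^ (k - m) * q\<^sub>2 ^ m"
      using m by (simp_all flip: power_add)
    then show "(fact b * fact k) * ((p ^ m / fact m) * (p ^ m / fact m) *
        (q\<^sub>1 ^ (b - m) / fact (b - m)) * (q\<^sub>2 ^ (k - m) / fact (k - m))) =
        q\<^sub>1 ^ b * q\<^sub>2 ^ k * (real (b choose m) * real (k choose m) * (p * p / (q\<^sub>1 * q\<^sub>2)) ^ m)"
      using q m by (simp add: binomial_fact power_divide power_mult_distrib divide_simps)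
  qed
  also have "\<dots> = (\<Sum>m\<le>k. q\<^sub>1 ^ b * q\<^sub>2 ^ k *
      (real (b choose m) * real (k choose m) * (p * p / (q\<^sub>1 * q\<^sub>2)) ^ m))"
    by (rule sum.mono_neutral_left) auto
  finally show ?thesis by (simp add: sum_distrib_left)
qed

lemma phase_average_output_state:
  assumes \<eta>: "0 < \<eta>" "\<eta> < 1" and NB: "N\<^sub>B \<ge> 0" and NT: "N\<^sub>T = (1 - \<eta>) * N\<^sub>B" and NS: "N\<^sub>S > 0" and NT0: "N\<^sub>T > 0"
  shows "phase_average (output_state \<eta> N\<^sub>B (tmsv_state N\<^sub>S)) = op_diag (\<lambda>x. complex_of_real (avg_pmf \<eta> N\<^sub>T N\<^sub>S x))"
proof (intro ext)
  fix x y :: "nat \<times> nat"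
  define p where "p = sqrt (N\<^sub>S / (N\<^sub>S + 1)) * sqrt \<eta> / (N\<^sub>T + 1)"
  define q\<^sub>1 where "q\<^sub>1 = N\<^sub>T / (N\<^sub>T + 1)"
  define q\<^sub>2 where "q\<^sub>2 = N\<^sub>S / (N\<^sub>S + 1) * (N\<^sub>T + 1 - \<eta>) / (N\<^sub>T + 1)"
  define C where "C = 1 / ((N\<^sub>S + 1) * (N\<^sub>T + 1))"
  have out: "output_state \<eta> N\<^sub>B (tmsv_state N\<^sub>S) \<theta> x y =
      phase \<theta> (snd x) * cnj (phase \<theta> (snd y)) * complex_of_real (C * gauss_op p p q\<^sub>1 q\<^sub>2 x y)" for \<theta> x y
    using output_state_gauss[OF \<eta> NB less_imp_le[OF NS], folded NT]
    unfolding p_def q\<^sub>1_def q\<^sub>2_def C_def .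
  have int: "phase_average (output_state \<eta> N\<^sub>B (tmsv_state N\<^sub>S)) x y =
      (if snd x = snd y then complex_of_real (C * gauss_op p p q\<^sub>1 q\<^sub>2 x y) else 0)"
    unfolding phase_average_def out phase_integral by simp
  show "phase_average (output_state \<eta> N\<^sub>B (tmsv_state N\<^sub>S)) x y =
      op_diag (\<lambda>x. complex_of_real (avg_pmf \<eta> N\<^sub>T N\<^sub>S x)) x y"
  proof (cases "x = y")
    case True
    have q: "q\<^sub>1 \<noteq> 0" "q\<^sub>2 \<noteq> 0" using \<eta> NS NT0 by (simp_all add: q\<^sub>1_def q\<^sub>2_def)
    have pp: "p * p = N\<^sub>S / (N\<^sub>S + 1) * \<eta> / ((N\<^sub>T + 1) * (N\<^sub>T + 1))"
    proof -
      have "p * p = (sqrt (N\<^sub>S / (N\<^sub>S + 1)) * sqrt (N\<^sub>S / (N\<^sub>S + 1))) * (sqrt \<eta> * sqrt \<eta>) / ((N\<^sub>T + 1) * (N\<^sub>T + 1))"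
        by (simp only: p_def times_divide_times_eq mult_ac)
      then show ?thesis using \<eta> NS by simp
    qed
    have ne: "N\<^sub>S \<noteq> 0" "N\<^sub>S + 1 \<noteq> 0" "N\<^sub>T \<noteq> 0" "N\<^sub>T + 1 \<noteq> 0" "N\<^sub>T + 1 - \<eta> \<noteq> 0" using \<eta> NS NT0 by auto
    have w: "p * p / (q\<^sub>1 * q\<^sub>2) = \<eta> / (N\<^sub>T * (N\<^sub>T + 1 - \<eta>))"
      unfolding pp q\<^sub>1_def q\<^sub>2_def using ne by simp
    have "avg_pmf \<eta> N\<^sub>T N\<^sub>S x = C * gauss_op p p q\<^sub>1 q\<^sub>2 x x"
      unfolding avg_pmf_def C_def[symmetric] q\<^sub>1_def[symmetric] q\<^sub>2_def[symmetric]
      using gauss_op_diag[OF q, of p "fst x" "snd x"] unfolding w by (simp add: mult.assoc)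
    then show ?thesis
      unfolding int op_diag_def using True by simp
  next
    case False
    \<comment> \<open>Averaging leaves only equal idler numbers, and conservation of the number
      difference then forces equal output numbers.\<close>
    then show ?thesis
      unfolding int op_diag_def by (auto simp: prod_eq_iff intro: gauss_op_support)
  qed
qed

section \<open>Moments of the averaged distribution\<close>

text \<open>The second sum is the mean of a binomial distribution with success probability y / (1 +
  y), read off from Bernstein polynomials.\<close>

lemma sum_choose_power:
  fixes y :: real
  assumes "y \<ge> 0"
  shows "(\<Sum>m\<le>k. real (k choose m) * y ^ m) = (1 + y) ^ k"
    and "(1 + y) * (\<Sum>m\<le>k. real m * (real (k choose m) * y ^ m)) = real k * y * (1 + y) ^ k"
proof -
  show "(\<Sum>m\<le>k. real (k choose m) * y ^ m) = (1 + y) ^ k"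
    using binomial_ring[of y 1 k] by (simp add: add.commute)
  let ?x = "y / (1 + y)"
  have ne: "1 + y \<noteq> 0" using assms by simp
  have omx: "1 - ?x = 1 / (1 + y)" using ne by (simp add: field_simps)
  have B: "(1 + y) ^ k * Bernstein k m ?x = real (k choose m) * y ^ m" if "m \<le> k" for m
  proof -
    have "(1 + y) ^ k = (1 + y) ^ m * (1 + y) ^ (k - m)" using that by (simp flip: power_add)
    then show ?thesis unfolding Bernstein_def omx using ne by (simp add: power_divide)
  qed
  have "(\<Sum>m\<le>k. real m * (real (k choose m) * y ^ m)) = (1 + y) ^ k * (\<Sum>m\<le>k. real m * Bernstein k m ?x)"
    unfolding sum_distrib_left by (rule sum.cong) (auto simp flip: B)
  also have "\<dots> = (1 + y) ^ k * (real k * ?x)"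
    by (simp only: sum_k_Bernstein)
  finally show "(1 + y) * (\<Sum>m\<le>k. real m * (real (k choose m) * y ^ m)) = real k * y * (1 + y) ^ k"
    using ne by (simp add: mult_ac)
qed

text \<open>Removes an extra factor b, so that first moments in b reduce to the sums of
  \<open>choose_power_has_sum\<close>.\<close>

lemma of_nat_mult_choose:
  "real b * real (b choose m) = real (Suc m) * real (b choose Suc m) + real m * real (b choose m)"
proof -
  have "Suc m * (b choose Suc m) + m * (b choose m) = b * (b choose m)"
  proof (cases "m \<le> b")
    case True
    then have "Suc m * (b choose Suc m) = (b - m) * (b choose m)"
      by (metis binomial_absorb_comp binomial_absorption mult.commute)
    then show ?thesis using True by (simp flip: distrib_right)
  qed (simp add: binomial_eq_0)
  then show ?thesis by (metis of_nat_add of_nat_mult)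
qed

text \<open>Given k idler photons, k signal photons enter the channel, and the output has mean
  \<open>N\<^sub>T\<close> + \<eta> k; the idler itself is geometric with mean
  \<open>N\<^sub>S\<close>.\<close>

lemma avg_pmf_row_sums:
  assumes \<eta>: "0 < \<eta>" "\<eta> < 1" and NT: "N\<^sub>T > 0" and NS: "N\<^sub>S > 0"
  shows "((\<lambda>b. avg_pmf \<eta> N\<^sub>T N\<^sub>S (b, k)) has_sum geom_pmf N\<^sub>S k) UNIV"
    and "((\<lambda>b. real b * avg_pmf \<eta> N\<^sub>T N\<^sub>S (b, k)) has_sum (N\<^sub>T + \<eta> * real k) * geom_pmf N\<^sub>S k) UNIV"
proof -
  define q\<^sub>1 where "q\<^sub>1 = N\<^sub>T / (N\<^sub>T + 1)"
  define q\<^sub>2 where "q\<^sub>2 = N\<^sub>S / (N\<^sub>S + 1) * (N\<^sub>T + 1 - \<eta>) / (N\<^sub>T + 1)"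
  define C where "C = 1 / ((N\<^sub>S + 1) * (N\<^sub>T + 1))"
  define w where "w = \<eta> / (N\<^sub>T * (N\<^sub>T + 1 - \<eta>))"
  \<comment> \<open>Summing over b turns w ^ m into y ^ m, up to a common factor. The remaining
    binomial sum is a power of 1 + y, which cancels the extra ratio in \<open>q\<^sub>2\<close> and
    restores \<open>N\<^sub>S / (N\<^sub>S + 1)\<close>.\<close>
  define y where "y = w * N\<^sub>T"
  have pos: "N\<^sub>T + 1 - \<eta> > 0" "N\<^sub>T + 1 \<noteq> 0" "N\<^sub>S + 1 \<noteq> 0" using \<eta> NT NS by auto
  have y: "y = \<eta> / (N\<^sub>T + 1 - \<eta>)" "y \<ge> 0" using \<eta> NT pos by (simp_all add: y_def w_def)
  have y1: "1 + y = (N\<^sub>T + 1) / (N\<^sub>T + 1 - \<eta>)" "1 + y \<noteq> 0" using pos y(2) by (simp_all add: y(1) field_simps)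
  have q1: "0 \<le> q\<^sub>1" "q\<^sub>1 < 1" "1 - q\<^sub>1 = 1 / (N\<^sub>T + 1)" using NT by (simp_all add: q\<^sub>1_def field_simps)
  have P: "avg_pmf \<eta> N\<^sub>T N\<^sub>S (b, k) =
      (\<Sum>m\<le>k. (C * q\<^sub>2 ^ k * real (k choose m) * w ^ m) * (real (b choose m) * q\<^sub>1 ^ b))" for b
    unfolding avg_pmf_def q\<^sub>1_def[symmetric] q\<^sub>2_def[symmetric] C_def[symmetric] w_def[symmetric]
    by (simp add: sum_distrib_left mult_ac)
  have s: "((\<lambda>b. real (b choose m) * q\<^sub>1 ^ b) has_sum N\<^sub>T ^ m * (N\<^sub>T + 1)) UNIV" for m
  proof -
    have "q\<^sub>1 ^ m / (1 - q\<^sub>1) ^ Suc m = N\<^sub>T ^ m * (N\<^sub>T + 1)"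
      unfolding q1(3) unfolding q\<^sub>1_def using pos by (simp add: power_divide)
    then show ?thesis using choose_power_has_sum[OF q1(1,2), of m] by simp
  qed
  have geo: "C * q\<^sub>2 ^ k * ((N\<^sub>T + 1) * (1 + y) ^ k) = geom_pmf N\<^sub>S k"
  proof -
    have "q\<^sub>2 ^ k * (1 + y) ^ k = (q\<^sub>2 * (1 + y)) ^ k" by (simp add: power_mult_distrib)
    also have "q\<^sub>2 * (1 + y) = N\<^sub>S / (N\<^sub>S + 1)" unfolding q\<^sub>2_def y1 using pos by simp
    finally have "C * (N\<^sub>T + 1) * (q\<^sub>2 ^ k * (1 + y) ^ k) = geom_pmf N\<^sub>S k"
      using pos by (simp add: C_def geom_pmf_def)
    then show ?thesis by (simp add: mult_ac)
  qed
  have "((\<lambda>b. avg_pmf \<eta> N\<^sub>T N\<^sub>S (b, k)) has_sum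
      (\<Sum>m\<le>k. (C * q\<^sub>2 ^ k * real (k choose m) * w ^ m) * (N\<^sub>T ^ m * (N\<^sub>T + 1)))) UNIV"
    unfolding P by (intro has_sum_finite_sum has_sum_cmult_right s)
  also have "(\<Sum>m\<le>k. (C * q\<^sub>2 ^ k * real (k choose m) * w ^ m) * (N\<^sub>T ^ m * (N\<^sub>T + 1)))
      = C * q\<^sub>2 ^ k * ((N\<^sub>T + 1) * (\<Sum>m\<le>k. real (k choose m) * y ^ m))"
    unfolding y_def sum_distrib_left by (simp add: power_mult_distrib mult_ac)
  finally show "((\<lambda>b. avg_pmf \<eta> N\<^sub>T N\<^sub>S (b, k)) has_sum geom_pmf N\<^sub>S k) UNIV"
    unfolding sum_choose_power(1)[OF y(2)] geo .
  have s': "((\<lambda>b. real b * (real (b choose m) * q\<^sub>1 ^ b)) has_sum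
      N\<^sub>T ^ m * (N\<^sub>T + 1) * (N\<^sub>T + real m * (N\<^sub>T + 1))) UNIV" for m
  proof -
    have "((\<lambda>b. real (Suc m) * (real (b choose Suc m) * q\<^sub>1 ^ b) + real m * (real (b choose m) * q\<^sub>1 ^ b)) has_sum
        real (Suc m) * (N\<^sub>T ^ Suc m * (N\<^sub>T + 1)) + real m * (N\<^sub>T ^ m * (N\<^sub>T + 1))) UNIV"
      by (intro has_sum_add has_sum_cmult_right s)
    also have "(\<lambda>b. real (Suc m) * (real (b choose Suc m) * q\<^sub>1 ^ b) + real m * (real (b choose m) * q\<^sub>1 ^ b))
        = (\<lambda>b. real b * (real (b choose m) * q\<^sub>1 ^ b))"
      unfolding mult.assoc[symmetric] of_nat_mult_choose by (simp add: distrib_right)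
    finally show ?thesis by (simp add: algebra_simps)
  qed
  have "((\<lambda>b. \<Sum>m\<le>k. (C * q\<^sub>2 ^ k * real (k choose m) * w ^ m) * (real b * (real (b choose m) * q\<^sub>1 ^ b))) has_sum
      (\<Sum>m\<le>k. (C * q\<^sub>2 ^ k * real (k choose m) * w ^ m) *
        (N\<^sub>T ^ m * (N\<^sub>T + 1) * (N\<^sub>T + real m * (N\<^sub>T + 1))))) UNIV"
    by (intro has_sum_finite_sum has_sum_cmult_right s')
  also have "(\<lambda>b. \<Sum>m\<le>k. (C * q\<^sub>2 ^ k * real (k choose m) * w ^ m) * (real b * (real (b choose m) * q\<^sub>1 ^ b)))
      = (\<lambda>b. real b * avg_pmf \<eta> N\<^sub>T N\<^sub>S (b, k))"
    unfolding P sum_distrib_left by (simp add: mult_ac)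
  also have "(\<Sum>m\<le>k. (C * q\<^sub>2 ^ k * real (k choose m) * w ^ m) *
        (N\<^sub>T ^ m * (N\<^sub>T + 1) * (N\<^sub>T + real m * (N\<^sub>T + 1))))
      = C * q\<^sub>2 ^ k * (N\<^sub>T + 1) * (N\<^sub>T * (\<Sum>m\<le>k. real (k choose m) * y ^ m)
          + (N\<^sub>T + 1) * (\<Sum>m\<le>k. real m * (real (k choose m) * y ^ m)))"
    unfolding sum_distrib_left sum.distrib[symmetric] y_def
    by (rule sum.cong) (simp_all add: power_mult_distrib algebra_simps)
  also have "(\<Sum>m\<le>k. real m * (real (k choose m) * y ^ m)) = real k * (y / (1 + y)) * (1 + y) ^ k"
    using sum_choose_power(2)[OF y(2), of k] y1(2) by (simp add: field_simps)
  also have "y / (1 + y) = \<eta> / (N\<^sub>T + 1)"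
    unfolding y1(1) unfolding y(1) using pos by simp
  also have "C * q\<^sub>2 ^ k * (N\<^sub>T + 1) * (N\<^sub>T * (\<Sum>m\<le>k. real (k choose m) * y ^ m)
          + (N\<^sub>T + 1) * (real k * (\<eta> / (N\<^sub>T + 1)) * (1 + y) ^ k))
      = (N\<^sub>T + (N\<^sub>T + 1) * (real k * (\<eta> / (N\<^sub>T + 1)))) * (C * q\<^sub>2 ^ k * ((N\<^sub>T + 1) * (1 + y) ^ k))"
    unfolding sum_choose_power(1)[OF y(2)] by (simp only: distrib_left distrib_right mult_ac)
  also have "(N\<^sub>T + 1) * (real k * (\<eta> / (N\<^sub>T + 1))) = \<eta> * real k" using pos by simp
  finally show "((\<lambda>b. real b * avg_pmf \<eta> N\<^sub>T N\<^sub>S (b, k)) has_sum (N\<^sub>T + \<eta> * real k) * geom_pmf N\<^sub>S k) UNIV"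
    unfolding geo .
qed

lemma avg_pmf_nonneg:
  assumes "0 < \<eta>" "\<eta> < 1" "N\<^sub>T > 0" "N\<^sub>S > 0"
  shows "avg_pmf \<eta> N\<^sub>T N\<^sub>S x \<ge> 0"
  unfolding avg_pmf_def using assms by (intro mult_nonneg_nonneg sum_nonneg zero_le_power) auto

text \<open>Summing over b first needs only the two row sums. Nonnegative coefficients upgrade the
  iterated sum to a sum over pairs.\<close>

lemma avg_pmf_expectation:
  assumes \<eta>: "0 < \<eta>" "\<eta> < 1" and NT: "N\<^sub>T > 0" and NS: "N\<^sub>S > 0"
    and nonneg: "\<And>k. \<alpha> k \<ge> 0" "\<And>k. \<beta> k \<ge> 0"
    and S: "((\<lambda>k. \<alpha> k * geom_pmf N\<^sub>S k + \<beta> k * ((N\<^sub>T + \<eta> * real k) * geom_pmf N\<^sub>S k)) has_sum S) UNIV"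
  shows "((\<lambda>x. (\<alpha> (snd x) + \<beta> (snd x) * real (fst x)) * avg_pmf \<eta> N\<^sub>T N\<^sub>S x) has_sum S) UNIV"
proof -
  let ?P = "avg_pmf \<eta> N\<^sub>T N\<^sub>S"
  let ?F = "\<lambda>(k, b). (\<alpha> k + \<beta> k * real b) * ?P (b, k)"
  have row: "((\<lambda>b. ?F (k, b)) has_sum
      \<alpha> k * geom_pmf N\<^sub>S k + \<beta> k * ((N\<^sub>T + \<eta> * real k) * geom_pmf N\<^sub>S k)) UNIV" for k
    using has_sum_add[OF has_sum_cmult_right[OF avg_pmf_row_sums(1)[OF \<eta> NT NS], of "\<alpha> k" k]
        has_sum_cmult_right[OF avg_pmf_row_sums(2)[OF \<eta> NT NS], of "\<beta> k" k]]
    by (simp add: algebra_simps)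
  have "?F summable_on UNIV \<times> UNIV"
    by (rule summable_on_SigmaI[OF row has_sum_imp_summable[OF S]])
       (use nonneg avg_pmf_nonneg[OF \<eta> NT NS] in auto)
  then have "(?F has_sum S) (UNIV \<times> UNIV)"
    by (rule has_sum_SigmaI[OF row S])
  then have "((\<lambda>(b, k). ?F (k, b)) has_sum S) (UNIV \<times> UNIV)"
    by (subst (asm) has_sum_swap)
  then show ?thesis by (simp add: case_prod_beta')
qed

text \<open>Later coefficients are logarithms of either sign, so the four nonnegative monomials are
  summed separately and recombined. The last constant is the mean of k (\<open>N\<^sub>T\<close> +
  \<eta> k), where k^2 has mean \<open>2 * N\<^sub>S\<^sup>2 + N\<^sub>S\<close>.\<close>

lemma avg_pmf_affine_expectation:
  assumes \<eta>: "0 < \<eta>" "\<eta> < 1" and NT: "N\<^sub>T > 0" and NS: "N\<^sub>S > 0"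
  shows "((\<lambda>x. (c\<^sub>0 + c\<^sub>1 * real (fst x) + c\<^sub>2 * real (snd x) + c\<^sub>3 * (real (fst x) * real (snd x))) *
      avg_pmf \<eta> N\<^sub>T N\<^sub>S x) has_sum
    c\<^sub>0 + c\<^sub>1 * (N\<^sub>T + \<eta> * N\<^sub>S) + c\<^sub>2 * N\<^sub>S + c\<^sub>3 * (N\<^sub>T * N\<^sub>S + \<eta> * (2 * N\<^sub>S\<^sup>2 + N\<^sub>S))) UNIV"
proof -
  note m = geom_pmf_moments[OF less_imp_le[OF NS]]
  note E = avg_pmf_expectation[OF \<eta> NT NS]
  let ?P = "avg_pmf \<eta> N\<^sub>T N\<^sub>S"
  have 0: "(?P has_sum 1) UNIV"
    using E[of "\<lambda>_. 1" "\<lambda>_. 0" 1] m(1) by simp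
  have 1: "((\<lambda>x. real (fst x) * ?P x) has_sum (N\<^sub>T + \<eta> * N\<^sub>S)) UNIV"
    using E[of "\<lambda>_. 0" "\<lambda>_. 1" "N\<^sub>T + \<eta> * N\<^sub>S"]
      has_sum_add[OF has_sum_cmult_right[OF m(1), of N\<^sub>T] has_sum_cmult_right[OF m(2), of \<eta>]]
    by (simp add: algebra_simps)
  have 2: "((\<lambda>x. real (snd x) * ?P x) has_sum N\<^sub>S) UNIV"
    using E[of real "\<lambda>_. 0" N\<^sub>S] m(2) by simp
  have 3: "((\<lambda>x. (real (fst x) * real (snd x)) * ?P x) has_sum (N\<^sub>T * N\<^sub>S + \<eta> * (2 * N\<^sub>S\<^sup>2 + N\<^sub>S))) UNIV"
    using E[of "\<lambda>_. 0" real "N\<^sub>T * N\<^sub>S + \<eta> * (2 * N\<^sub>S\<^sup>2 + N\<^sub>S)"]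
      has_sum_add[OF has_sum_cmult_right[OF m(2), of N\<^sub>T] has_sum_cmult_right[OF m(3), of \<eta>]]
    by (simp add: algebra_simps power2_eq_square)
  have "((\<lambda>x. c\<^sub>0 * ?P x + c\<^sub>1 * (real (fst x) * ?P x) + c\<^sub>2 * (real (snd x) * ?P x)
      + c\<^sub>3 * ((real (fst x) * real (snd x)) * ?P x)) has_sum
    c\<^sub>0 * 1 + c\<^sub>1 * (N\<^sub>T + \<eta> * N\<^sub>S) + c\<^sub>2 * N\<^sub>S + c\<^sub>3 * (N\<^sub>T * N\<^sub>S + \<eta> * (2 * N\<^sub>S\<^sup>2 + N\<^sub>S))) UNIV"
    by (intro has_sum_add has_sum_cmult_right 0 1 2 3)
  then show ?thesis by (simp add: algebra_simps)
qed

section \<open>Entropy bound for the averaged distribution\<close>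

text \<open>Bounding b choose m by b ^ m makes the sum a binomial expansion of (1 + b w) ^ k, to
  which Bernoulli applies. The term m = 0 alone gives the lower bound 1.\<close>

lemma choose_sum_bounds:
  fixes w :: real and b k :: nat
  assumes w: "0 \<le> w" "w < 1"
  defines "Q \<equiv> \<Sum>m\<le>k. real (b choose m) * real (k choose m) * w ^ m"
  shows "1 \<le> Q" and "ln Q \<le> - (real b * real k) * ln (1 - w)"
proof -
  have "(\<Sum>m\<in>{0}. real (b choose m) * real (k choose m) * w ^ m) \<le> Q"
    unfolding Q_def using w by (intro sum_mono2) auto
  then show Q1: "1 \<le> Q" by simp
  have "Q \<le> (\<Sum>m\<le>k. real (k choose m) * (real b * w) ^ m)"
    unfolding Q_def
  proof (rule sum_mono)
    fix m
    have "b choose m \<le> b ^ m"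
      by (cases "m \<le> b") (auto simp: binomial_le_pow binomial_eq_0)
    then have "real (b choose m) \<le> real b ^ m" by (metis of_nat_le_iff of_nat_power)
    then have "real (b choose m) * (real (k choose m) * w ^ m) \<le> real b ^ m * (real (k choose m) * w ^ m)"
      using w by (intro mult_right_mono) auto
    then show "real (b choose m) * real (k choose m) * w ^ m \<le> real (k choose m) * (real b * w) ^ m"
      by (simp add: power_mult_distrib mult_ac)
  qed
  also have "\<dots> = (1 + real b * w) ^ k"
    using w by (intro sum_choose_power(1)) auto
  also have "\<dots> \<le> ((1 + w) ^ b) ^ k"
    using w by (intro power_mono Bernoulli_inequality) auto
  finally have "Q \<le> (1 + w) ^ (b * k)" by (simp add: power_mult)
  then have "ln Q \<le> ln ((1 + w) ^ (b * k))" using Q1 w by (simp add: ln_mono)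
  also have "\<dots> = real b * real k * ln (1 + w)" using w by (simp add: ln_realpow)
  also have "\<dots> \<le> real b * real k * (- ln (1 - w))"
  proof (rule mult_left_mono)
    have "(1 + w) * (1 - w) \<le> 1" by (simp add: algebra_simps)
    then have "ln ((1 + w) * (1 - w)) \<le> 0" using w by (subst ln_le_zero_iff) auto
    then show "ln (1 + w) \<le> - ln (1 - w)" using w by (simp add: ln_mult)
  qed simp
  finally show "ln Q \<le> - (real b * real k) * ln (1 - w)" by simp
qed

lemma op_id_eq_diag: "op_id = op_diag (\<lambda>_. 1)"
  by (auto simp: op_id_def op_diag_def fun_eq_iff)

lemma diagonalizes_op_diag:
  assumes "bounded (range m)"
  shows "diagonalizes op_id m (op_diag (\<lambda>k. complex_of_real (m k)))"
proof -
  have "op_conjugate op_id A = A" for A :: "'a operator"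
    by (intro ext) (simp add: op_id_eq_diag op_conjugate_by_diag)
  moreover have "op_unitary (op_id :: 'a operator)"
    by (simp add: op_unitary_def op_id_eq_diag op_adj_diag op_mult_diag_left)
  ultimately show ?thesis using assms by (simp add: diagonalizes_def)
qed

lemma vN_entropy_phase_average_ge:
  assumes \<eta>: "0 < \<eta>" "\<eta> < 1" and NT: "N\<^sub>T > \<eta>" and NS: "N\<^sub>S > 0"
  defines "C \<equiv> 1 / ((N\<^sub>S + 1) * (N\<^sub>T + 1))" and "q\<^sub>1 \<equiv> N\<^sub>T / (N\<^sub>T + 1)"
    and "q\<^sub>2 \<equiv> N\<^sub>S / (N\<^sub>S + 1) * (N\<^sub>T + 1 - \<eta>) / (N\<^sub>T + 1)"
    and "w \<equiv> \<eta> / (N\<^sub>T * (N\<^sub>T + 1 - \<eta>))"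
  shows "vN_entropy (op_diag (\<lambda>x. complex_of_real (avg_pmf \<eta> N\<^sub>T N\<^sub>S x))) \<ge>
    - ln C - ln q\<^sub>1 * (N\<^sub>T + \<eta> * N\<^sub>S) - ln q\<^sub>2 * N\<^sub>S + ln (1 - w) * (N\<^sub>T * N\<^sub>S + \<eta> * (2 * N\<^sub>S\<^sup>2 + N\<^sub>S))"
proof -
  have NT0: "N\<^sub>T > 0" using \<eta> NT by simp
  let ?P = "avg_pmf \<eta> N\<^sub>T N\<^sub>S"
  note E = avg_pmf_affine_expectation[OF \<eta> NT0 NS]
  have C: "0 < C" "C \<le> 1" using NS NT0 by (simp_all add: C_def mult_ge1_I)
  have q1: "0 < q\<^sub>1" "q\<^sub>1 \<le> 1" using NT0 by (simp_all add: q\<^sub>1_def)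
  have "N\<^sub>S / (N\<^sub>S + 1) * ((N\<^sub>T + 1 - \<eta>) / (N\<^sub>T + 1)) \<le> 1 * 1"
    using NS NT0 \<eta> by (intro mult_mono) auto
  then have q2: "0 < q\<^sub>2" "q\<^sub>2 \<le> 1" using NS NT0 \<eta> by (simp_all add: q\<^sub>2_def)
  \<comment> \<open>This is where \<open>N\<^sub>T > \<eta>\<close> enters: the difference of the
    two sides factors, and its positivity is w < 1.\<close>
  have "\<eta> < N\<^sub>T * (N\<^sub>T + 1 - \<eta>)"
  proof -
    have "0 < (N\<^sub>T - \<eta>) * (N\<^sub>T + 1)" using NT NT0 by simp
    then show ?thesis by (simp add: algebra_simps)
  qed
  then have w: "0 \<le> w" "w < 1" using \<eta> NT0 by (simp_all add: w_def)
  define Q where "Q x = (\<Sum>m\<le>snd x. real (fst x choose m) * real (snd x choose m) * w ^ m)" for x :: "nat \<times> nat"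
  have Q: "1 \<le> Q x" "ln (Q x) \<le> - (real (fst x) * real (snd x)) * ln (1 - w)" for x
    unfolding Q_def by (rule choose_sum_bounds[OF w])+
  have P: "?P x = C * q\<^sub>1 ^ fst x * q\<^sub>2 ^ snd x * Q x" for x
    by (simp add: avg_pmf_def C_def q\<^sub>1_def q\<^sub>2_def w_def Q_def)
  have Q0: "0 < Q x" for x using Q(1)[of x] by linarith
  have Ppos: "0 < ?P x" for x unfolding P using C q1 q2 Q0[of x] by simp
  have Ple1: "?P x \<le> 1" for x
    using finite_sum_le_has_sum[OF E[of 1 0 0 0], of "{x}"] Ppos by (simp add: less_imp_le)
  have lnP: "- ln (?P x) = - ln C + - ln q\<^sub>1 * real (fst x) + - ln q\<^sub>2 * real (snd x) - ln (Q x)" for x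
    unfolding P using C(1) q1(1) q2(1) Q0[of x] by (simp add: ln_mult ln_realpow)
  \<comment> \<open>Since ln Q is nonnegative, dropping it leaves an affine majorant with finite
    expectation. It secures convergence of the entropy sum, which would otherwise default to
    0.\<close>
  have upper: "((\<lambda>x. (- ln C + - ln q\<^sub>1 * real (fst x) + - ln q\<^sub>2 * real (snd x)) * ?P x) has_sum
      (- ln C + - ln q\<^sub>1 * (N\<^sub>T + \<eta> * N\<^sub>S) + - ln q\<^sub>2 * N\<^sub>S)) UNIV"
    using E[of "- ln C" "- ln q\<^sub>1" "- ln q\<^sub>2" 0] by simp
  have lower: "((\<lambda>x. (- ln C + - ln q\<^sub>1 * real (fst x) + - ln q\<^sub>2 * real (snd x)
        + ln (1 - w) * (real (fst x) * real (snd x))) * ?P x) has_sum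
      (- ln C + - ln q\<^sub>1 * (N\<^sub>T + \<eta> * N\<^sub>S) + - ln q\<^sub>2 * N\<^sub>S
        + ln (1 - w) * (N\<^sub>T * N\<^sub>S + \<eta> * (2 * N\<^sub>S\<^sup>2 + N\<^sub>S)))) UNIV"
    by (rule E)
  have "(\<lambda>x. - (?P x * ln (?P x))) summable_on UNIV"
  proof (rule summable_on_comparison_test[OF has_sum_imp_summable[OF upper]])
    fix x
    have "- ln (?P x) * ?P x \<le> (- ln C + - ln q\<^sub>1 * real (fst x) + - ln q\<^sub>2 * real (snd x)) * ?P x"
      unfolding lnP using Q(1)[of x] Ppos[of x] by (intro mult_right_mono) auto
    then show "- (?P x * ln (?P x)) \<le> (- ln C + - ln q\<^sub>1 * real (fst x) + - ln q\<^sub>2 * real (snd x)) * ?P x"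
      by (simp add: mult.commute)
    show "0 \<le> - (?P x * ln (?P x))"
      using Ppos[of x] Ple1[of x] by (simp add: mult_nonneg_nonpos)
  qed
  then have H: "((\<lambda>x. - (?P x * ln (?P x))) has_sum (\<Sum>\<^sub>\<infinity>x. - (?P x * ln (?P x)))) UNIV"
    by (rule has_sum_infsum)
  have "bounded (range ?P)"
    using Ppos Ple1 by (auto simp: bounded_iff abs_of_pos intro!: exI[of _ 1])
  from vN_entropy_diagonalizes[OF diagonalizes_op_diag[OF this] less_imp_le[OF Ppos] Ple1 H]
  have "vN_entropy (op_diag (\<lambda>x. complex_of_real (?P x))) = (\<Sum>\<^sub>\<infinity>x. - (?P x * ln (?P x)))" .
  moreover have "- ln C + - ln q\<^sub>1 * (N\<^sub>T + \<eta> * N\<^sub>S) + - ln q\<^sub>2 * N\<^sub>S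
        + ln (1 - w) * (N\<^sub>T * N\<^sub>S + \<eta> * (2 * N\<^sub>S\<^sup>2 + N\<^sub>S)) \<le> (\<Sum>\<^sub>\<infinity>x. - (?P x * ln (?P x)))"
  proof (rule has_sum_mono[OF lower H])
    fix x
    have "- ln C + - ln q\<^sub>1 * real (fst x) + - ln q\<^sub>2 * real (snd x)
        + ln (1 - w) * (real (fst x) * real (snd x)) \<le> - ln (?P x)"
      unfolding lnP using Q(2)[of x] by (simp add: mult.commute)
    from mult_right_mono[OF this less_imp_le[OF Ppos]]
    show "(- ln C + - ln q\<^sub>1 * real (fst x) + - ln q\<^sub>2 * real (snd x)
        + ln (1 - w) * (real (fst x) * real (snd x))) * ?P x \<le> - (?P x * ln (?P x))"
      by (simp add: mult.commute)
  qed
  ultimately show ?thesis by simp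
qed

theorem theorem1:
  fixes \<eta> N\<^sub>B N\<^sub>T N\<^sub>S :: real
  assumes "0 < \<eta>" and "\<eta> < 1"
    and "N\<^sub>B \<ge> 0"
    and "N\<^sub>T = (1 - \<eta>) * N\<^sub>B"
    and "N\<^sub>S > 0"
    and "N\<^sub>T > max \<eta> (\<eta> * N\<^sub>S - 1)"
  shows "holevo_ring \<eta> N\<^sub>B (tmsv_state N\<^sub>S) \<ge>
      C_EA \<eta> N\<^sub>S N\<^sub>T + g N\<^sub>T - g (\<eta> * N\<^sub>S + N\<^sub>T)
      + (2 * \<eta> * N\<^sub>S + N\<^sub>T) * N\<^sub>S
          * ln (((N\<^sub>T + 1) * (N\<^sub>T - \<eta>)) / (N\<^sub>T * (N\<^sub>T - \<eta> + 1)))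
      + N\<^sub>S * ln ((N\<^sub>T + 1) / (N\<^sub>T - \<eta> + 1))
      + \<eta> * N\<^sub>S * ln (((N\<^sub>T + 1)\<^sup>2 * (N\<^sub>T - \<eta>)) / (N\<^sub>T\<^sup>2 * (N\<^sub>T - \<eta> + 1)))"
proof -
  have \<eta>: "0 < \<eta>" "\<eta> < 1" and NB: "N\<^sub>B \<ge> 0" and NT: "N\<^sub>T = (1 - \<eta>) * N\<^sub>B" and NS: "N\<^sub>S > 0" and NT\<eta>: "N\<^sub>T > \<eta>"
    using assms by simp_all
  have NT0: "N\<^sub>T > 0" using \<eta> NT\<eta> by simp
  let ?G = "g ((mu_plus \<eta> N\<^sub>S N\<^sub>T - 1) / 2) + g ((mu_minus \<eta> N\<^sub>S N\<^sub>T - 1) / 2)"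
  \<comment> \<open>The entropy of the output state is the same for every \<theta>, so its phase
    average is the integral of a constant.\<close>
  have holevo: "holevo_ring \<eta> N\<^sub>B (tmsv_state N\<^sub>S) = vN_entropy (op_diag (\<lambda>x. complex_of_real (avg_pmf \<eta> N\<^sub>T N\<^sub>S x))) - ?G"
    unfolding holevo_ring_def phase_average_output_state[OF \<eta> NB NT NS NT0]
      vN_entropy_output_state[OF \<eta> NB NT NS NT0] by simp
  \<comment> \<open>Naming the six elementary logarithms makes every logarithm in the bound and in
    the claim a linear combination of them.\<close>
  define a where "a = ln (N\<^sub>T + 1)"
  define b where "b = ln N\<^sub>T"
  define c where "c = ln (N\<^sub>T + 1 - \<eta>)"
  define d where "d = ln (N\<^sub>T - \<eta>)"
  define s where "s = ln (N\<^sub>S + 1)"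
  define r where "r = ln N\<^sub>S"
  have pos: "N\<^sub>T + 1 > 0" "N\<^sub>T + 1 - \<eta> > 0" "N\<^sub>T - \<eta> > 0" "N\<^sub>S + 1 > 0" using \<eta> NT\<eta> NS by auto
  have c': "N\<^sub>T - \<eta> + 1 = N\<^sub>T + 1 - \<eta>" by simp
  have l1: "ln (1 / ((N\<^sub>S + 1) * (N\<^sub>T + 1))) = - s - a"
    using pos by (simp add: ln_div ln_mult s_def a_def)
  have l2: "ln (N\<^sub>T / (N\<^sub>T + 1)) = b - a" using pos NT0 by (simp add: ln_div a_def b_def)
  have l3: "ln (N\<^sub>S / (N\<^sub>S + 1) * (N\<^sub>T + 1 - \<eta>) / (N\<^sub>T + 1)) = r - s + c - a"
    using pos NS by (simp add: ln_div ln_mult a_def c_def r_def s_def)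
  have w: "1 - \<eta> / (N\<^sub>T * (N\<^sub>T + 1 - \<eta>)) = ((N\<^sub>T + 1) * (N\<^sub>T - \<eta>)) / (N\<^sub>T * (N\<^sub>T + 1 - \<eta>))"
  proof -
    have "N\<^sub>T * (N\<^sub>T + 1 - \<eta>) \<noteq> 0" using pos NT0 by simp
    then have "1 - \<eta> / (N\<^sub>T * (N\<^sub>T + 1 - \<eta>)) = (N\<^sub>T * (N\<^sub>T + 1 - \<eta>) - \<eta>) / (N\<^sub>T * (N\<^sub>T + 1 - \<eta>))"
      by (metis diff_divide_distrib divide_self)
    also have "N\<^sub>T * (N\<^sub>T + 1 - \<eta>) - \<eta> = (N\<^sub>T + 1) * (N\<^sub>T - \<eta>)" by (simp add: algebra_simps)
    finally show ?thesis .
  qed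
  have l4: "ln (((N\<^sub>T + 1) * (N\<^sub>T - \<eta>)) / (N\<^sub>T * (N\<^sub>T + 1 - \<eta>))) = a + d - b - c"
    using pos NT0 by (simp add: ln_div ln_mult a_def b_def c_def d_def)
  have l5: "ln ((N\<^sub>T + 1) / (N\<^sub>T + 1 - \<eta>)) = a - c" using pos by (simp add: ln_div a_def c_def)
  have l6: "ln (((N\<^sub>T + 1)\<^sup>2 * (N\<^sub>T - \<eta>)) / (N\<^sub>T\<^sup>2 * (N\<^sub>T + 1 - \<eta>))) = 2 * a + d - 2 * b - c"
    using pos NT0 by (simp add: ln_div ln_mult ln_realpow a_def b_def c_def d_def)
  have gS: "g N\<^sub>S = (N\<^sub>S + 1) * s - N\<^sub>S * r" and gT: "g N\<^sub>T = (N\<^sub>T + 1) * a - N\<^sub>T * b"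
    by (simp_all add: g_def a_def b_def s_def r_def)
  \<comment> \<open>With the logarithms as symbols this is a polynomial identity. The term
    \<open>g (\<eta> * N\<^sub>S + N\<^sub>T)\<close> does not occur, because the claim subtracts
    the copy contained in \<open>C_EA\<close>.\<close>
  have "- (- s - a) - (b - a) * (N\<^sub>T + \<eta> * N\<^sub>S) - (r - s + c - a) * N\<^sub>S
      + (a + d - b - c) * (N\<^sub>T * N\<^sub>S + \<eta> * (2 * N\<^sub>S\<^sup>2 + N\<^sub>S)) =
    g N\<^sub>S + g N\<^sub>T + (2 * \<eta> * N\<^sub>S + N\<^sub>T) * N\<^sub>S * (a + d - b - c) + N\<^sub>S * (a - c) + \<eta> * N\<^sub>S * (2 * a + d - 2 * b - c)"
    unfolding gS gT by (simp add: power2_eq_square algebra_simps)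
  with vN_entropy_phase_average_ge[OF \<eta> NT\<eta> NS] show ?thesis
    unfolding holevo C_EA_def c' w l1 l2 l3 l4 l5 l6 by linarith
qed

end
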